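(* Let $q\in\mathbb{C}\setminus\{0\}$ be not a root of $1$. With grading jump $\operatorname{GJ}=-1$, there exist two 2-parameter series of $U_q(\mathfrak{sl}_2)$-symmetries on $\operatorname{Pol}(\mathbb{D})_q$ as follows. $(-1a)$, for $b_0,b_1\in\mathbb{C}$ with $b_1\ne 0$: $$\pi(\mathsf{k})(z)=q^{-2}z,\qquad \pi(\mathsf{k})(z^* )=q^{2}z^*,$$ $$\pi(\mathsf{e})(y)=-qb_1^{-1}z^*,\qquad \pi(\mathsf{f})(y)=z(b_0+b_1y),$$ $$\pi(\mathsf{e})(z)=q^{-1}b_1^{-1},\qquad \pi(\mathsf{f})(z)=-q^2b_1z^2,$$ $$\pi(\mathsf{e})(z^* )=0,\qquad \pi(\mathsf{f})(z^* )=-q^{-2}b_0+b_1-(1+q^{-2})b_1y.$$ $(-1b)$, for $a_0,a_1\in\mathbb{C}$ with $a_1\ne 0$: $$\pi(\mathsf{k})(z)=q^{-2}z,\qquad \pi(\mathsf{k})(z^* )=q^{2}z^*,$$ $$\pi(\mathsf{e})(y)=(a_0+a_1y)z^*,\qquad \pi(\mathsf{f})(y)=-qa_1^{-1}z,$$ $$\pi(\mathsf{e})(z)=-q^{-2}a_0+a_1-(1+q^{-2})a_1y,\qquad \pi(\mathsf{f})(z)=0,$$ $$\pi(\mathsf{e})(z^* )=-q^2a_1z^{*2},\qquad \pi(\mathsf{f})(z^* )=q^{-1}a_1^{-1}.$$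
   Context: The ground field is $\mathbb{C}$. The quantum disc $\operatorname{Pol}(\mathbb{D})_q$ is the unital $\mathbb{C}$-algebra generated by $z,z^*$ subject to the single relation $zz^*=q^2z^*z+1-q^2$; it is considered as an algebra without involution, so $z^*$ is just a symbol for a second generator, and $z^{*j}=(z^* )^j$. Put $y=1-zz^*$. The algebra is graded, $\operatorname{Pol}(\mathbb{D})_q=\bigoplus_{k\in\mathbb{Z}}\mathcal{A}_k$, where $\mathcal{A}_k$ is the linear span of $\{z^iz^{*j} : i-j=k\}$. $U_q(\mathfrak{sl}_2)$ is the unital associative algebra generated by $\mathsf{k},\mathsf{k}^{-1},\mathsf{e},\mathsf{f}$ subject to $\mathsf{k}^{-1}\mathsf{k}=\mathsf{k}\mathsf{k}^{-1}=\mathbf{1}$, $\mathsf{ke}=q^2\mathsf{ek}$, $\mathsf{kf}=q^{-2}\mathsf{fk}$, $\mathsf{ef}-\mathsf{fe}=\frac{\mathsf{k}-\mathsf{k}^{-1}}{q-q^{-1}}$, with Hopf algebra structure $\Delta(\mathsf{k})=\mathsf{k}\otimes\mathsf{k}$, $\Delta(\mathsf{e})=\mathbf{1}\otimes\mathsf{e}+\mathsf{e}\otimes\mathsf{k}$, $\Delta(\mathsf{f})=\mathsf{f}\otimes\mathbf{1}+\mathsf{k}^{-1}\otimes\mathsf{f}$, $\mathsf{S}(\mathsf{k})=\mathsf{k}^{-1}$, $\mathsf{S}(\mathsf{e})=-\mathsf{ek}^{-1}$, $\mathsf{S}(\mathsf{f})=-\mathsf{kf}$, $\varepsilon(\mathsf{k})=1$,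 $\varepsilon(\mathsf{e})=\varepsilon(\mathsf{f})=0$. For a Hopf algebra $H$ and a unital algebra $A$, an $H$-symmetry on $A$ is a homomorphism of algebras $\pi:H\to\operatorname{End}_{\mathbb{C}}A$ such that $\pi(h)(ab)=\sum_{(h)}\pi(h_{(1)})(a)\,\pi(h_{(2)})(b)$ and $\pi(h)(\mathbf{1})=\varepsilon(h)\mathbf{1}$ for all $h\in H$, $a,b\in A$. A symmetry is described by the action of the generators of $U_q(\mathfrak{sl}_2)$ on the generators $z,z^*$, which extends uniquely to everything. Grading jump: for every $U_q(\mathfrak{sl}_2)$-symmetry $\pi$ on $\operatorname{Pol}(\mathbb{D})_q$, if $\pi(\mathsf{e})$ and $\pi(\mathsf{f})$ are not both identically zero, then there is a unique non-zero integer $n$ such that $\pi(\mathsf{e})\mathcal{A}_k\subset\mathcal{A}_{k+n}$ and $\pi(\mathsf{f})\mathcal{A}_k\subset\mathcal{A}_{k-n}$ for all $k\in\mathbb{Z}$; this $n$ is called the grading jump $\operatorname{GJ}$ of $\pi$. If $\pi(\mathsf{e})=\pi(\mathsf{f})=0$, one sets $\operatorname{GJ}=0$. *)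

theory Defs
  imports Complex_Main "HOL-Library.Poly_Mapping" "HOL-Algebra.QuotRing" "HOL-Algebra.Module"
begin

section \<open>Complex algebras\<close>

text \<open>
  A (not necessarily commutative) complex algebra is a HOL-Algebra record of type
  \<open>(complex, 'a) module\<close>; the scalars are the whole type \<^typ>\<open>complex\<close>.
\<close>

definition lin_span :: "(complex, 'a, 'x) module_scheme \<Rightarrow> 'a set \<Rightarrow> 'a set" where
  "lin_span A S = {(\<Oplus>\<^bsub>A\<^esub> s \<in> F. c s \<odot>\<^bsub>A\<^esub> s) | F c. finite F \<and> F \<subseteq> S}"

definition algebra_hom ::
    "(complex, 'a, 'x) module_scheme \<Rightarrow> (complex, 'b, 'y) module_scheme \<Rightarrow> ('a \<Rightarrow> 'b) set" where
  "algebra_hom A B =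
    {h \<in> ring_hom A B. \<forall>c. \<forall>x \<in> carrier A. h (c \<odot>\<^bsub>A\<^esub> x) = c \<odot>\<^bsub>B\<^esub> h x}"

definition complex_algebra :: "(complex, complex) module" where
  "complex_algebra =
    \<lparr>carrier = UNIV, mult = (*), one = 1, zero = 0, add = (+), smult = (*)\<rparr>"

definition opposite_algebra :: "(complex, 'a, 'x) module_scheme \<Rightarrow> (complex, 'a, 'x) module_scheme" where
  "opposite_algebra A = A\<lparr>mult := \<lambda>x y. y \<otimes>\<^bsub>A\<^esub> x\<rparr>"

text \<open>Linear maps are taken extensional, so that equality in the algebra is equality of maps.\<close>

definition End_algebra :: "(complex, 'a, 'x) module_scheme \<Rightarrow> (complex, 'a \<Rightarrow> 'a) module" where
  "End_algebra A =
    \<lparr>carrier = {f \<in> carrier A \<rightarrow>\<^sub>E carrier A.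
        (\<forall>x \<in> carrier A. \<forall>y \<in> carrier A. f (x \<oplus>\<^bsub>A\<^esub> y) = f x \<oplus>\<^bsub>A\<^esub> f y) \<and>
        (\<forall>c. \<forall>x \<in> carrier A. f (c \<odot>\<^bsub>A\<^esub> x) = c \<odot>\<^bsub>A\<^esub> f x)},
     mult = (\<lambda>f g. compose (carrier A) f g),
     one = (\<lambda>x \<in> carrier A. x),
     zero = (\<lambda>x \<in> carrier A. \<zero>\<^bsub>A\<^esub>),
     add = (\<lambda>f g. \<lambda>x \<in> carrier A. f x \<oplus>\<^bsub>A\<^esub> g x),
     smult = (\<lambda>c f. \<lambda>x \<in> carrier A. c \<odot>\<^bsub>A\<^esub> f x)\<rparr>"

definition quotient_algebra ::
    "(complex, 'a, 'x) module_scheme \<Rightarrow> 'a set \<Rightarrow> (complex, 'a set) module" where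
  "quotient_algebra A I =
    \<lparr>carrier = carrier (A Quot I), mult = mult (A Quot I), one = one (A Quot I),
     zero = zero (A Quot I), add = add (A Quot I),
     smult = (\<lambda>c X. \<Union>x \<in> X. I +>\<^bsub>A\<^esub> (c \<odot>\<^bsub>A\<^esub> x))\<rparr>"

text \<open>The monoid algebra: formal linear combinations of elements of \<open>M\<close>, multiplied bilinearly.\<close>

definition monoid_algebra :: "('m, 'x) monoid_scheme \<Rightarrow> (complex, 'm \<Rightarrow>\<^sub>0 complex) module" where
  "monoid_algebra M =
    \<lparr>carrier = {p. Poly_Mapping.keys p \<subseteq> carrier M},
     mult = (\<lambda>p p'. \<Sum>u \<in> Poly_Mapping.keys p. \<Sum>v \<in> Poly_Mapping.keys p'.
       Poly_Mapping.single (u \<otimes>\<^bsub>M\<^esub> v) (Poly_Mapping.lookup p u * Poly_Mapping.lookup p' v)),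
     one = Poly_Mapping.single \<one>\<^bsub>M\<^esub> 1, zero = 0, add = (+),
     smult = (\<lambda>c. Poly_Mapping.map ((*) c))\<rparr>"


section \<open>Algebras given by generators and relations\<close>

definition free_algebra :: "(complex, 'g list \<Rightarrow>\<^sub>0 complex) module" where
  "free_algebra = monoid_algebra \<lparr>carrier = UNIV, mult = (@), one = []\<rparr>"

definition presented_algebra ::
    "('g list \<Rightarrow>\<^sub>0 complex) set \<Rightarrow> (complex, ('g list \<Rightarrow>\<^sub>0 complex) set) module" where
  "presented_algebra R = quotient_algebra free_algebra (Idl\<^bsub>free_algebra\<^esub> R)"

definition generator :: "('g list \<Rightarrow>\<^sub>0 complex) set \<Rightarrow> 'g \<Rightarrow> ('g list \<Rightarrow>\<^sub>0 complex) set" where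
  "generator R g = Idl\<^bsub>free_algebra\<^esub> R +>\<^bsub>free_algebra\<^esub> Poly_Mapping.single [g] 1"

definition eval_free ::
    "(complex, 'a, 'x) module_scheme \<Rightarrow> ('g \<Rightarrow> 'a) \<Rightarrow> ('g list \<Rightarrow>\<^sub>0 complex) \<Rightarrow> 'a" where
  "eval_free A \<phi> p = (\<Oplus>\<^bsub>A\<^esub> w \<in> Poly_Mapping.keys p.
     Poly_Mapping.lookup p w \<odot>\<^bsub>A\<^esub> foldr (\<lambda>g a. \<phi> g \<otimes>\<^bsub>A\<^esub> a) w \<one>\<^bsub>A\<^esub>)"

text \<open>
  The homomorphism from a presented algebra to \<open>A\<close> that sends the generator \<open>g\<close> to \<open>\<phi> g\<close>: if
  the values \<open>\<phi> g\<close> satisfy the defining relations, then \<open>eval_free A \<phi>\<close> is constant on each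
  coset \<open>X\<close>, so the image of \<open>X\<close> is a singleton.
\<close>

definition extend_hom ::
    "(complex, 'a, 'x) module_scheme \<Rightarrow> ('g \<Rightarrow> 'a) \<Rightarrow> ('g list \<Rightarrow>\<^sub>0 complex) set \<Rightarrow> 'a" where
  "extend_hom A \<phi> X = the_elem (eval_free A \<phi> ` X)"


section \<open>Tensor products\<close>

text \<open>
  The carrier of \<open>monoid_algebra (H \<times>\<times> K)\<close> is the vector space freely spanned by the pairs
  \<open>(x, y)\<close>, and its product is \<open>(x, y) (x', y') = (x x', y y')\<close>. So its quotient by the span
  of the bilinearity relations is \<open>H \<otimes> K\<close> with the usual product.
\<close>

definition bilinear_relations ::
    "(complex, 'h, 'x) module_scheme \<Rightarrow> (complex, 'k, 'y) module_scheme \<Rightarrow>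
      ('h \<times> 'k \<Rightarrow>\<^sub>0 complex) set" where
  "bilinear_relations H K =
    {Poly_Mapping.single (x \<oplus>\<^bsub>H\<^esub> x', y) 1 - Poly_Mapping.single (x, y) 1
        - Poly_Mapping.single (x', y) 1
      | x x' y. x \<in> carrier H \<and> x' \<in> carrier H \<and> y \<in> carrier K} \<union>
    {Poly_Mapping.single (x, y \<oplus>\<^bsub>K\<^esub> y') 1 - Poly_Mapping.single (x, y) 1
        - Poly_Mapping.single (x, y') 1
      | x y y'. x \<in> carrier H \<and> y \<in> carrier K \<and> y' \<in> carrier K} \<union>
    {Poly_Mapping.single (c \<odot>\<^bsub>H\<^esub> x, y) 1 - Poly_Mapping.single (x, y) c
      | c x y. x \<in> carrier H \<and> y \<in> carrier K} \<union>
    {Poly_Mapping.single (x, c \<odot>\<^bsub>K\<^esub> y) 1 - Poly_Mapping.single (x, y) c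
      | c x y. x \<in> carrier H \<and> y \<in> carrier K}"

definition tensor_null ::
    "(complex, 'h, 'x) module_scheme \<Rightarrow> (complex, 'k, 'y) module_scheme \<Rightarrow>
      ('h \<times> 'k \<Rightarrow>\<^sub>0 complex) set" where
  "tensor_null H K = lin_span (monoid_algebra (H \<times>\<times> K)) (bilinear_relations H K)"

definition tensor_algebra ::
    "(complex, 'h, 'x) module_scheme \<Rightarrow> (complex, 'k, 'y) module_scheme \<Rightarrow>
      (complex, ('h \<times> 'k \<Rightarrow>\<^sub>0 complex) set) module" where
  "tensor_algebra H K = quotient_algebra (monoid_algebra (H \<times>\<times> K)) (tensor_null H K)"

definition pure_tensor ::
    "(complex, 'h, 'x) module_scheme \<Rightarrow> (complex, 'k, 'y) module_scheme \<Rightarrow> 'h \<Rightarrow> 'k \<Rightarrow>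
      ('h \<times> 'k \<Rightarrow>\<^sub>0 complex) set" where
  "pure_tensor H K x y =
    tensor_null H K +>\<^bsub>monoid_algebra (H \<times>\<times> K)\<^esub> Poly_Mapping.single (x, y) 1"

text \<open>
  The linear map \<open>x \<otimes> y \<mapsto> \<beta> x y\<close> induced on the tensor product by a bilinear map \<open>\<beta>\<close>; it is
  again constant on cosets.
\<close>

definition tensor_map ::
    "(complex, 'a, 'x) module_scheme \<Rightarrow> ('h \<Rightarrow> 'k \<Rightarrow> 'a) \<Rightarrow>
      ('h \<times> 'k \<Rightarrow>\<^sub>0 complex) set \<Rightarrow> 'a" where
  "tensor_map A \<beta> T = the_elem ((\<lambda>t. \<Oplus>\<^bsub>A\<^esub> u \<in> Poly_Mapping.keys t.
     Poly_Mapping.lookup t u \<odot>\<^bsub>A\<^esub> \<beta> (fst u) (snd u)) ` T)"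


section \<open>Symmetries\<close>

record 'h hopf_algebra = "(complex, 'h) module" +
  comult :: "'h \<Rightarrow> ('h \<times> 'h \<Rightarrow>\<^sub>0 complex) set"
  counit :: "'h \<Rightarrow> complex"
  antipode :: "'h \<Rightarrow> 'h"

text \<open>
  In Sweedler notation, the \<open>tensor_map\<close> term below is the sum of
  \<open>\<pi> h\<^sub>1 a \<otimes>\<^bsub>A\<^esub> \<pi> h\<^sub>2 b\<close>, where \<open>\<otimes>\<^bsub>A\<^esub>\<close> is the product of \<open>A\<close>.
\<close>

definition hopf_symmetry ::
    "('h, 'x) hopf_algebra_scheme \<Rightarrow> (complex, 'a, 'y) module_scheme \<Rightarrow> ('h \<Rightarrow> 'a \<Rightarrow> 'a) \<Rightarrow> bool" where
  "hopf_symmetry H A \<pi> \<longleftrightarrow>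
    \<pi> \<in> algebra_hom H (End_algebra A) \<and>
    (\<forall>h \<in> carrier H. \<forall>a \<in> carrier A. \<forall>b \<in> carrier A.
      \<pi> h (a \<otimes>\<^bsub>A\<^esub> b) = tensor_map A (\<lambda>x y. \<pi> x a \<otimes>\<^bsub>A\<^esub> \<pi> y b) (comult H h)) \<and>
    (\<forall>h \<in> carrier H. \<pi> h \<one>\<^bsub>A\<^esub> = counit H h \<odot>\<^bsub>A\<^esub> \<one>\<^bsub>A\<^esub>)"


section \<open>The quantum disc\<close>

text \<open>\<open>Gen_zs\<close> is the second generator, written $z^*$; there is no involution.\<close>

datatype disc_gen = Gen_z | Gen_zs

definition disc_relations :: "complex \<Rightarrow> (disc_gen list \<Rightarrow>\<^sub>0 complex) set" where
  "disc_relations q =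
    {Poly_Mapping.single [Gen_z, Gen_zs] 1 -
      (Poly_Mapping.single [Gen_zs, Gen_z] (q^2) + Poly_Mapping.single [] (1 - q^2))}"

type_synonym disc_elem = "(disc_gen list \<Rightarrow>\<^sub>0 complex) set"

definition Pol_disc :: "complex \<Rightarrow> (complex, disc_elem) module" where
  "Pol_disc q = presented_algebra (disc_relations q)"

definition disc_z :: "complex \<Rightarrow> disc_elem" where
  "disc_z q = generator (disc_relations q) Gen_z"

definition disc_zs :: "complex \<Rightarrow> disc_elem" where
  "disc_zs q = generator (disc_relations q) Gen_zs"

definition disc_y :: "complex \<Rightarrow> disc_elem" where
  "disc_y q = \<one>\<^bsub>Pol_disc q\<^esub> \<ominus>\<^bsub>Pol_disc q\<^esub> (disc_z q \<otimes>\<^bsub>Pol_disc q\<^esub> disc_zs q)"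

definition disc_grade :: "complex \<Rightarrow> int \<Rightarrow> disc_elem set" where
  "disc_grade q k = lin_span (Pol_disc q)
    {(disc_z q [^]\<^bsub>Pol_disc q\<^esub> i) \<otimes>\<^bsub>Pol_disc q\<^esub> (disc_zs q [^]\<^bsub>Pol_disc q\<^esub> j)
      | (i::nat) (j::nat). int i - int j = k}"


section \<open>The quantum universal enveloping algebra of sl2\<close>

datatype uq_gen = Gen_k | Gen_kinv | Gen_e | Gen_f

definition uq_relations :: "complex \<Rightarrow> (uq_gen list \<Rightarrow>\<^sub>0 complex) set" where
  "uq_relations q =
    {Poly_Mapping.single [Gen_kinv, Gen_k] 1 - Poly_Mapping.single [] 1,
     Poly_Mapping.single [Gen_k, Gen_kinv] 1 - Poly_Mapping.single [] 1,
     Poly_Mapping.single [Gen_k, Gen_e] 1 - Poly_Mapping.single [Gen_e, Gen_k] (q^2),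
     Poly_Mapping.single [Gen_k, Gen_f] 1 - Poly_Mapping.single [Gen_f, Gen_k] (q powi (-2)),
     (Poly_Mapping.single [Gen_e, Gen_f] 1 - Poly_Mapping.single [Gen_f, Gen_e] 1) -
     (Poly_Mapping.single [Gen_k] (1 / (q - inverse q))
       - Poly_Mapping.single [Gen_kinv] (1 / (q - inverse q)))}"

type_synonym uq_elem = "(uq_gen list \<Rightarrow>\<^sub>0 complex) set"

definition Uq_algebra :: "complex \<Rightarrow> (complex, uq_elem) module" where
  "Uq_algebra q = presented_algebra (uq_relations q)"

definition uq_k :: "complex \<Rightarrow> uq_elem" where
  "uq_k q = generator (uq_relations q) Gen_k"

definition uq_kinv :: "complex \<Rightarrow> uq_elem" where
  "uq_kinv q = generator (uq_relations q) Gen_kinv"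

definition uq_e :: "complex \<Rightarrow> uq_elem" where
  "uq_e q = generator (uq_relations q) Gen_e"

definition uq_f :: "complex \<Rightarrow> uq_elem" where
  "uq_f q = generator (uq_relations q) Gen_f"

definition uq_comult_gen :: "complex \<Rightarrow> uq_gen \<Rightarrow> (uq_elem \<times> uq_elem \<Rightarrow>\<^sub>0 complex) set" where
  "uq_comult_gen q g =
    (let U = Uq_algebra q; T = tensor_algebra U U; tens = pure_tensor U U in
     case g of
       Gen_k \<Rightarrow> tens (uq_k q) (uq_k q)
     | Gen_kinv \<Rightarrow> tens (uq_kinv q) (uq_kinv q)
     | Gen_e \<Rightarrow> tens \<one>\<^bsub>U\<^esub> (uq_e q) \<oplus>\<^bsub>T\<^esub> tens (uq_e q) (uq_k q)
     | Gen_f \<Rightarrow> tens (uq_f q) \<one>\<^bsub>U\<^esub> \<oplus>\<^bsub>T\<^esub> tens (uq_kinv q) (uq_f q))"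

definition uq_counit_gen :: "uq_gen \<Rightarrow> complex" where
  "uq_counit_gen g = (case g of Gen_k \<Rightarrow> 1 | Gen_kinv \<Rightarrow> 1 | Gen_e \<Rightarrow> 0 | Gen_f \<Rightarrow> 0)"

definition uq_antipode_gen :: "complex \<Rightarrow> uq_gen \<Rightarrow> uq_elem" where
  "uq_antipode_gen q g =
    (let U = Uq_algebra q in
     case g of
       Gen_k \<Rightarrow> uq_kinv q
     | Gen_kinv \<Rightarrow> uq_k q
     | Gen_e \<Rightarrow> \<ominus>\<^bsub>U\<^esub> (uq_e q \<otimes>\<^bsub>U\<^esub> uq_kinv q)
     | Gen_f \<Rightarrow> \<ominus>\<^bsub>U\<^esub> (uq_k q \<otimes>\<^bsub>U\<^esub> uq_f q))"

text \<open>
  The comultiplication and the counit are algebra homomorphisms and the antipode is an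
  antihomomorphism, so that the values on the generators determine them.
\<close>

definition Uq :: "complex \<Rightarrow> uq_elem hopf_algebra" where
  "Uq q = (let U = Uq_algebra q in
    \<lparr>carrier = carrier U, mult = mult U, one = one U, zero = zero U, add = add U,
     smult = smult U,
     comult = extend_hom (tensor_algebra U U) (uq_comult_gen q),
     counit = extend_hom complex_algebra uq_counit_gen,
     antipode = extend_hom (opposite_algebra U) (uq_antipode_gen q)\<rparr>)"


section \<open>Symmetries on the quantum disc\<close>

definition uq_disc_symmetry :: "complex \<Rightarrow> (uq_elem \<Rightarrow> disc_elem \<Rightarrow> disc_elem) \<Rightarrow> bool" where
  "uq_disc_symmetry q \<pi> \<longleftrightarrow> hopf_symmetry (Uq q) (Pol_disc q) \<pi>"

definition is_grading_jump ::
    "complex \<Rightarrow> (uq_elem \<Rightarrow> disc_elem \<Rightarrow> disc_elem) \<Rightarrow> int \<Rightarrow> bool" where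
  "is_grading_jump q \<pi> n \<longleftrightarrow> n \<noteq> 0 \<and>
    (\<forall>k. \<pi> (uq_e q) ` disc_grade q k \<subseteq> disc_grade q (k + n) \<and>
         \<pi> (uq_f q) ` disc_grade q k \<subseteq> disc_grade q (k - n))"

definition grading_jump :: "complex \<Rightarrow> (uq_elem \<Rightarrow> disc_elem \<Rightarrow> disc_elem) \<Rightarrow> int" where
  "grading_jump q \<pi> =
    (if \<pi> (uq_e q) = \<zero>\<^bsub>End_algebra (Pol_disc q)\<^esub> \<and> \<pi> (uq_f q) = \<zero>\<^bsub>End_algebra (Pol_disc q)\<^esub>
     then 0 else (THE n. is_grading_jump q \<pi> n))"

end

theory Submission
  imports Defs
begin

text \<open>
  Both series belong to one family: with \<open>p = q\<^sup>-\<^sup>2\<close>, let the generator e act by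
  \<open>z \<mapsto> s\<^sub>0 - (1 + p) a\<^sub>1 y\<close>, \<open>z\<^sup>* \<mapsto> -q\<^sup>2 a\<^sub>1 z\<^sup>*\<^sup>2\<close> and f by
  \<open>z \<mapsto> -q\<^sup>2 b\<^sub>1 z\<^sup>2\<close>, \<open>z\<^sup>* \<mapsto> t\<^sub>0 - (1 + p) b\<^sub>1 y\<close>.  These values always
  extend to skew derivations of the disc, and the relation between e and f holds as soon as
  \<open>a\<^sub>1 b\<^sub>1 = 0\<close> and \<open>q (b\<^sub>1 s\<^sub>0 + a\<^sub>1 t\<^sub>0) = 1\<close>: both sides of each relation of the
  quantum group are skew derivations of the same kind, so that it is enough to compare them on
  \<open>z\<close> and \<open>z\<^sup>*\<close>.  The Leibniz rule passes from generators to all of the quantum group because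
  the comultiplication is multiplicative.  The grading jump is unique since e maps \<open>z\<close>, or f
  maps \<open>z\<^sup>*\<close>, to a non-zero scalar, and the characters \<open>z \<mapsto> u\<close>, \<open>z\<^sup>* \<mapsto> u\<^sup>-\<^sup>1\<close>
  show that scalars have degree 0.
\<close>

section \<open>Complex algebras and monoid algebras\<close>

text \<open>The disc and the quantum group are quotients of free algebras, and no basis of either is
  established. The proof therefore only verifies equations: words are brought to the form with
  \<open>z\<close> before \<open>zs\<close> and coefficients are compared, without the converse that
  equal elements have equal coefficients. Where something has to be non-zero, a character detects
  it. The constants arise as follows. Respecting the disc relation ties the coefficient of
  \<open>y\<close> in the value at one generator to the coefficient of the square in the value at
  the other; \<open>a1\<close> and \<open>b1\<close> are the free factors that remain. In the
  commutator of e and f at \<open>z\<close>, the word z z zs has coefficient -q^2 (1 + p) (1 + p +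
  p^2) a1 b1, which suggests a1 b1 = 0. The coefficient of \<open>z\<close> then becomes -q^2 (1 +
  p) (b1 s0 + a1 t0) and has to equal (p - q^2) / (q - 1/q) = -q (1 + p); this is the normalization.
  The choices a1 = 0 and b1 = 0 are the two series, with \<open>b0\<close> and \<open>a0\<close>
  entering through \<open>t0\<close> and \<open>s0\<close>.\<close>

locale complex_alg = ring A for A :: "(complex, 'a, 'x) module_scheme" (structure) +
  assumes smult_closed [simp, intro]: "x \<in> carrier A \<Longrightarrow> c \<odot> x \<in> carrier A"
    and smult_l_distr: "x \<in> carrier A \<Longrightarrow> (c + d) \<odot> x = c \<odot> x \<oplus> d \<odot> x"
    and smult_r_distr: "\<lbrakk>x \<in> carrier A; y \<in> carrier A\<rbrakk> \<Longrightarrow> c \<odot> (x \<oplus> y) = c \<odot> x \<oplus> c \<odot> y"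
    and smult_smult: "x \<in> carrier A \<Longrightarrow> c \<odot> (d \<odot> x) = (c * d) \<odot> x"
    and smult_one [simp]: "x \<in> carrier A \<Longrightarrow> 1 \<odot> x = x"
    and smult_m_l: "\<lbrakk>x \<in> carrier A; y \<in> carrier A\<rbrakk> \<Longrightarrow> (c \<odot> x) \<otimes> y = c \<odot> (x \<otimes> y)"
    and smult_m_r: "\<lbrakk>x \<in> carrier A; y \<in> carrier A\<rbrakk> \<Longrightarrow> x \<otimes> (c \<odot> y) = c \<odot> (x \<otimes> y)"
begin

lemma smult_0 [simp]:
  assumes "x \<in> carrier A" shows "0 \<odot> x = \<zero>"
  using smult_l_distr[of x 0 0] assms by simp

lemma smult_zero [simp]: "c \<odot> \<zero> = \<zero>"
  using smult_smult[of \<zero> c 0] by simp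

lemma smult_minus:
  assumes "x \<in> carrier A" shows "(- c) \<odot> x = \<ominus> (c \<odot> x)"
proof -
  have "(- c) \<odot> x \<oplus> c \<odot> x = \<zero>"
    using smult_l_distr[of x "- c" c] assms by simp
  then show ?thesis using assms by (intro minus_equality[symmetric]) auto
qed

lemma a_inv_conv_smult: "x \<in> carrier A \<Longrightarrow> \<ominus> x = (-1) \<odot> x"
  using smult_minus[of x 1] by simp

lemma smult_a_inv:
  "x \<in> carrier A \<Longrightarrow> c \<odot> (\<ominus> x) = \<ominus> (c \<odot> x)"
  by (simp add: a_inv_conv_smult smult_smult)

text \<open>The generator case carries an arbitrary coefficient, so that closure of \<open>P\<close>
  under scalars is not a separate obligation.\<close>

lemma lin_span_induct [consumes 2, case_names zero smult add]:
  assumes x: "x \<in> lin_span A S"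
    and S: "S \<subseteq> carrier A"
    and "P \<zero>"
    and "\<And>c s. s \<in> S \<Longrightarrow> P (c \<odot> s)"
    and "\<And>x y. \<lbrakk>x \<in> carrier A; y \<in> carrier A; P x; P y\<rbrakk> \<Longrightarrow> P (x \<oplus> y)"
  shows "P x"
proof -
  obtain F c where F: "finite F" "F \<subseteq> S" and xF: "x = (\<Oplus>s\<in>F. c s \<odot> s)"
    using x unfolding lin_span_def by auto
  from F have "P (\<Oplus>s\<in>F. c s \<odot> s)"
  proof (induction F)
    case empty
    then show ?case using assms by simp
  next
    case (insert s F)
    have FS: "F \<subseteq> carrier A" and s: "s \<in> carrier A" using insert S by auto
    have "(\<Oplus>s\<in>insert s F. c s \<odot> s) = c s \<odot> s \<oplus> (\<Oplus>s\<in>F. c s \<odot> s)"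
      using insert FS s by (subst finsum_insert) auto
    then show ?case using insert assms(4,5) FS s by (auto intro!: assms(5) finsum_closed)
  qed
  then show ?thesis by (simp add: xF)
qed

lemma lin_span_carrier:
  assumes "S \<subseteq> carrier A" shows "lin_span A S \<subseteq> carrier A"
proof
  fix x assume "x \<in> lin_span A S"
  from this assms show "x \<in> carrier A"
    by (induction rule: lin_span_induct) (use assms in auto)
qed

lemma lin_span_zero [simp]: "\<zero> \<in> lin_span A S"
  unfolding lin_span_def by (rule CollectI, rule exI[of _ "{}"]) auto

lemma lin_span_smult_base:
  assumes "s \<in> S" "S \<subseteq> carrier A" shows "c \<odot> s \<in> lin_span A S"
  unfolding lin_span_def using assms
  by (intro CollectI exI[of _ "{s}"] exI[of _ "\<lambda>_. c"]) (auto simp: finsum_insert[of "{}"])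

lemma lin_span_base:
  assumes "s \<in> S" "S \<subseteq> carrier A" shows "s \<in> lin_span A S"
  using lin_span_smult_base[OF assms, of 1] assms by auto

lemma lin_span_add:
  assumes S: "S \<subseteq> carrier A" and "x \<in> lin_span A S" "y \<in> lin_span A S"
  shows "x \<oplus> y \<in> lin_span A S"
proof -
  obtain F c where F: "finite F" "F \<subseteq> S" and x: "x = (\<Oplus>s\<in>F. c s \<odot> s)"
    using assms unfolding lin_span_def by auto
  obtain G d where G: "finite G" "G \<subseteq> S" and y: "y = (\<Oplus>s\<in>G. d s \<odot> s)"
    using assms unfolding lin_span_def by auto
  \<comment> \<open>Extending both coefficient functions by 0 lets the two sums range over the same
    index set.\<close>
  let ?c = "\<lambda>s. if s \<in> F then c s else 0" and ?d = "\<lambda>s. if s \<in> G then d s else 0"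
  have FG: "F \<union> G \<subseteq> carrier A" using F G S by auto
  have x': "x = (\<Oplus>s\<in>F \<union> G. ?c s \<odot> s)"
    unfolding x using F G FG
    by (intro add.finprod_mono_neutral_cong_left) auto
  have y': "y = (\<Oplus>s\<in>F \<union> G. ?d s \<odot> s)"
    unfolding y using F G FG
    by (intro add.finprod_mono_neutral_cong_left) auto
  have "x \<oplus> y = (\<Oplus>s\<in>F \<union> G. ?c s \<odot> s \<oplus> ?d s \<odot> s)"
    unfolding x' y' using FG by (intro finsum_addf[symmetric]) auto
  also have "\<dots> = (\<Oplus>s\<in>F \<union> G. (?c s + ?d s) \<odot> s)"
    using FG by (intro finsum_cong') (auto simp: smult_l_distr)
  finally show ?thesis using F G unfolding lin_span_def
    by (intro CollectI exI[of _ "F \<union> G"] exI[of _ "\<lambda>s. ?c s + ?d s"]) auto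
qed

lemma lin_span_smult:
  assumes S: "S \<subseteq> carrier A" and x: "x \<in> lin_span A S"
  shows "c \<odot> x \<in> lin_span A S"
  using x S
proof (induction rule: lin_span_induct)
  case (smult d s)
  then show ?case using S lin_span_smult_base[of s S "c * d"] by (auto simp: smult_smult subsetD)
next
  case (add x y)
  then show ?case using S by (simp add: smult_r_distr lin_span_add)
qed simp_all

end

text \<open>Nothing is required outside the carrier, so that composites and lambda terms are linear
  maps as they stand; \<open>EA_restrict\<close> turns them into members of the endomorphism
  algebra.\<close>

definition linear_map ::
    "(complex, 'a, 'x) module_scheme \<Rightarrow> (complex, 'b, 'y) module_scheme \<Rightarrow> ('a \<Rightarrow> 'b) \<Rightarrow> bool" where
  "linear_map A B f \<longleftrightarrow> f \<in> carrier A \<rightarrow> carrier B \<and>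
    (\<forall>x \<in> carrier A. \<forall>y \<in> carrier A. f (x \<oplus>\<^bsub>A\<^esub> y) = f x \<oplus>\<^bsub>B\<^esub> f y) \<and>
    (\<forall>c. \<forall>x \<in> carrier A. f (c \<odot>\<^bsub>A\<^esub> x) = c \<odot>\<^bsub>B\<^esub> f x)"

lemma linear_mapD:
  assumes "linear_map A B f"
  shows "x \<in> carrier A \<Longrightarrow> f x \<in> carrier B"
    and "\<lbrakk>x \<in> carrier A; y \<in> carrier A\<rbrakk> \<Longrightarrow> f (x \<oplus>\<^bsub>A\<^esub> y) = f x \<oplus>\<^bsub>B\<^esub> f y"
    and "x \<in> carrier A \<Longrightarrow> f (c \<odot>\<^bsub>A\<^esub> x) = c \<odot>\<^bsub>B\<^esub> f x"
  using assms unfolding linear_map_def by auto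

lemma linear_mapI:
  assumes "\<And>x. x \<in> carrier A \<Longrightarrow> f x \<in> carrier B"
    and "\<And>x y. \<lbrakk>x \<in> carrier A; y \<in> carrier A\<rbrakk> \<Longrightarrow> f (x \<oplus>\<^bsub>A\<^esub> y) = f x \<oplus>\<^bsub>B\<^esub> f y"
    and "\<And>c x. x \<in> carrier A \<Longrightarrow> f (c \<odot>\<^bsub>A\<^esub> x) = c \<odot>\<^bsub>B\<^esub> f x"
  shows "linear_map A B f"
  using assms unfolding linear_map_def by auto

lemma linear_map_zero:
  assumes "complex_alg A" "complex_alg B" "linear_map A B f"
  shows "f \<zero>\<^bsub>A\<^esub> = \<zero>\<^bsub>B\<^esub>"
proof -
  interpret A: complex_alg A by fact
  interpret B: complex_alg B by fact
  have "f (0 \<odot>\<^bsub>A\<^esub> \<zero>\<^bsub>A\<^esub>) = 0 \<odot>\<^bsub>B\<^esub> f \<zero>\<^bsub>A\<^esub>" using assms(3) by (rule linear_mapD) simp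
  then show ?thesis using linear_mapD(1)[OF assms(3), of "\<zero>\<^bsub>A\<^esub>"] by simp
qed

lemma algebra_hom_linear_map: "f \<in> algebra_hom A B \<Longrightarrow> linear_map A B f"
  by (rule linear_mapI) (auto simp: algebra_hom_def intro: ring_hom_closed ring_hom_add)

text \<open>The linear extension of a map given on basis elements. Both \<open>eval_free\<close> and
  the sum inside \<open>tensor_map\<close> are instances, so that additivity and homogeneity are
  proved once.\<close>

definition lin_ext ::
    "(complex, 'a, 'x) module_scheme \<Rightarrow> ('u \<Rightarrow> 'a) \<Rightarrow> ('u \<Rightarrow>\<^sub>0 complex) \<Rightarrow> 'a" where
  "lin_ext A \<beta> p = (\<Oplus>\<^bsub>A\<^esub> u \<in> Poly_Mapping.keys p. Poly_Mapping.lookup p u \<odot>\<^bsub>A\<^esub> \<beta> u)"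

context complex_alg
begin

text \<open>Cancellation can make the keys of a sum smaller than the union of the keys. Over a fixed
  finite superset the sum is visibly additive in the coefficients.\<close>

lemma lin_ext_superset:
  assumes "finite F" "Poly_Mapping.keys p \<subseteq> F" "\<beta> \<in> F \<rightarrow> carrier A"
  shows "lin_ext A \<beta> p = (\<Oplus>u\<in>F. Poly_Mapping.lookup p u \<odot> \<beta> u)"
  unfolding lin_ext_def using assms
  by (intro add.finprod_mono_neutral_cong_left) (auto simp: in_keys_iff Pi_iff)

lemma lin_ext_closed:
  assumes "Poly_Mapping.keys p \<subseteq> S" "\<beta> \<in> S \<rightarrow> carrier A"
  shows "lin_ext A \<beta> p \<in> carrier A"
  unfolding lin_ext_def using assms by (intro finsum_closed) auto

lemma lin_ext_add:
  assumes "Poly_Mapping.keys p \<subseteq> S" "Poly_Mapping.keys p' \<subseteq> S" "\<beta> \<in> S \<rightarrow> carrier A"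
  shows "lin_ext A \<beta> (p + p') = lin_ext A \<beta> p \<oplus> lin_ext A \<beta> p'"
proof -
  let ?F = "Poly_Mapping.keys p \<union> Poly_Mapping.keys p'"
  have b: "\<beta> \<in> ?F \<rightarrow> carrier A" using assms by auto
  have "lin_ext A \<beta> (p + p') = (\<Oplus>u\<in>?F. Poly_Mapping.lookup (p + p') u \<odot> \<beta> u)"
    by (rule lin_ext_superset) (use b Poly_Mapping.keys_add[of p p'] in auto)
  also have "\<dots> = (\<Oplus>u\<in>?F. Poly_Mapping.lookup p u \<odot> \<beta> u \<oplus> Poly_Mapping.lookup p' u \<odot> \<beta> u)"
    using b by (intro finsum_cong') (auto simp: lookup_add smult_l_distr Pi_iff)
  also have "\<dots> = (\<Oplus>u\<in>?F. Poly_Mapping.lookup p u \<odot> \<beta> u) \<oplus> (\<Oplus>u\<in>?F. Poly_Mapping.lookup p' u \<odot> \<beta> u)"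
    using b by (intro finsum_addf) auto
  also have "\<dots> = lin_ext A \<beta> p \<oplus> lin_ext A \<beta> p'"
    using b lin_ext_superset[of ?F p \<beta>] lin_ext_superset[of ?F p' \<beta>] by simp
  finally show ?thesis .
qed

lemma lin_ext_single [simp]:
  assumes "\<beta> u \<in> carrier A"
  shows "lin_ext A \<beta> (Poly_Mapping.single u c) = c \<odot> \<beta> u"
  using assms by (subst lin_ext_superset[of "{u}"]) (auto simp: finsum_insert[of "{}"])

lemma lin_ext_0 [simp]: "lin_ext A \<beta> 0 = \<zero>"
  by (simp add: lin_ext_def)

lemma lin_ext_scale:
  assumes "Poly_Mapping.keys p \<subseteq> S" "\<beta> \<in> S \<rightarrow> carrier A"
  shows "lin_ext A \<beta> (Poly_Mapping.map ((*) c) p) = c \<odot> lin_ext A \<beta> p"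
proof -
  let ?F = "Poly_Mapping.keys p"
  have l: "Poly_Mapping.lookup (Poly_Mapping.map ((*) c) p) u = c * Poly_Mapping.lookup p u" for u
    by (simp add: Poly_Mapping.map.rep_eq when_def)
  have b: "\<beta> \<in> ?F \<rightarrow> carrier A" using assms by auto
  have "finite F \<Longrightarrow> F \<subseteq> ?F \<Longrightarrow>
     (\<Oplus>u\<in>F. (c * Poly_Mapping.lookup p u) \<odot> \<beta> u) = c \<odot> (\<Oplus>u\<in>F. Poly_Mapping.lookup p u \<odot> \<beta> u)" for F
  proof (induction F rule: finite_induct)
    case (insert u F)
    have c: "(\<Oplus>u\<in>F. Poly_Mapping.lookup p u \<odot> \<beta> u) \<in> carrier A" "\<beta> u \<in> carrier A"
      "(\<lambda>u. Poly_Mapping.lookup p u \<odot> \<beta> u) \<in> F \<rightarrow> carrier A"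
      "(\<lambda>u. (c * Poly_Mapping.lookup p u) \<odot> \<beta> u) \<in> F \<rightarrow> carrier A"
      using insert b by (auto intro!: finsum_closed)
    then show ?case using insert by (simp add: finsum_insert smult_r_distr smult_smult)
  qed simp
  then have "(\<Oplus>u\<in>?F. (c * Poly_Mapping.lookup p u) \<odot> \<beta> u) = c \<odot> lin_ext A \<beta> p"
    by (simp add: lin_ext_def)
  moreover have "lin_ext A \<beta> (Poly_Mapping.map ((*) c) p) = (\<Oplus>u\<in>?F. (c * Poly_Mapping.lookup p u) \<odot> \<beta> u)"
    by (subst lin_ext_superset[of ?F]) (use b in \<open>auto simp: l in_keys_iff\<close>)
  ultimately show ?thesis by simp
qed

end

text \<open>The bound \<open>S\<close> is kept through the induction because the laws of a monoid
  hold only on its carrier, so the keys have to stay there.\<close>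

lemma poly_mapping_keys_induct [consumes 1, case_names zero single add]:
  fixes p :: "'u \<Rightarrow>\<^sub>0 'c::comm_monoid_add"
  assumes "Poly_Mapping.keys p \<subseteq> S"
    and "P 0"
    and single: "\<And>u c. u \<in> S \<Longrightarrow> P (Poly_Mapping.single u c)"
    and add: "\<And>p p'. \<lbrakk>Poly_Mapping.keys p \<subseteq> S; Poly_Mapping.keys p' \<subseteq> S; P p; P p'\<rbrakk> \<Longrightarrow> P (p + p')"
  shows "P p"
proof -
  have "finite F \<Longrightarrow> Poly_Mapping.keys p \<subseteq> F \<Longrightarrow> F \<subseteq> S \<Longrightarrow> P p" for F
  proof (induction F arbitrary: p rule: finite_induct)
    case empty
    then have "p = 0" by simp
    then show ?case using assms by simp
  next
    case (insert u F)
    \<comment> \<open>Updating to 0 erases the key \<open>u\<close>, so the remainder is supported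
      on \<open>F\<close> and the induction hypothesis applies.\<close>
    define p' where "p' = Poly_Mapping.update u 0 p"
    have p: "p = Poly_Mapping.single u (Poly_Mapping.lookup p u) + p'"
      by (rule poly_mapping_eqI) (auto simp: p'_def lookup_add lookup_update lookup_single when_def)
    have k: "Poly_Mapping.keys p' \<subseteq> F" using insert.prems
      by (auto simp: p'_def lookup_update in_keys_iff split: if_splits)
    then have "P p'" using insert.prems(2) by (intro insert.IH) auto
    moreover have "Poly_Mapping.keys (Poly_Mapping.single u (Poly_Mapping.lookup p u)) \<subseteq> S"
      using insert by auto
    ultimately have "P (Poly_Mapping.single u (Poly_Mapping.lookup p u) + p')"
      using insert.prems(2) k by (intro add single) auto
    then show ?case using p by metis
  qed
  from this[OF finite_keys subset_refl assms(1)] show ?thesis .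
qed

lemma lookup_map_scale [simp]:
  fixes p :: "'u \<Rightarrow>\<^sub>0 complex"
  shows "Poly_Mapping.lookup (Poly_Mapping.map ((*) c) p) u = c * Poly_Mapping.lookup p u"
  by (simp add: Poly_Mapping.map.rep_eq when_def)

lemma map_scale_add:
  fixes p :: "'u \<Rightarrow>\<^sub>0 complex"
  shows "Poly_Mapping.map ((*) c) (p + p') = Poly_Mapping.map ((*) c) p + Poly_Mapping.map ((*) c) p'"
  by (rule poly_mapping_eqI) (simp add: lookup_add algebra_simps)

lemma map_scale_single [simp]:
  fixes d :: complex
  shows "Poly_Mapping.map ((*) c) (Poly_Mapping.single u d) = Poly_Mapping.single u (c * d)"
  by (rule poly_mapping_eqI) (simp add: lookup_single when_def)

lemma map_scale_0 [simp]: "Poly_Mapping.map ((*) (c::complex)) 0 = 0"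
  by (rule poly_mapping_eqI) simp

lemma keys_map_scale: "Poly_Mapping.keys (Poly_Mapping.map ((*) (c::complex)) p) \<subseteq> Poly_Mapping.keys p"
  by (auto simp: in_keys_iff)

lemma sum_keys_superset:
  fixes p :: "'u \<Rightarrow>\<^sub>0 complex" and g :: "'u \<Rightarrow> complex \<Rightarrow> 'b::comm_monoid_add"
  assumes "finite F" "Poly_Mapping.keys p \<subseteq> F" "\<And>u. g u 0 = 0"
  shows "(\<Sum>u\<in>Poly_Mapping.keys p. g u (Poly_Mapping.lookup p u)) = (\<Sum>u\<in>F. g u (Poly_Mapping.lookup p u))"
  using assms by (intro sum.mono_neutral_left) (auto simp: in_keys_iff)

text \<open>Stated for an arbitrary summand that is additive in the coefficient, so that it serves
  for either factor of the convolution product.\<close>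

lemma sum_keys_add:
  fixes p :: "'u \<Rightarrow>\<^sub>0 complex" and g :: "'u \<Rightarrow> complex \<Rightarrow> 'b::comm_monoid_add"
  assumes 0: "\<And>u. g u 0 = 0" and add: "\<And>u c d. g u (c + d) = g u c + g u d"
  shows "(\<Sum>u\<in>Poly_Mapping.keys (p + p'). g u (Poly_Mapping.lookup (p + p') u)) =
    (\<Sum>u\<in>Poly_Mapping.keys p. g u (Poly_Mapping.lookup p u)) +
    (\<Sum>u\<in>Poly_Mapping.keys p'. g u (Poly_Mapping.lookup p' u))"
proof -
  let ?F = "Poly_Mapping.keys p \<union> Poly_Mapping.keys p'"
  have "Poly_Mapping.keys (p + p') \<subseteq> ?F" by (rule Poly_Mapping.keys_add)
  then show ?thesis
    using sum_keys_superset[of ?F "p + p'" g] sum_keys_superset[of ?F p g]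
      sum_keys_superset[of ?F p' g]
    by (simp add: 0 add lookup_add sum.distrib)
qed

section \<open>The monoid algebra\<close>

locale monoid_alg = monoid M for M :: "('m, 'x) monoid_scheme"
begin

abbreviation MA where "MA \<equiv> monoid_algebra M"

lemma MA_simps [simp]:
  "\<zero>\<^bsub>MA\<^esub> = 0" "\<one>\<^bsub>MA\<^esub> = Poly_Mapping.single \<one>\<^bsub>M\<^esub> 1" "x \<oplus>\<^bsub>MA\<^esub> y = x + y"
  "c \<odot>\<^bsub>MA\<^esub> x = Poly_Mapping.map ((*) c) x"
  "x \<in> carrier MA \<longleftrightarrow> Poly_Mapping.keys x \<subseteq> carrier M"
  by (simp_all add: monoid_algebra_def)

lemma mult_MA: "p \<otimes>\<^bsub>MA\<^esub> p' = (\<Sum>u \<in> Poly_Mapping.keys p. \<Sum>v \<in> Poly_Mapping.keys p'.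
       Poly_Mapping.single (u \<otimes>\<^bsub>M\<^esub> v) (Poly_Mapping.lookup p u * Poly_Mapping.lookup p' v))"
  by (simp add: monoid_algebra_def)

lemma MA_add_l: "(p + p') \<otimes>\<^bsub>MA\<^esub> r = p \<otimes>\<^bsub>MA\<^esub> r + p' \<otimes>\<^bsub>MA\<^esub> r"
  unfolding mult_MA
  by (rule sum_keys_add[where g = "\<lambda>u c. \<Sum>v\<in>Poly_Mapping.keys r.
      Poly_Mapping.single (u \<otimes>\<^bsub>M\<^esub> v) (c * Poly_Mapping.lookup r v)"])
    (simp_all add: algebra_simps single_add sum.distrib)

lemma MA_add_r: "r \<otimes>\<^bsub>MA\<^esub> (p + p') = r \<otimes>\<^bsub>MA\<^esub> p + r \<otimes>\<^bsub>MA\<^esub> p'"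
proof -
  \<comment> \<open>Exchanging the sums puts the right factor outside, where
    \<open>sum_keys_add\<close> can act on it.\<close>
  have "r \<otimes>\<^bsub>MA\<^esub> p = (\<Sum>v \<in> Poly_Mapping.keys p. \<Sum>u \<in> Poly_Mapping.keys r.
       Poly_Mapping.single (u \<otimes>\<^bsub>M\<^esub> v) (Poly_Mapping.lookup r u * Poly_Mapping.lookup p v))" for p
    unfolding mult_MA by (rule sum.swap)
  then show ?thesis 
    by (simp only:, intro sum_keys_add[where g = "\<lambda>v c. \<Sum>u\<in>Poly_Mapping.keys r.
      Poly_Mapping.single (u \<otimes>\<^bsub>M\<^esub> v) (Poly_Mapping.lookup r u * c)"])
      (simp_all add: algebra_simps single_add sum.distrib)
qed

lemma MA_single [simp]:
  "Poly_Mapping.single u c \<otimes>\<^bsub>MA\<^esub> Poly_Mapping.single v d = Poly_Mapping.single (u \<otimes>\<^bsub>M\<^esub> v) (c * d)"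
  by (cases "c = 0"; cases "d = 0") (simp_all add: mult_MA)

lemma MA_0 [simp]: "0 \<otimes>\<^bsub>MA\<^esub> p = 0" "p \<otimes>\<^bsub>MA\<^esub> 0 = 0"
  by (simp_all add: mult_MA)

lemma keys_mult_MA:
  assumes "Poly_Mapping.keys p \<subseteq> carrier M" "Poly_Mapping.keys r \<subseteq> carrier M"
  shows "Poly_Mapping.keys (p \<otimes>\<^bsub>MA\<^esub> r) \<subseteq> carrier M"
  using assms(1)
proof (induction p rule: poly_mapping_keys_induct)
  case u: (single u c)
  show ?case using assms(2)
  proof (induction r rule: poly_mapping_keys_induct)
    case (single v d)
    then show ?case using u by simp
  next
    case (add p p')
    then show ?case unfolding MA_add_r by (intro order_trans[OF Poly_Mapping.keys_add]) simp
  qed simp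
next
  case (add p p')
  then show ?case unfolding MA_add_l by (intro order_trans[OF Poly_Mapping.keys_add]) simp
qed simp

text \<open>Additivity in each factor reduces this to multiples of three basis elements, where it is
  associativity in \<open>M\<close> and of the scalars.\<close>

lemma MA_assoc:
  assumes "Poly_Mapping.keys p \<subseteq> carrier M" "Poly_Mapping.keys r \<subseteq> carrier M"
    "Poly_Mapping.keys s \<subseteq> carrier M"
  shows "(p \<otimes>\<^bsub>MA\<^esub> r) \<otimes>\<^bsub>MA\<^esub> s = p \<otimes>\<^bsub>MA\<^esub> (r \<otimes>\<^bsub>MA\<^esub> s)"
  using assms(1)
proof (induction p rule: poly_mapping_keys_induct)
  case u: (single u c)
  show ?case using assms(2)
  proof (induction r rule: poly_mapping_keys_induct)
    case v: (single v d)
    show ?case using assms(3)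
    proof (induction s rule: poly_mapping_keys_induct)
      case (single w e)
      then show ?case using u v by (simp add: m_assoc mult.assoc)
    qed (simp_all add: MA_add_r)
  qed (simp_all add: MA_add_l MA_add_r)
qed (simp_all add: MA_add_l)

lemma MA_smult_l: 
  assumes "Poly_Mapping.keys p \<subseteq> carrier M" "Poly_Mapping.keys r \<subseteq> carrier M"
  shows "Poly_Mapping.map ((*) c) p \<otimes>\<^bsub>MA\<^esub> r = Poly_Mapping.map ((*) c) (p \<otimes>\<^bsub>MA\<^esub> r)"
    and "p \<otimes>\<^bsub>MA\<^esub> Poly_Mapping.map ((*) c) r = Poly_Mapping.map ((*) c) (p \<otimes>\<^bsub>MA\<^esub> r)"
proof -
  have "Poly_Mapping.map ((*) c) p \<otimes>\<^bsub>MA\<^esub> r = Poly_Mapping.map ((*) c) (p \<otimes>\<^bsub>MA\<^esub> r) \<and>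
    p \<otimes>\<^bsub>MA\<^esub> Poly_Mapping.map ((*) c) r = Poly_Mapping.map ((*) c) (p \<otimes>\<^bsub>MA\<^esub> r)"
    using assms(1)
  proof (induction p rule: poly_mapping_keys_induct)
    case u: (single u a)
    show ?case using assms(2)
    proof (induction r rule: poly_mapping_keys_induct)
      case v: (single v b)
      then show ?case using u by (simp add: ac_simps)
    qed (simp_all add: MA_add_l MA_add_r map_scale_add)
  qed (simp_all add: MA_add_l MA_add_r map_scale_add)
  then show "Poly_Mapping.map ((*) c) p \<otimes>\<^bsub>MA\<^esub> r = Poly_Mapping.map ((*) c) (p \<otimes>\<^bsub>MA\<^esub> r)"
    and "p \<otimes>\<^bsub>MA\<^esub> Poly_Mapping.map ((*) c) r = Poly_Mapping.map ((*) c) (p \<otimes>\<^bsub>MA\<^esub> r)" by auto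
qed

lemma MA_one:
  assumes "Poly_Mapping.keys p \<subseteq> carrier M"
  shows "Poly_Mapping.single \<one>\<^bsub>M\<^esub> 1 \<otimes>\<^bsub>MA\<^esub> p = p" "p \<otimes>\<^bsub>MA\<^esub> Poly_Mapping.single \<one>\<^bsub>M\<^esub> 1 = p"
  using assms
  by (induction p rule: poly_mapping_keys_induct) (simp_all add: MA_add_l MA_add_r)

lemma complex_alg_MA: "complex_alg MA"
proof (intro complex_alg.intro complex_alg_axioms.intro ringI)
  show "abelian_group MA"
  proof (rule abelian_groupI)
    show "\<exists>y\<in>carrier MA. y \<oplus>\<^bsub>MA\<^esub> x = \<zero>\<^bsub>MA\<^esub>" if "x \<in> carrier MA" for x
      using that by (intro bexI[of _ "- x"]) auto
  next
    show "x \<oplus>\<^bsub>MA\<^esub> y \<in> carrier MA" if "x \<in> carrier MA" "y \<in> carrier MA" for x y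
      using that Poly_Mapping.keys_add[of x y] by auto
  qed (simp_all add: add.assoc add.commute)
  show "monoid MA"
    by (rule monoidI) (simp_all add: MA_assoc MA_one keys_mult_MA)
next
  show "c \<odot>\<^bsub>MA\<^esub> x \<in> carrier MA" if "x \<in> carrier MA" for c x
    using that keys_map_scale[of c x] by auto
  show "(c + d) \<odot>\<^bsub>MA\<^esub> x = c \<odot>\<^bsub>MA\<^esub> x \<oplus>\<^bsub>MA\<^esub> d \<odot>\<^bsub>MA\<^esub> x" for c d x
    by (simp, rule poly_mapping_eqI) (simp add: lookup_add algebra_simps)
  show "c \<odot>\<^bsub>MA\<^esub> (d \<odot>\<^bsub>MA\<^esub> x) = (c * d) \<odot>\<^bsub>MA\<^esub> x" for c d x
    by (simp, rule poly_mapping_eqI) simp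
  show "1 \<odot>\<^bsub>MA\<^esub> x = x" for x
    by (simp, rule poly_mapping_eqI) simp
qed (simp_all add: MA_add_l MA_add_r map_scale_add MA_smult_l)

end

section \<open>Quotients and presented algebras\<close>

lemma ring_hom_ring_algebra_hom:
  assumes "complex_alg A" "complex_alg B" "f \<in> algebra_hom A B"
  shows "ring_hom_ring A B f"
  using assms by (intro ring_hom_ringI2) (auto simp: algebra_hom_def complex_alg_def)

lemma algebra_homI:
  assumes "linear_map A B f"
    and "\<And>x y. \<lbrakk>x \<in> carrier A; y \<in> carrier A\<rbrakk> \<Longrightarrow> f (x \<otimes>\<^bsub>A\<^esub> y) = f x \<otimes>\<^bsub>B\<^esub> f y"
    and "f \<one>\<^bsub>A\<^esub> = \<one>\<^bsub>B\<^esub>"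
  shows "f \<in> algebra_hom A B"
  using assms(2,3) by (auto simp: algebra_hom_def linear_mapD[OF assms(1)] intro!: ring_hom_memI)

lemma algebra_homD:
  assumes "f \<in> algebra_hom A B"
  shows "\<lbrakk>x \<in> carrier A; y \<in> carrier A\<rbrakk> \<Longrightarrow> f (x \<otimes>\<^bsub>A\<^esub> y) = f x \<otimes>\<^bsub>B\<^esub> f y"
    and "f \<one>\<^bsub>A\<^esub> = \<one>\<^bsub>B\<^esub>"
  using assms by (auto simp: algebra_hom_def ring_hom_mult ring_hom_one)

text \<open>\<open>quotient_algebra\<close> copies the operations of \<open>A Quot I\<close> into a
  record of another type, so the ring axioms have to be carried over field by field.\<close>

lemma ring_cong:
  assumes "ring R" "carrier S = carrier R" "add S = add R" "mult S = mult R"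
    "one S = one R" "zero S = zero R"
  shows "ring S"
proof -
  interpret R: ring R by fact
  show ?thesis
  proof (rule ringI)
    show "abelian_group S"
      by (rule abelian_groupI) (use R.add.l_inv_ex in \<open>simp_all add: assms R.add.m_ac\<close>)
    show "monoid S" by (rule monoidI) (simp_all add: assms R.m_assoc)
  qed (simp_all add: assms R.l_distr R.r_distr)
qed

locale algebra_ideal = complex_alg A + ideal I A for I and A :: "(complex, 'a, 'x) module_scheme" (structure)
begin

abbreviation Q where "Q \<equiv> quotient_algebra A I"

text \<open>Multiplying by a scalar is multiplying by that multiple of the unit, so a ring ideal is
  a subspace.\<close>

lemma ideal_smult_closed:
  assumes "x \<in> I" shows "c \<odot> x \<in> I"
proof -
  have x: "x \<in> carrier A" using assms by auto
  have "(c \<odot> \<one>) \<otimes> x \<in> I" using assms by (intro I_l_closed) auto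
  then show ?thesis using x by (simp add: smult_m_l)
qed

lemma Q_carrier: "carrier Q = (+>) I ` carrier A"
  by (auto simp: quotient_algebra_def FactRing_simps)

lemma Q_closed [simp]: "x \<in> carrier A \<Longrightarrow> I +> x \<in> carrier Q"
  by (simp add: Q_carrier)

lemma coset_eq_iff:
  assumes "x \<in> carrier A" "y \<in> carrier A"
  shows "I +> x = I +> y \<longleftrightarrow> x \<ominus> y \<in> I"
  using assms a_rcos_module_minus[OF ring_axioms] a_repr_independence' a_repr_independenceD a_rcos_self
  by metis

lemma Q_mult [simp]:
  "\<lbrakk>x \<in> carrier A; y \<in> carrier A\<rbrakk> \<Longrightarrow> (I +> x) \<otimes>\<^bsub>Q\<^esub> (I +> y) = I +> (x \<otimes> y)"
  by (simp add: quotient_algebra_def FactRing_def rcoset_mult_add)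

lemma Q_add [simp]:
  "\<lbrakk>x \<in> carrier A; y \<in> carrier A\<rbrakk> \<Longrightarrow> (I +> x) \<oplus>\<^bsub>Q\<^esub> (I +> y) = I +> (x \<oplus> y)"
  by (simp add: quotient_algebra_def FactRing_def a_rcos_sum)

lemma Q_one: "\<one>\<^bsub>Q\<^esub> = I +> \<one>"
  by (simp add: quotient_algebra_def FactRing_def)

lemma Q_zero: "\<zero>\<^bsub>Q\<^esub> = I +> \<zero>"
  using a_coset_add_zero[OF a_subset] by (simp add: quotient_algebra_def FactRing_def)

text \<open>The definition takes a union over all representatives of the coset. Each of them
  contributes the same coset, so the union collapses.\<close>

lemma Q_smult [simp]:
  assumes "x \<in> carrier A" shows "c \<odot>\<^bsub>Q\<^esub> (I +> x) = I +> (c \<odot> x)"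
proof -
  have "I +> (c \<odot> x') = I +> (c \<odot> x)" if "x' \<in> I +> x" for x'
  proof -
    have x': "x' \<in> carrier A" using that assms a_r_coset_subset_G[OF a_subset] by auto
    then have "x' \<ominus> x \<in> I" using that assms a_rcos_module_minus[OF ring_axioms] by auto
    then have "c \<odot> (x' \<ominus> x) \<in> I" by (rule ideal_smult_closed)
    then have "(c \<odot> x') \<ominus> (c \<odot> x) \<in> I"
      using assms x' by (simp add: minus_eq smult_r_distr smult_a_inv)
    then show ?thesis using assms x' by (simp add: coset_eq_iff)
  qed
  moreover have "I +> x \<noteq> {}" using a_rcos_self[OF assms] by (metis empty_iff)
  ultimately have "(\<Union>x'\<in>I +> x. I +> (c \<odot> x')) = I +> (c \<odot> x)" by (intro SUP_eq_const)
  then show ?thesis by (simp add: quotient_algebra_def)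
qed

lemma Q_cases:
  assumes "X \<in> carrier Q" obtains x where "x \<in> carrier A" "X = I +> x"
  using assms by (auto simp: Q_carrier)

lemma complex_alg_Q: "complex_alg Q"
proof (intro complex_alg.intro complex_alg_axioms.intro)
  show "ring Q" by (rule ring_cong[OF quotient_is_ring]) (simp_all add: quotient_algebra_def)
next
  fix c d x y
  show "c \<odot>\<^bsub>Q\<^esub> x \<in> carrier Q" if "x \<in> carrier Q"
    using that by (elim Q_cases) (simp)
  show "(c + d) \<odot>\<^bsub>Q\<^esub> x = c \<odot>\<^bsub>Q\<^esub> x \<oplus>\<^bsub>Q\<^esub> d \<odot>\<^bsub>Q\<^esub> x" if "x \<in> carrier Q"
    using that by (elim Q_cases) (simp add: smult_l_distr)
  show "c \<odot>\<^bsub>Q\<^esub> (x \<oplus>\<^bsub>Q\<^esub> y) = c \<odot>\<^bsub>Q\<^esub> x \<oplus>\<^bsub>Q\<^esub> c \<odot>\<^bsub>Q\<^esub> y"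
    if "x \<in> carrier Q" "y \<in> carrier Q"
    using that by (elim Q_cases) (simp add: smult_r_distr)
  show "c \<odot>\<^bsub>Q\<^esub> (d \<odot>\<^bsub>Q\<^esub> x) = (c * d) \<odot>\<^bsub>Q\<^esub> x" if "x \<in> carrier Q"
    using that by (elim Q_cases) (simp add: smult_smult)
  show "1 \<odot>\<^bsub>Q\<^esub> x = x" if "x \<in> carrier Q"
    using that by (elim Q_cases) (simp)
  show "(c \<odot>\<^bsub>Q\<^esub> x) \<otimes>\<^bsub>Q\<^esub> y = c \<odot>\<^bsub>Q\<^esub> (x \<otimes>\<^bsub>Q\<^esub> y)"
    if "x \<in> carrier Q" "y \<in> carrier Q"
    using that by (elim Q_cases) (simp add: smult_m_l)
  show "x \<otimes>\<^bsub>Q\<^esub> (c \<odot>\<^bsub>Q\<^esub> y) = c \<odot>\<^bsub>Q\<^esub> (x \<otimes>\<^bsub>Q\<^esub> y)"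
    if "x \<in> carrier Q" "y \<in> carrier Q"
    using that by (elim Q_cases) (simp add: smult_m_r)
qed

lemma coset_algebra_hom: "(+>) I \<in> algebra_hom A Q"
  by (intro algebra_homI linear_mapI) (simp_all add: Q_one)

text \<open>This gives the definitions by \<open>the_elem\<close> their meaning: a linear map that
  vanishes on the ideal is constant on each coset. \<open>extend_hom\<close> and
  \<open>tensor_map\<close> are both evaluated through it.\<close>

lemma the_elem_image_coset:
  assumes B: "complex_alg B" and f: "linear_map A B f" and I: "\<And>x. x \<in> I \<Longrightarrow> f x = \<zero>\<^bsub>B\<^esub>"
    and x: "x \<in> carrier A"
  shows "the_elem (f ` (I +> x)) = f x"
proof -
  interpret B: complex_alg B by (rule B)
  have const: "f x' = f x" if "x' \<in> I +> x" for x'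
  proof -
    have "x' \<in> (\<Union>i\<in>I. {i \<oplus> x})" using that by (simp only: a_r_coset_def')
    then obtain i where i: "i \<in> I" "x' = i \<oplus> x" by (elim UN_E singletonE)
    then have "f x' = f i \<oplus>\<^bsub>B\<^esub> f x" using x linear_mapD(2)[OF f, of i x] by simp
    also have "\<dots> = f x" using I[OF i(1)] linear_mapD(1)[OF f x] by simp
    finally show ?thesis .
  qed
  have "I +> x \<noteq> {}" using a_rcos_self[OF x] by (metis empty_iff)
  then show ?thesis using const by (rule the_elem_image_unique)
qed

end

section \<open>Evaluation of words and the free algebra\<close>

context complex_alg
begin

abbreviation word_val where "word_val \<phi> w \<equiv> foldr (\<lambda>g a. \<phi> g \<otimes> a) w \<one>"

lemma word_val_closed [simp]:
  assumes "\<And>g. \<phi> g \<in> carrier A" shows "word_val \<phi> w \<in> carrier A"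
  using assms by (induction w) auto

lemma word_val_append:
  assumes "\<And>g. \<phi> g \<in> carrier A" shows "word_val \<phi> (v @ w) = word_val \<phi> v \<otimes> word_val \<phi> w"
  using assms by (induction v) (auto simp: m_assoc)

lemma eval_free_lin_ext: "eval_free A \<phi> = lin_ext A (word_val \<phi>)"
  by (simp add: eval_free_def lin_ext_def fun_eq_iff)

lemma eval_free_single [simp]:
  "(\<And>g. \<phi> g \<in> carrier A) \<Longrightarrow> eval_free A \<phi> (Poly_Mapping.single w c) = c \<odot> word_val \<phi> w"
  by (simp add: eval_free_lin_ext)

lemma lin_ext_diff:
  assumes "Poly_Mapping.keys p \<subseteq> S" "Poly_Mapping.keys p' \<subseteq> S" "\<beta> \<in> S \<rightarrow> carrier A"
  shows "lin_ext A \<beta> (p - p') = lin_ext A \<beta> p \<ominus> lin_ext A \<beta> p'"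
proof -
  have e: "p - p' = p + Poly_Mapping.map ((*) (-1)) p'"
    by (rule poly_mapping_eqI) (simp add: lookup_minus lookup_add)
  have "lin_ext A \<beta> (p - p') = lin_ext A \<beta> p \<oplus> lin_ext A \<beta> (Poly_Mapping.map ((*) (-1)) p')"
    unfolding e by (rule lin_ext_add[OF assms(1) order_trans[OF keys_map_scale assms(2)] assms(3)])
  also have "\<dots> = lin_ext A \<beta> p \<ominus> lin_ext A \<beta> p'"
    by (simp add: lin_ext_scale[OF assms(2,3)] minus_eq a_inv_conv_smult lin_ext_closed[OF assms(2,3)])
  finally show ?thesis .
qed

lemma eval_free_add:
  "(\<And>g. \<phi> g \<in> carrier A) \<Longrightarrow> eval_free A \<phi> (p + p') = eval_free A \<phi> p \<oplus> eval_free A \<phi> p'"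
  unfolding eval_free_lin_ext by (rule lin_ext_add[of _ UNIV]) auto

lemma eval_free_diff:
  "(\<And>g. \<phi> g \<in> carrier A) \<Longrightarrow> eval_free A \<phi> (p - p') = eval_free A \<phi> p \<ominus> eval_free A \<phi> p'"
  unfolding eval_free_lin_ext by (rule lin_ext_diff[of _ UNIV]) auto

lemma eval_free_closed:
  "(\<And>g. \<phi> g \<in> carrier A) \<Longrightarrow> eval_free A \<phi> p \<in> carrier A"
  unfolding eval_free_lin_ext by (rule lin_ext_closed[of _ UNIV]) auto

end

lemma monoid_alg_words: "monoid_alg \<lparr>carrier = UNIV, mult = (@), one = []\<rparr>"
  by (intro monoid_alg.intro monoidI) auto

lemmas free_algebra_simps [simp] =
    monoid_alg.MA_simps[OF monoid_alg_words, folded free_algebra_def, simplified]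
  and free_algebra_single [simp] =
    monoid_alg.MA_single[OF monoid_alg_words, folded free_algebra_def, simplified]

lemma carrier_free_algebra [simp]: "carrier free_algebra = UNIV"
  by auto

lemma complex_alg_free: "complex_alg free_algebra"
  unfolding free_algebra_def by (rule monoid_alg.complex_alg_MA[OF monoid_alg_words])

text \<open>Both sides of the multiplication rule are bilinear, so it suffices to treat words, whose
  product is concatenation.\<close>

lemma eval_free_algebra_hom:
  fixes A (structure)
  assumes "complex_alg A" "\<And>g. \<phi> g \<in> carrier A"
  shows "eval_free A \<phi> \<in> algebra_hom free_algebra A"
proof -
  interpret complex_alg A by fact
  interpret free: complex_alg free_algebra by (rule complex_alg_free)
  note \<phi> = assms(2)
  have cl: "word_val \<phi> \<in> UNIV \<rightarrow> carrier A" using \<phi> by auto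
  have lin: "linear_map free_algebra A (eval_free A \<phi>)"
  proof (rule linear_mapI)
    show "eval_free A \<phi> (c \<odot>\<^bsub>free_algebra\<^esub> x) = c \<odot> eval_free A \<phi> x" for c x
      unfolding eval_free_lin_ext free_algebra_simps by (rule lin_ext_scale[OF _ cl]) simp
  qed (simp_all add: eval_free_add eval_free_closed \<phi>)
  have mult: "eval_free A \<phi> (p \<otimes>\<^bsub>free_algebra\<^esub> r) = eval_free A \<phi> p \<otimes> eval_free A \<phi> r" for p r
  proof -
    have *: "eval_free A \<phi> (Poly_Mapping.single w c \<otimes>\<^bsub>free_algebra\<^esub> r) = eval_free A \<phi> (Poly_Mapping.single w c) \<otimes> eval_free A \<phi> r" for w c
      using subset_UNIV[of "Poly_Mapping.keys r"]
    proof (induction r rule: poly_mapping_keys_induct)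
      case zero
      then show ?case using \<phi> free.r_null[of "Poly_Mapping.single w c"] by (simp add: eval_free_lin_ext)
    next
      case (single v d)
      then show ?case using \<phi> by (simp add: word_val_append smult_m_l smult_m_r smult_smult mult.commute del: foldr_append)
    next
      case (add r r')
      then show ?case using \<phi> free.r_distr[of r r' "Poly_Mapping.single w c"]
        by (simp add: eval_free_add eval_free_closed r_distr)
    qed
    show ?thesis using subset_UNIV[of "Poly_Mapping.keys p"]
    proof (induction p rule: poly_mapping_keys_induct)
      case zero
      then show ?case using \<phi> free.l_null[of r] by (simp add: eval_free_lin_ext l_null eval_free_closed[unfolded eval_free_lin_ext])
    next
      case (single v d)
      show ?case by (rule *)
    next
      case (add p p')
      then show ?case using \<phi> free.l_distr[of p p' r]
        by (simp add: eval_free_add eval_free_closed l_distr)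
    qed
  qed
  show ?thesis using lin mult by (rule algebra_homI) (simp_all add: \<phi>)
qed

lemma algebra_ideal_Idl: "algebra_ideal (Idl\<^bsub>free_algebra\<^esub> R) free_algebra"
proof -
  interpret free: complex_alg free_algebra by (rule complex_alg_free)
  show ?thesis
    by (intro algebra_ideal.intro complex_alg_free free.genideal_ideal) auto
qed

lemma complex_alg_presented: "complex_alg (presented_algebra R)"
  unfolding presented_algebra_def by (rule algebra_ideal.complex_alg_Q[OF algebra_ideal_Idl])

lemma generator_closed [simp]: "generator R g \<in> carrier (presented_algebra R)"
  unfolding presented_algebra_def generator_def
  by (rule algebra_ideal.Q_closed[OF algebra_ideal_Idl]) simp

text \<open>The canonical projection of the free algebra; its value at a one-letter word is the
  corresponding \<open>generator\<close>.\<close>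

definition free_class :: "('g list \<Rightarrow>\<^sub>0 complex) set \<Rightarrow> ('g list \<Rightarrow>\<^sub>0 complex) \<Rightarrow> ('g list \<Rightarrow>\<^sub>0 complex) set" where
  "free_class R p = Idl\<^bsub>free_algebra\<^esub> R +>\<^bsub>free_algebra\<^esub> p"

lemma free_class_algebra_hom: "free_class R \<in> algebra_hom free_algebra (presented_algebra R)"
  using algebra_ideal.coset_algebra_hom[OF algebra_ideal_Idl]
  by (simp add: presented_algebra_def free_class_def[abs_def])

lemma carrier_presented: "carrier (presented_algebra R) = range (free_class R)"
  using algebra_ideal.Q_carrier[OF algebra_ideal_Idl[of R]]
  by (simp add: presented_algebra_def free_class_def[abs_def])

text \<open>Words are built from the left one letter at a time, so instead of closure under all
  products only closure under prefixing a generator is asked. Leibniz rules for a generator on the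
  left fit this form exactly.\<close>

lemma presented_induct [consumes 1, case_names one gen smult add]:
  fixes R :: "('g list \<Rightarrow>\<^sub>0 complex) set"
  defines "B \<equiv> presented_algebra R"
  assumes x: "x \<in> carrier B"
    and one: "P \<one>\<^bsub>B\<^esub>"
    and gen: "\<And>g x. \<lbrakk>x \<in> carrier B; P x\<rbrakk> \<Longrightarrow> P (generator R g \<otimes>\<^bsub>B\<^esub> x)"
    and smult: "\<And>c x. \<lbrakk>x \<in> carrier B; P x\<rbrakk> \<Longrightarrow> P (c \<odot>\<^bsub>B\<^esub> x)"
    and add: "\<And>x y. \<lbrakk>x \<in> carrier B; y \<in> carrier B; P x; P y\<rbrakk> \<Longrightarrow> P (x \<oplus>\<^bsub>B\<^esub> y)"
  shows "P x"
proof -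
  interpret B: complex_alg B unfolding B_def by (rule complex_alg_presented)
  have hom: "free_class R \<in> algebra_hom free_algebra B" unfolding B_def by (rule free_class_algebra_hom)
  note lin = linear_mapD[OF algebra_hom_linear_map[OF hom]]
  have cl: "free_class R p \<in> carrier B" for p by (rule lin(1)) simp
  have word: "P (free_class R (Poly_Mapping.single w 1))" for w
  proof (induction w)
    case Nil
    then show ?case using one algebra_homD(2)[OF hom] by simp
  next
    case (Cons g w)
    have "free_class R (Poly_Mapping.single (g # w) 1) =
      free_class R (Poly_Mapping.single [g] 1) \<otimes>\<^bsub>B\<^esub> free_class R (Poly_Mapping.single w 1)"
      using algebra_homD(1)[OF hom, of "Poly_Mapping.single [g] 1" "Poly_Mapping.single w 1"] by simp
    also have "free_class R (Poly_Mapping.single [g] 1) = generator R g"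
      by (simp add: free_class_def generator_def)
    finally show ?case using gen[OF cl Cons] by simp
  qed
  have single: "P (free_class R (Poly_Mapping.single w c))" for w c
    using smult[OF cl word, of c w] lin(3)[of "Poly_Mapping.single w 1" c] by simp
  have "P (free_class R p)" for p using subset_UNIV[of "Poly_Mapping.keys p"]
  proof (induction p rule: poly_mapping_keys_induct)
    case zero
    then show ?case using single[of "[]" 0] by simp
  next
    case (add p p')
    then show ?case using assms(6)[OF cl cl] lin(2)[of p p'] by simp
  qed (rule single)
  then show ?thesis using x by (auto simp: B_def carrier_presented)
qed

text \<open>With \<open>eval_free_generator_relation\<close>, this lets the general translation of
  relations into equations be applied to the generators of the presented algebra itself.\<close>

lemma eval_free_generator: "eval_free (presented_algebra R) (generator R) p = free_class R p"
proof -
  let ?B = "presented_algebra R"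
  interpret B: complex_alg ?B by (rule complex_alg_presented)
  have hom: "free_class R \<in> algebra_hom free_algebra ?B" by (rule free_class_algebra_hom)
  note lin = linear_mapD[OF algebra_hom_linear_map[OF hom]]
  have word: "free_class R (Poly_Mapping.single w 1) = B.word_val (generator R) w" for w
  proof (induction w)
    case Nil
    then show ?case using algebra_homD(2)[OF hom] by simp
  next
    case (Cons g w)
    have "free_class R (Poly_Mapping.single (g # w) 1) =
      free_class R (Poly_Mapping.single [g] 1) \<otimes>\<^bsub>?B\<^esub> free_class R (Poly_Mapping.single w 1)"
      using algebra_homD(1)[OF hom, of "Poly_Mapping.single [g] 1" "Poly_Mapping.single w 1"] by simp
    also have "free_class R (Poly_Mapping.single [g] 1) = generator R g"
      by (simp add: free_class_def generator_def)
    finally show ?case using Cons by simp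
  qed
  have single: "free_class R (Poly_Mapping.single w c) = c \<odot>\<^bsub>?B\<^esub> B.word_val (generator R) w" for w c
    using lin(3)[of "Poly_Mapping.single w 1" c] word by simp
  show ?thesis using subset_UNIV[of "Poly_Mapping.keys p"]
  proof (induction p rule: poly_mapping_keys_induct)
    case zero
    then show ?case using single[of "[]" 0] by (simp add: B.eval_free_lin_ext)
  next
    case (single w c)
    then show ?case using \<open>\<And>w c. free_class R (Poly_Mapping.single w c) = _ w c\<close> by simp
  next
    case (add p p')
    then show ?case using lin(2)[of p p'] by (simp add: B.eval_free_add)
  qed
qed

lemma eval_free_generator_relation:
  assumes "r \<in> R"
  shows "eval_free (presented_algebra R) (generator R) r = \<zero>\<^bsub>presented_algebra R\<^esub>"
proof -
  interpret I: algebra_ideal "Idl\<^bsub>free_algebra\<^esub> R" free_algebra by (rule algebra_ideal_Idl)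
  interpret free: complex_alg free_algebra by (rule complex_alg_free)
  have r: "r \<in> Idl\<^bsub>free_algebra\<^esub> R" using assms free.genideal_self[of R] by auto
  have "r \<ominus>\<^bsub>free_algebra\<^esub> \<zero>\<^bsub>free_algebra\<^esub> = r"
    by (simp add: free.minus_eq del: free_algebra_simps)
  then have "free_class R r = free_class R \<zero>\<^bsub>free_algebra\<^esub>"
    using r unfolding free_class_def by (subst I.coset_eq_iff) (simp_all del: free_algebra_simps)
  also have "\<dots> = \<zero>\<^bsub>presented_algebra R\<^esub>"
    unfolding free_class_def presented_algebra_def by (rule I.Q_zero[symmetric])
  finally show ?thesis by (simp add: eval_free_generator)
qed

section \<open>The universal property of a presented algebra\<close>

locale presented_hom = complex_alg A for A :: "(complex, 'a, 'x) module_scheme" (structure) +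
  fixes R :: "('g list \<Rightarrow>\<^sub>0 complex) set" and \<phi> :: "'g \<Rightarrow> 'a"
  assumes gen_closed: "\<And>g. \<phi> g \<in> carrier A"
    and relations: "\<And>r. r \<in> R \<Longrightarrow> eval_free A \<phi> r = \<zero>"
begin

abbreviation B where "B \<equiv> presented_algebra R"

lemma eval_hom: "eval_free A \<phi> \<in> algebra_hom free_algebra A"
  by (rule eval_free_algebra_hom[OF complex_alg_axioms gen_closed])

text \<open>The kernel of the evaluation is an ideal that contains \<open>R\<close>, hence it
  contains the least such ideal.\<close>

lemma eval_free_Idl:
  assumes "x \<in> Idl\<^bsub>free_algebra\<^esub> R" shows "eval_free A \<phi> x = \<zero>"
proof -
  have ideal: "ideal (a_kernel free_algebra A (eval_free A \<phi>)) free_algebra"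
    by (rule ring_hom_ring.kernel_is_ideal[OF ring_hom_ring_algebra_hom[OF complex_alg_free
          complex_alg_axioms eval_hom]])
  have "R \<subseteq> a_kernel free_algebra A (eval_free A \<phi>)"
    by (rule subsetI) (simp add: a_kernel_def' relations)
  then have "Idl\<^bsub>free_algebra\<^esub> R \<subseteq> a_kernel free_algebra A (eval_free A \<phi>)"
    by (rule ring.genideal_minimal[OF complex_alg.axioms(1)[OF complex_alg_free] ideal])
  then have "x \<in> a_kernel free_algebra A (eval_free A \<phi>)" using assms by (rule subsetD)
  then show ?thesis by (simp add: a_kernel_def')
qed

lemma extend_hom_free_class: "extend_hom A \<phi> (free_class R p) = eval_free A \<phi> p"
  unfolding extend_hom_def free_class_def
  by (rule algebra_ideal.the_elem_image_coset[OF algebra_ideal_Idl complex_alg_axioms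
        algebra_hom_linear_map[OF eval_hom] eval_free_Idl]) simp_all

lemma extend_hom_generator [simp]: "extend_hom A \<phi> (generator R g) = \<phi> g"
  using extend_hom_free_class[of "Poly_Mapping.single [g] 1"] gen_closed
  by (simp add: free_class_def generator_def)

lemma extend_hom_algebra_hom: "extend_hom A \<phi> \<in> algebra_hom B A"
proof -
  have hom: "free_class R \<in> algebra_hom free_algebra B" by (rule free_class_algebra_hom)
  note lin = linear_mapD[OF algebra_hom_linear_map[OF hom]]
  note elin = linear_mapD[OF algebra_hom_linear_map[OF eval_hom]]
  have cases: thesis if "x \<in> carrier B" "\<And>p. x = free_class R p \<Longrightarrow> thesis" for x thesis
    using that by (auto simp: carrier_presented)
  show ?thesis
  proof (intro algebra_homI linear_mapI)
    show "extend_hom A \<phi> x \<in> carrier A" if "x \<in> carrier B" for x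
      using that elin(1) by (elim cases) (simp add: extend_hom_free_class)
    show "extend_hom A \<phi> (x \<oplus>\<^bsub>B\<^esub> y) = extend_hom A \<phi> x \<oplus> extend_hom A \<phi> y"
      if "x \<in> carrier B" "y \<in> carrier B" for x y
      using that elin(2) by (elim cases) (simp add: extend_hom_free_class lin(2)[symmetric])
    show "extend_hom A \<phi> (c \<odot>\<^bsub>B\<^esub> x) = c \<odot> extend_hom A \<phi> x" if "x \<in> carrier B" for c x
      using that elin(3) by (elim cases) (simp add: extend_hom_free_class lin(3)[symmetric])
    show "extend_hom A \<phi> (x \<otimes>\<^bsub>B\<^esub> y) = extend_hom A \<phi> x \<otimes> extend_hom A \<phi> y"
      if "x \<in> carrier B" "y \<in> carrier B" for x y
      using that algebra_homD(1)[OF eval_hom]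
      by (elim cases) (simp add: extend_hom_free_class algebra_homD(1)[OF hom, symmetric])
    show "extend_hom A \<phi> \<one>\<^bsub>B\<^esub> = \<one>"
      using algebra_homD(2)[OF hom, symmetric] algebra_homD(2)[OF eval_hom]
      by (simp only: extend_hom_free_class)
  qed
qed

end

section \<open>Tensor products\<close>

lemma keys_diff_subset:
  fixes p :: "'u \<Rightarrow>\<^sub>0 complex"
  shows "Poly_Mapping.keys (p - p') \<subseteq> Poly_Mapping.keys p \<union> Poly_Mapping.keys p'"
  by (auto simp: in_keys_iff lookup_minus)

context monoid_alg
begin

lemma MA_diff_l: "(p - p') \<otimes>\<^bsub>MA\<^esub> r = p \<otimes>\<^bsub>MA\<^esub> r - p' \<otimes>\<^bsub>MA\<^esub> r"
  using MA_add_l[of "p - p'" p' r] by (simp add: algebra_simps)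

lemma MA_diff_r: "r \<otimes>\<^bsub>MA\<^esub> (p - p') = r \<otimes>\<^bsub>MA\<^esub> p - r \<otimes>\<^bsub>MA\<^esub> p'"
  using MA_add_r[of r "p - p'" p'] by (simp add: algebra_simps)

lemma MA_minus:
  assumes "Poly_Mapping.keys r \<subseteq> carrier M"
  shows "p \<ominus>\<^bsub>MA\<^esub> r = p - r"
proof -
  interpret MA: complex_alg MA by (rule complex_alg_MA)
  have "p \<ominus>\<^bsub>MA\<^esub> r = p + Poly_Mapping.map ((*) (-1)) r"
    using assms by (simp add: MA.minus_eq MA.a_inv_conv_smult)
  also have "\<dots> = p - r"
    by (rule poly_mapping_eqI) (simp add: lookup_add lookup_minus)
  finally show ?thesis .
qed

end

lemma bilinear_relationsI:
  "\<lbrakk>x \<in> carrier H; x' \<in> carrier H; y \<in> carrier K\<rbrakk> \<Longrightarrow>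
    Poly_Mapping.single (x \<oplus>\<^bsub>H\<^esub> x', y) 1 - Poly_Mapping.single (x, y) 1
      - Poly_Mapping.single (x', y) 1 \<in> bilinear_relations H K"
  "\<lbrakk>x \<in> carrier H; y \<in> carrier K; y' \<in> carrier K\<rbrakk> \<Longrightarrow>
    Poly_Mapping.single (x, y \<oplus>\<^bsub>K\<^esub> y') 1 - Poly_Mapping.single (x, y) 1
      - Poly_Mapping.single (x, y') 1 \<in> bilinear_relations H K"
  "\<lbrakk>x \<in> carrier H; y \<in> carrier K\<rbrakk> \<Longrightarrow>
    Poly_Mapping.single (c \<odot>\<^bsub>H\<^esub> x, y) 1 - Poly_Mapping.single (x, y) c \<in> bilinear_relations H K"
  "\<lbrakk>x \<in> carrier H; y \<in> carrier K\<rbrakk> \<Longrightarrow>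
    Poly_Mapping.single (x, c \<odot>\<^bsub>K\<^esub> y) 1 - Poly_Mapping.single (x, y) c \<in> bilinear_relations H K"
  unfolding bilinear_relations_def by blast+

lemma bilinear_relationsE [consumes 1, case_names add_l add_r smult_l smult_r]:
  assumes "r \<in> bilinear_relations H K"
  obtains x x' y where "x \<in> carrier H" "x' \<in> carrier H" "y \<in> carrier K"
    "r = Poly_Mapping.single (x \<oplus>\<^bsub>H\<^esub> x', y) 1 - Poly_Mapping.single (x, y) 1
      - Poly_Mapping.single (x', y) 1"
  | x y y' where "x \<in> carrier H" "y \<in> carrier K" "y' \<in> carrier K"
    "r = Poly_Mapping.single (x, y \<oplus>\<^bsub>K\<^esub> y') 1 - Poly_Mapping.single (x, y) 1
      - Poly_Mapping.single (x, y') 1"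
  | c x y where "x \<in> carrier H" "y \<in> carrier K"
    "r = Poly_Mapping.single (c \<odot>\<^bsub>H\<^esub> x, y) 1 - Poly_Mapping.single (x, y) c"
  | c x y where "x \<in> carrier H" "y \<in> carrier K"
    "r = Poly_Mapping.single (x, c \<odot>\<^bsub>K\<^esub> y) 1 - Poly_Mapping.single (x, y) c"
  using assms unfolding bilinear_relations_def by blast

section \<open>The tensor product as a quotient algebra\<close>

locale alg_tensor = H: complex_alg H + K: complex_alg K
  for H :: "(complex, 'h, 'x) module_scheme" and K :: "(complex, 'k, 'y) module_scheme"
begin

abbreviation MA where "MA \<equiv> monoid_algebra (H \<times>\<times> K)"
abbreviation N where "N \<equiv> tensor_null H K"
abbreviation T where "T \<equiv> tensor_algebra H K"
abbreviation pure where "pure \<equiv> pure_tensor H K"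

lemma monoid_alg_DirProd: "monoid_alg (H \<times>\<times> K)"
  by (intro monoid_alg.intro DirProd_monoid H.is_monoid K.is_monoid)

lemmas MA_simps [simp] = monoid_alg.MA_simps[OF monoid_alg_DirProd]
lemmas MA_single [simp] = monoid_alg.MA_single[OF monoid_alg_DirProd]
lemmas complex_alg_MA = monoid_alg.complex_alg_MA[OF monoid_alg_DirProd]
lemmas MA_diff_l = monoid_alg.MA_diff_l[OF monoid_alg_DirProd]
lemmas MA_diff_r = monoid_alg.MA_diff_r[OF monoid_alg_DirProd]
lemmas MA_minus = monoid_alg.MA_minus[OF monoid_alg_DirProd]

lemma single_carrier: "\<lbrakk>x \<in> carrier H; y \<in> carrier K\<rbrakk> \<Longrightarrow> Poly_Mapping.single (x, y) c \<in> carrier MA"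
  by simp

lemma diff_carrier: "\<lbrakk>x \<in> carrier MA; y \<in> carrier MA\<rbrakk> \<Longrightarrow> x - y \<in> carrier MA"
  unfolding MA_simps by (rule order_trans[OF keys_diff_subset]) simp

lemma relations_carrier: "bilinear_relations H K \<subseteq> carrier MA"
proof
  fix r assume "r \<in> bilinear_relations H K"
  then show "r \<in> carrier MA"
    by (cases rule: bilinear_relationsE)
      (simp_all add: diff_carrier single_carrier del: MA_simps)
qed

lemma relations_mult:
  assumes "r \<in> bilinear_relations H K" and u: "u \<in> carrier H" "v \<in> carrier K"
  shows "Poly_Mapping.single (u, v) 1 \<otimes>\<^bsub>MA\<^esub> r \<in> bilinear_relations H K"
    and "r \<otimes>\<^bsub>MA\<^esub> Poly_Mapping.single (u, v) 1 \<in> bilinear_relations H K"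
proof -
  have "Poly_Mapping.single (u, v) 1 \<otimes>\<^bsub>MA\<^esub> r \<in> bilinear_relations H K \<and>
    r \<otimes>\<^bsub>MA\<^esub> Poly_Mapping.single (u, v) 1 \<in> bilinear_relations H K"
    using assms(1) u
    by (cases rule: bilinear_relationsE)
      (simp_all add: MA_diff_l MA_diff_r H.r_distr K.r_distr H.l_distr K.l_distr
        H.smult_m_l H.smult_m_r K.smult_m_l K.smult_m_r bilinear_relationsI)
  then show "Poly_Mapping.single (u, v) 1 \<otimes>\<^bsub>MA\<^esub> r \<in> bilinear_relations H K"
    and "r \<otimes>\<^bsub>MA\<^esub> Poly_Mapping.single (u, v) 1 \<in> bilinear_relations H K" by auto
qed

text \<open>\<open>tensor_null\<close> is only a linear span, yet it is a two-sided ideal: the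
  product of a bilinearity relation with a basis pair is a relation of the same kind
  (\<open>relations_mult\<close>), and both factors extend from there by linearity.\<close>

lemma algebra_ideal_N: "algebra_ideal N MA"
proof -
  interpret MA: complex_alg MA by (rule complex_alg_MA)
  note carr = relations_carrier
  have sub: "N \<subseteq> carrier MA"
    unfolding tensor_null_def by (rule MA.lin_span_carrier[OF carr])
  have add: "x \<oplus>\<^bsub>MA\<^esub> y \<in> N" if "x \<in> N" "y \<in> N" for x y
    using that unfolding tensor_null_def by (rule MA.lin_span_add[OF carr])
  have smult: "c \<odot>\<^bsub>MA\<^esub> x \<in> N" if "x \<in> N" for c x
    using that unfolding tensor_null_def by (rule MA.lin_span_smult[OF carr])
  have zero: "\<zero>\<^bsub>MA\<^esub> \<in> N" unfolding tensor_null_def by (rule MA.lin_span_zero)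
  have pure: "Poly_Mapping.single (u, v) 1 \<otimes>\<^bsub>MA\<^esub> r \<in> N \<and> r \<otimes>\<^bsub>MA\<^esub> Poly_Mapping.single (u, v) 1 \<in> N"
    if r: "r \<in> N" and uv: "u \<in> carrier H" "v \<in> carrier K" for u v r
  proof -
    define s :: "('h \<times> 'k) \<Rightarrow>\<^sub>0 complex" where "s = Poly_Mapping.single (u, v) 1"
    have s: "s \<in> carrier MA" using uv by (simp add: s_def)
    from r have "r \<in> lin_span MA (bilinear_relations H K)" by (simp add: tensor_null_def)
    from this carr show ?thesis unfolding s_def[symmetric]
    proof (induction rule: MA.lin_span_induct)
      case zero
      then show ?case using s MA.l_null[OF s] MA.r_null[OF s] \<open>\<zero>\<^bsub>MA\<^esub> \<in> N\<close> by metis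
    next
      case (smult c r)
      have rc: "r \<in> carrier MA" using smult carr by (rule_tac subsetD)
      have "s \<otimes>\<^bsub>MA\<^esub> r \<in> N" "r \<otimes>\<^bsub>MA\<^esub> s \<in> N"
        using relations_mult[OF smult uv] MA.lin_span_base[OF _ carr]
        unfolding s_def tensor_null_def by metis+
      then show ?case
        using MA.smult_m_l[OF rc s, of c] MA.smult_m_r[OF s rc, of c]
          \<open>\<And>x c. x \<in> N \<Longrightarrow> c \<odot>\<^bsub>MA\<^esub> x \<in> N\<close> by metis
    next
      case (add x y)
      then show ?case
        using MA.l_distr[OF add(1,2) s] MA.r_distr[OF add(1,2) s]
          \<open>\<And>x y. x \<in> N \<Longrightarrow> y \<in> N \<Longrightarrow> x \<oplus>\<^bsub>MA\<^esub> y \<in> N\<close> by metis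
    qed
  qed
  have mult: "p \<otimes>\<^bsub>MA\<^esub> r \<in> N \<and> r \<otimes>\<^bsub>MA\<^esub> p \<in> N" if r: "r \<in> N" and p: "p \<in> carrier MA" for r p
  proof -
    from p have "Poly_Mapping.keys p \<subseteq> carrier H \<times> carrier K" by simp
    then show ?thesis
    proof (induction p rule: poly_mapping_keys_induct)
      case zero
      show ?case
        using MA.l_null[OF subsetD[OF sub r]] MA.r_null[OF subsetD[OF sub r]] \<open>\<zero>\<^bsub>MA\<^esub> \<in> N\<close>
        by simp
    next
      case (single w c)
      obtain u v where w: "w = (u, v)" "u \<in> carrier H" "v \<in> carrier K" using single by auto
      have s: "Poly_Mapping.single w 1 \<in> carrier MA" using w by simp
      have e: "Poly_Mapping.single w c = c \<odot>\<^bsub>MA\<^esub> Poly_Mapping.single w 1" by simp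
      show ?case
        using MA.smult_m_l[OF s subsetD[OF sub r]] MA.smult_m_r[OF subsetD[OF sub r] s]
          pure[OF r w(2,3)] smult
        unfolding e w(1)[symmetric] by metis
    next
      case (add p p')
      then have c: "p \<in> carrier MA" "p' \<in> carrier MA" by simp_all
      show ?case
        using MA.l_distr[OF c subsetD[OF sub r]] MA.r_distr[OF c subsetD[OF sub r]] add(3,4)
          \<open>\<And>x y. x \<in> N \<Longrightarrow> y \<in> N \<Longrightarrow> x \<oplus>\<^bsub>MA\<^esub> y \<in> N\<close> MA_simps(3) by metis
    qed
  qed
  have "ideal N MA"
  proof (rule idealI)
    show "subgroup N (add_monoid MA)"
    proof (rule MA.add.subgroupI)
      show "N \<noteq> {}" using zero by (metis empty_iff)
      show "\<ominus>\<^bsub>MA\<^esub> a \<in> N" if "a \<in> N" for a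
        using smult[OF that, of "-1"] MA.a_inv_conv_smult[OF subsetD[OF sub that]] by metis
    qed (rule sub, rule add)
  qed (use mult in \<open>simp_all add: MA.ring_axioms\<close>)
  then show ?thesis by (intro algebra_ideal.intro complex_alg_MA)
qed

lemma complex_alg_T: "complex_alg T"
  unfolding tensor_algebra_def by (rule algebra_ideal.complex_alg_Q[OF algebra_ideal_N])

lemma pure_closed [simp]: "\<lbrakk>x \<in> carrier H; y \<in> carrier K\<rbrakk> \<Longrightarrow> pure x y \<in> carrier T"
  unfolding tensor_algebra_def pure_tensor_def
  by (rule algebra_ideal.Q_closed[OF algebra_ideal_N single_carrier])

lemma pure_mult [simp]:
  "\<lbrakk>x \<in> carrier H; y \<in> carrier K; x' \<in> carrier H; y' \<in> carrier K\<rbrakk> \<Longrightarrow>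
    pure x y \<otimes>\<^bsub>T\<^esub> pure x' y' = pure (x \<otimes>\<^bsub>H\<^esub> x') (y \<otimes>\<^bsub>K\<^esub> y')"
  unfolding tensor_algebra_def pure_tensor_def
  by (simp add: algebra_ideal.Q_mult[OF algebra_ideal_N])

lemma pure_one: "\<one>\<^bsub>T\<^esub> = pure \<one>\<^bsub>H\<^esub> \<one>\<^bsub>K\<^esub>"
  unfolding tensor_algebra_def pure_tensor_def
  by (simp add: algebra_ideal.Q_one[OF algebra_ideal_N])

lemma relation_coset_eq:
  assumes "p - p' \<in> bilinear_relations H K" "p \<in> carrier MA" "p' \<in> carrier MA"
  shows "N +>\<^bsub>MA\<^esub> p = N +>\<^bsub>MA\<^esub> p'"
proof -
  interpret MA: complex_alg MA by (rule complex_alg_MA)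
  have "p \<ominus>\<^bsub>MA\<^esub> p' \<in> N"
    using assms MA.lin_span_base[OF _ relations_carrier] by (simp add: MA_minus tensor_null_def)
  then show ?thesis using algebra_ideal.coset_eq_iff[OF algebra_ideal_N assms(2,3)] by metis
qed

lemma pure_add_l:
  assumes "x \<in> carrier H" "x' \<in> carrier H" "y \<in> carrier K"
  shows "pure (x \<oplus>\<^bsub>H\<^esub> x') y = pure x y \<oplus>\<^bsub>T\<^esub> pure x' y"
proof -
  have c: "Poly_Mapping.single (x, y) 1 + Poly_Mapping.single (x', y) 1 \<in> carrier MA"
    using assms by (simp, intro order_trans[OF Poly_Mapping.keys_add]) simp
  show ?thesis
    using assms relation_coset_eq[OF _ _ c, of "Poly_Mapping.single (x \<oplus>\<^bsub>H\<^esub> x', y) 1"]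
      bilinear_relationsI(1)[of x H x' y K]
    by (simp add: tensor_algebra_def pure_tensor_def algebra_ideal.Q_add[OF algebra_ideal_N] diff_diff_add)
qed

lemma pure_add_r:
  assumes "x \<in> carrier H" "y \<in> carrier K" "y' \<in> carrier K"
  shows "pure x (y \<oplus>\<^bsub>K\<^esub> y') = pure x y \<oplus>\<^bsub>T\<^esub> pure x y'"
proof -
  have c: "Poly_Mapping.single (x, y) 1 + Poly_Mapping.single (x, y') 1 \<in> carrier MA"
    using assms by (simp, intro order_trans[OF Poly_Mapping.keys_add]) simp
  show ?thesis
    using assms relation_coset_eq[OF _ _ c, of "Poly_Mapping.single (x, y \<oplus>\<^bsub>K\<^esub> y') 1"]
      bilinear_relationsI(2)[of x H y K y']
    by (simp add: tensor_algebra_def pure_tensor_def algebra_ideal.Q_add[OF algebra_ideal_N] diff_diff_add)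
qed

lemma pure_smult_l:
  assumes "x \<in> carrier H" "y \<in> carrier K"
  shows "pure (c \<odot>\<^bsub>H\<^esub> x) y = c \<odot>\<^bsub>T\<^esub> pure x y"
  using assms bilinear_relationsI(3)[of x H y K c]
    relation_coset_eq[of "Poly_Mapping.single (c \<odot>\<^bsub>H\<^esub> x, y) 1" "Poly_Mapping.single (x, y) c"]
  by (simp add: tensor_algebra_def pure_tensor_def algebra_ideal.Q_smult[OF algebra_ideal_N])

lemma pure_smult_r:
  assumes "x \<in> carrier H" "y \<in> carrier K"
  shows "pure x (c \<odot>\<^bsub>K\<^esub> y) = c \<odot>\<^bsub>T\<^esub> pure x y"
  using assms bilinear_relationsI(4)[of x H y K c]
    relation_coset_eq[of "Poly_Mapping.single (x, c \<odot>\<^bsub>K\<^esub> y) 1" "Poly_Mapping.single (x, y) c"]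
  by (simp add: tensor_algebra_def pure_tensor_def algebra_ideal.Q_smult[OF algebra_ideal_N])

lemma tensor_induct [consumes 1, case_names pure smult add]:
  assumes t: "t \<in> carrier T"
    and pure: "\<And>x y. \<lbrakk>x \<in> carrier H; y \<in> carrier K\<rbrakk> \<Longrightarrow> P (pure x y)"
    and smult: "\<And>c t. \<lbrakk>t \<in> carrier T; P t\<rbrakk> \<Longrightarrow> P (c \<odot>\<^bsub>T\<^esub> t)"
    and add: "\<And>s t. \<lbrakk>s \<in> carrier T; t \<in> carrier T; P s; P t\<rbrakk> \<Longrightarrow> P (s \<oplus>\<^bsub>T\<^esub> t)"
  shows "P t"
proof -
  interpret T: complex_alg T by (rule complex_alg_T)
  note Qs = algebra_ideal.Q_add[OF algebra_ideal_N] algebra_ideal.Q_smult[OF algebra_ideal_N]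
  have cl: "N +>\<^bsub>MA\<^esub> p \<in> carrier T" if "p \<in> carrier MA" for p
    unfolding tensor_algebra_def using that by (rule algebra_ideal.Q_closed[OF algebra_ideal_N])
  obtain p where p: "p \<in> carrier MA" "t = N +>\<^bsub>MA\<^esub> p"
    using t unfolding tensor_algebra_def by (elim algebra_ideal.Q_cases[OF algebra_ideal_N])
  from p(1) have "Poly_Mapping.keys p \<subseteq> carrier H \<times> carrier K" by simp
  then have "P (N +>\<^bsub>MA\<^esub> p)"
  proof (induction p rule: poly_mapping_keys_induct)
    case zero
    \<comment> \<open>The rule has no case for zero; it is reached as the multiple by 0 of a pure
      tensor.\<close>
    have "0 \<odot>\<^bsub>T\<^esub> pure \<one>\<^bsub>H\<^esub> \<one>\<^bsub>K\<^esub> = N +>\<^bsub>MA\<^esub> 0"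
      using algebra_ideal.Q_zero[OF algebra_ideal_N] by (simp add: tensor_algebra_def[symmetric])
    then show ?case using smult[OF pure_closed pure, of "\<one>\<^bsub>H\<^esub>" "\<one>\<^bsub>K\<^esub>" 0] by simp
  next
    case (single w c)
    obtain u v where w: "w = (u, v)" "u \<in> carrier H" "v \<in> carrier K" using single by auto
    have "c \<odot>\<^bsub>T\<^esub> pure u v = N +>\<^bsub>MA\<^esub> Poly_Mapping.single w c"
      unfolding w(1) tensor_algebra_def pure_tensor_def
      using Qs(2)[OF single_carrier[OF w(2,3)], of c 1] by simp
    then show ?case using smult[OF pure_closed pure, OF w(2,3) w(2,3), of c] by simp
  next
    case (add p p')
    then have c: "p \<in> carrier MA" "p' \<in> carrier MA" by simp_all
    have "(N +>\<^bsub>MA\<^esub> p) \<oplus>\<^bsub>T\<^esub> (N +>\<^bsub>MA\<^esub> p') = N +>\<^bsub>MA\<^esub> (p + p')"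
      unfolding tensor_algebra_def using Qs(1)[OF c] by simp
    then show ?case using assms(4)[OF cl[OF c(1)] cl[OF c(2)] add(3,4)] by simp
  qed
  then show ?thesis by (simp add: p)
qed

end

section \<open>Linear maps on a tensor product induced by bilinear maps\<close>

locale alg_bilinear = alg_tensor H K + A: complex_alg A
  for H :: "(complex, 'h, 'x) module_scheme" and K :: "(complex, 'k, 'y) module_scheme"
    and A :: "(complex, 'a, 'z) module_scheme" +
  fixes \<beta> :: "'h \<Rightarrow> 'k \<Rightarrow> 'a"
  assumes bilinear_l: "y \<in> carrier K \<Longrightarrow> linear_map H A (\<lambda>x. \<beta> x y)"
    and bilinear_r: "x \<in> carrier H \<Longrightarrow> linear_map K A (\<beta> x)"
begin

abbreviation L where "L \<equiv> lin_ext A (\<lambda>u. \<beta> (fst u) (snd u))"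

lemma \<beta>_closed [simp]: "\<lbrakk>x \<in> carrier H; y \<in> carrier K\<rbrakk> \<Longrightarrow> \<beta> x y \<in> carrier A"
  using linear_mapD(1)[OF bilinear_l] .

lemma \<beta>_Pi: "(\<lambda>u. \<beta> (fst u) (snd u)) \<in> carrier H \<times> carrier K \<rightarrow> carrier A"
  by (rule Pi_I) (auto simp del: MA_simps)

lemma linear_map_L: "linear_map MA A L"
proof (rule linear_mapI)
  show "L x \<in> carrier A" if "x \<in> carrier MA" for x
    by (rule A.lin_ext_closed[OF _ \<beta>_Pi]) (use that in simp)
  show "L (x \<oplus>\<^bsub>MA\<^esub> y) = L x \<oplus>\<^bsub>A\<^esub> L y" if "x \<in> carrier MA" "y \<in> carrier MA" for x y
    unfolding MA_simps by (rule A.lin_ext_add[OF _ _ \<beta>_Pi]) (use that in simp_all)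
  show "L (c \<odot>\<^bsub>MA\<^esub> x) = c \<odot>\<^bsub>A\<^esub> L x" if "x \<in> carrier MA" for c x
    unfolding MA_simps by (rule A.lin_ext_scale[OF _ \<beta>_Pi]) (use that in simp)
qed

lemma L_diff:
  "\<lbrakk>x \<in> carrier MA; y \<in> carrier MA\<rbrakk> \<Longrightarrow> L (x - y) = L x \<ominus>\<^bsub>A\<^esub> L y"
  by (rule A.lin_ext_diff[OF _ _ \<beta>_Pi]) simp_all

lemma L_relation:
  assumes "r \<in> bilinear_relations H K" shows "L r = \<zero>\<^bsub>A\<^esub>"
  using assms
proof (cases rule: bilinear_relationsE)
  case (add_l x x' y)
  then show ?thesis
    by (simp add: L_diff diff_carrier single_carrier linear_mapD(2)[OF bilinear_l] A.minus_eq A.a_ac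
        A.r_neg A.r_neg1 A.r_neg2 del: MA_simps)
next
  case (add_r x y y')
  then show ?thesis
    by (simp add: L_diff diff_carrier single_carrier linear_mapD(2)[OF bilinear_r] A.minus_eq A.a_ac
        A.r_neg A.r_neg1 A.r_neg2 del: MA_simps)
next
  case (smult_l c x y)
  then show ?thesis
    by (simp add: L_diff single_carrier linear_mapD(3)[OF bilinear_l] A.minus_eq A.r_neg del: MA_simps)
next
  case (smult_r c x y)
  then show ?thesis
    by (simp add: L_diff single_carrier linear_mapD(3)[OF bilinear_r] A.minus_eq A.r_neg del: MA_simps)
qed

lemma L_null:
  assumes "x \<in> N" shows "L x = \<zero>\<^bsub>A\<^esub>"
proof -
  interpret MA: complex_alg MA by (rule complex_alg_MA)
  note lin = linear_mapD[OF linear_map_L]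
  from assms have "x \<in> lin_span MA (bilinear_relations H K)" by (simp add: tensor_null_def)
  from this relations_carrier show ?thesis
  proof (induction rule: MA.lin_span_induct)
    case zero
    show ?case by (rule linear_map_zero[OF complex_alg_MA A.complex_alg_axioms linear_map_L])
  next
    case (smult c s)
    then show ?case using lin(3)[OF subsetD[OF relations_carrier smult], of c] L_relation[OF smult] by simp
  next
    case (add x y)
    then show ?case using lin(2)[OF add(1,2)] by simp
  qed
qed

lemma tensor_map_coset:
  assumes "p \<in> carrier MA" shows "tensor_map A \<beta> (N +>\<^bsub>MA\<^esub> p) = L p"
  using algebra_ideal.the_elem_image_coset[OF algebra_ideal_N A.complex_alg_axioms linear_map_L L_null assms]
  by (simp add: tensor_map_def lin_ext_def[abs_def])

lemma tensor_map_pure [simp]: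
  assumes "x \<in> carrier H" "y \<in> carrier K" shows "tensor_map A \<beta> (pure x y) = \<beta> x y"
  using tensor_map_coset[OF single_carrier[OF assms], of 1] assms
  by (simp add: pure_tensor_def)

lemma linear_map_tensor_map: "linear_map T A (tensor_map A \<beta>)"
proof (rule linear_mapI)
  note lin = linear_mapD[OF linear_map_L]
  note hom = linear_mapD[OF algebra_hom_linear_map[OF algebra_ideal.coset_algebra_hom[OF algebra_ideal_N]],
      folded tensor_algebra_def]
  interpret MA: complex_alg MA by (rule complex_alg_MA)
  have cases: thesis if "t \<in> carrier T" "\<And>p. \<lbrakk>p \<in> carrier MA; t = N +>\<^bsub>MA\<^esub> p\<rbrakk> \<Longrightarrow> thesis" for t thesis
    using that unfolding tensor_algebra_def by (rule algebra_ideal.Q_cases[OF algebra_ideal_N])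
  show "tensor_map A \<beta> x \<in> carrier A" if "x \<in> carrier T" for x
    using that by (elim cases) (simp only: tensor_map_coset lin)
  show "tensor_map A \<beta> (x \<oplus>\<^bsub>T\<^esub> y) = tensor_map A \<beta> x \<oplus>\<^bsub>A\<^esub> tensor_map A \<beta> y"
    if "x \<in> carrier T" "y \<in> carrier T" for x y
    using that
    by (elim cases) (simp only: tensor_map_coset lin tensor_algebra_def MA.a_closed
        algebra_ideal.Q_add[OF algebra_ideal_N])
  show "tensor_map A \<beta> (c \<odot>\<^bsub>T\<^esub> x) = c \<odot>\<^bsub>A\<^esub> tensor_map A \<beta> x" if "x \<in> carrier T" for c x
    using that
    by (elim cases) (simp only: tensor_map_coset lin tensor_algebra_def MA.smult_closed
        algebra_ideal.Q_smult[OF algebra_ideal_N])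
qed

end

section \<open>Endomorphisms and skew derivations\<close>

lemma linear_map_compose:
  assumes "linear_map A B f" "linear_map B C g" shows "linear_map A C (g \<circ> f)"
  by (rule linear_mapI) (simp_all add: linear_mapD[OF assms(1)] linear_mapD[OF assms(2)])

lemma algebra_hom_presented_eqI:
  assumes f: "f \<in> algebra_hom (presented_algebra R) A" and g: "g \<in> algebra_hom (presented_algebra R) A"
    and gen: "\<And>a. f (generator R a) = g (generator R a)"
    and x: "x \<in> carrier (presented_algebra R)"
  shows "f x = g x"
  using x
proof (induction rule: presented_induct)
  case (gen a x)
  then show ?case using assms(3) by (simp add: algebra_homD[OF f] algebra_homD[OF g])
qed (simp_all add: algebra_homD[OF f] algebra_homD[OF g] linear_mapD[OF algebra_hom_linear_map[OF f]]
    linear_mapD[OF algebra_hom_linear_map[OF g]])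

lemma id_algebra_hom: "(\<lambda>x. x) \<in> algebra_hom A A"
  by (intro algebra_homI linear_mapI) simp_all

context complex_alg
begin

abbreviation EA where "EA \<equiv> End_algebra A"

lemma EA_carrier: "f \<in> carrier EA \<longleftrightarrow> f \<in> extensional (carrier A) \<and> linear_map A A f"
  unfolding End_algebra_def linear_map_def PiE_def by auto

lemma EA_closed: "\<lbrakk>f \<in> carrier EA; x \<in> carrier A\<rbrakk> \<Longrightarrow> f x \<in> carrier A"
  unfolding EA_carrier by (rule linear_mapD(1)[of A A f]) simp_all

lemma EA_apply:
  assumes "x \<in> carrier A"
  shows "(f \<otimes>\<^bsub>EA\<^esub> g) x = f (g x)" "(f \<oplus>\<^bsub>EA\<^esub> g) x = f x \<oplus> g x"
    "(c \<odot>\<^bsub>EA\<^esub> f) x = c \<odot> f x" "\<one>\<^bsub>EA\<^esub> x = x" "\<zero>\<^bsub>EA\<^esub> x = \<zero>"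
  using assms by (simp_all add: End_algebra_def compose_def)

lemma EA_eqI:
  assumes "f \<in> carrier EA" "g \<in> carrier EA" "\<And>x. x \<in> carrier A \<Longrightarrow> f x = g x"
  shows "f = g"
  using assms by (auto simp: EA_carrier intro: extensionalityI)

lemma EA_linear:
  assumes "f \<in> carrier EA"
  shows "linear_map A A f"
  using assms by (simp add: EA_carrier)

lemma EA_restrict: "linear_map A A f \<Longrightarrow> restrict f (carrier A) \<in> carrier EA"
  by (simp add: EA_carrier linear_map_def Pi_iff)

lemma linear_zero: "linear_map A A (\<lambda>x. \<zero>)"
  by (rule linear_mapI) simp_all

lemma linear_add:
  assumes "linear_map A A f" "linear_map A A g" shows "linear_map A A (\<lambda>x. f x \<oplus> g x)"
  by (rule linear_mapI)
    (simp_all add: linear_mapD[OF assms(1)] linear_mapD[OF assms(2)] smult_r_distr add.m_ac)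

lemma linear_smult:
  assumes "linear_map A A f" shows "linear_map A A (\<lambda>x. c \<odot> f x)"
  by (rule linear_mapI)
    (simp_all add: linear_mapD[OF assms(1)] smult_r_distr smult_smult mult.commute)

lemma EA_ops_closed:
  assumes "f \<in> carrier EA" "g \<in> carrier EA"
  shows "f \<otimes>\<^bsub>EA\<^esub> g \<in> carrier EA" "f \<oplus>\<^bsub>EA\<^esub> g \<in> carrier EA" "c \<odot>\<^bsub>EA\<^esub> f \<in> carrier EA"
    "\<one>\<^bsub>EA\<^esub> \<in> carrier EA" "\<zero>\<^bsub>EA\<^esub> \<in> carrier EA"
proof -
  show "f \<otimes>\<^bsub>EA\<^esub> g \<in> carrier EA"
    using EA_restrict[OF linear_map_compose[OF EA_linear[OF assms(2)] EA_linear[OF assms(1)]]]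
    by (simp add: End_algebra_def compose_def comp_def)
  show "f \<oplus>\<^bsub>EA\<^esub> g \<in> carrier EA"
    using EA_restrict[OF linear_add[OF EA_linear[OF assms(1)] EA_linear[OF assms(2)]]]
    by (simp add: End_algebra_def)
  show "c \<odot>\<^bsub>EA\<^esub> f \<in> carrier EA"
    using EA_restrict[OF linear_smult[OF EA_linear[OF assms(1)]]]
    by (simp add: End_algebra_def)
  show "\<one>\<^bsub>EA\<^esub> \<in> carrier EA"
    using EA_restrict[OF algebra_hom_linear_map[OF id_algebra_hom]] by (simp add: End_algebra_def)
  show "\<zero>\<^bsub>EA\<^esub> \<in> carrier EA"
    using EA_restrict[OF linear_zero] by (simp add: End_algebra_def)
qed

lemma complex_alg_EA: "complex_alg EA"
proof -
  note ops [simp] = EA_ops_closed and [simp] = EA_apply EA_closed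
  \<comment> \<open>\<open>EA_ops_closed\<close> asks for two endomorphisms even in its statements
    about the constants; the zero map provides them.\<close>
  have zc: "\<zero>\<^bsub>EA\<^esub> \<in> carrier EA" by (rule EA_ops_closed(5)[OF EA_restrict EA_restrict]) (rule linear_zero)+
  have oc: "\<one>\<^bsub>EA\<^esub> \<in> carrier EA" by (rule EA_ops_closed(4)[OF zc zc])
  note [simp] = zc oc
  show ?thesis
  proof (intro complex_alg.intro complex_alg_axioms.intro ringI)
    show "abelian_group EA"
    proof (rule abelian_groupI)
      fix f assume f: "f \<in> carrier EA"
      have "(-1) \<odot>\<^bsub>EA\<^esub> f \<oplus>\<^bsub>EA\<^esub> f = \<zero>\<^bsub>EA\<^esub>"
      proof (rule EA_eqI)
        fix x assume x: "x \<in> carrier A"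
        then show "((-1) \<odot>\<^bsub>EA\<^esub> f \<oplus>\<^bsub>EA\<^esub> f) x = \<zero>\<^bsub>EA\<^esub> x"
          using f by (simp add: smult_minus l_neg)
      qed (use f in simp_all)
      then show "\<exists>g\<in>carrier EA. g \<oplus>\<^bsub>EA\<^esub> f = \<zero>\<^bsub>EA\<^esub>"
        using f by (intro bexI[of _ "(-1) \<odot>\<^bsub>EA\<^esub> f"]) simp_all
    next
      fix f g h assume "f \<in> carrier EA" "g \<in> carrier EA" "h \<in> carrier EA"
      then show "f \<oplus>\<^bsub>EA\<^esub> g \<oplus>\<^bsub>EA\<^esub> h = f \<oplus>\<^bsub>EA\<^esub> (g \<oplus>\<^bsub>EA\<^esub> h)"
        by (intro EA_eqI) (simp_all add: a_assoc)
    next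
      fix f g assume "f \<in> carrier EA" "g \<in> carrier EA"
      then show "f \<oplus>\<^bsub>EA\<^esub> g = g \<oplus>\<^bsub>EA\<^esub> f"
        by (intro EA_eqI) (simp_all add: a_comm)
    next
      fix f assume "f \<in> carrier EA"
      then show "\<zero>\<^bsub>EA\<^esub> \<oplus>\<^bsub>EA\<^esub> f = f"
        by (intro EA_eqI) simp_all
    qed simp_all
    show "monoid EA"
      by (rule monoidI; (intro EA_eqI)?; simp)
  next
    fix f g h assume *: "f \<in> carrier EA" "g \<in> carrier EA" "h \<in> carrier EA"
    show "(f \<oplus>\<^bsub>EA\<^esub> g) \<otimes>\<^bsub>EA\<^esub> h = f \<otimes>\<^bsub>EA\<^esub> h \<oplus>\<^bsub>EA\<^esub> g \<otimes>\<^bsub>EA\<^esub> h"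
      using * by (intro EA_eqI) simp_all
    show "h \<otimes>\<^bsub>EA\<^esub> (f \<oplus>\<^bsub>EA\<^esub> g) = h \<otimes>\<^bsub>EA\<^esub> f \<oplus>\<^bsub>EA\<^esub> h \<otimes>\<^bsub>EA\<^esub> g"
      using * by (intro EA_eqI) (simp_all add: linear_mapD[OF EA_linear])
  next
    fix f g c d assume *: "f \<in> carrier EA" "g \<in> carrier EA"
    show "c \<odot>\<^bsub>EA\<^esub> (f \<oplus>\<^bsub>EA\<^esub> g) = c \<odot>\<^bsub>EA\<^esub> f \<oplus>\<^bsub>EA\<^esub> c \<odot>\<^bsub>EA\<^esub> g"
      using * by (intro EA_eqI) (simp_all add: smult_r_distr)
    show "(c \<odot>\<^bsub>EA\<^esub> f) \<otimes>\<^bsub>EA\<^esub> g = c \<odot>\<^bsub>EA\<^esub> (f \<otimes>\<^bsub>EA\<^esub> g)"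
      using * by (intro EA_eqI) simp_all
    show "f \<otimes>\<^bsub>EA\<^esub> (c \<odot>\<^bsub>EA\<^esub> g) = c \<odot>\<^bsub>EA\<^esub> (f \<otimes>\<^bsub>EA\<^esub> g)"
      using * by (intro EA_eqI) (simp_all add: linear_mapD[OF EA_linear])
  next
    fix f c d assume *: "f \<in> carrier EA"
    show "c \<odot>\<^bsub>EA\<^esub> f \<in> carrier EA" using * by simp
    show "(c + d) \<odot>\<^bsub>EA\<^esub> f = c \<odot>\<^bsub>EA\<^esub> f \<oplus>\<^bsub>EA\<^esub> d \<odot>\<^bsub>EA\<^esub> f"
      using * by (intro EA_eqI) (simp_all add: smult_l_distr)
    show "c \<odot>\<^bsub>EA\<^esub> (d \<odot>\<^bsub>EA\<^esub> f) = (c * d) \<odot>\<^bsub>EA\<^esub> f"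
      using * by (intro EA_eqI) (simp_all add: smult_smult)
    show "1 \<odot>\<^bsub>EA\<^esub> f = f"
      using * by (intro EA_eqI) simp_all
  qed
qed

end

text \<open>The upper triangular 2 by 2 matrices over \<open>A\<close>: the triple (a, b, d) has
  diagonal a, d and upper right corner b.\<close>

definition triangular_algebra ::
    "(complex, 'a, 'x) module_scheme \<Rightarrow> (complex, 'a \<times> 'a \<times> 'a) module" where
  "triangular_algebra A =
    \<lparr>carrier = carrier A \<times> carrier A \<times> carrier A,
     mult = (\<lambda>(a, b, d) (a', b', d').
       (a \<otimes>\<^bsub>A\<^esub> a', a \<otimes>\<^bsub>A\<^esub> b' \<oplus>\<^bsub>A\<^esub> b \<otimes>\<^bsub>A\<^esub> d', d \<otimes>\<^bsub>A\<^esub> d')),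
     one = (\<one>\<^bsub>A\<^esub>, \<zero>\<^bsub>A\<^esub>, \<one>\<^bsub>A\<^esub>), zero = (\<zero>\<^bsub>A\<^esub>, \<zero>\<^bsub>A\<^esub>, \<zero>\<^bsub>A\<^esub>),
     add = (\<lambda>(a, b, d) (a', b', d'). (a \<oplus>\<^bsub>A\<^esub> a', b \<oplus>\<^bsub>A\<^esub> b', d \<oplus>\<^bsub>A\<^esub> d')),
     smult = (\<lambda>c (a, b, d). (c \<odot>\<^bsub>A\<^esub> a, c \<odot>\<^bsub>A\<^esub> b, c \<odot>\<^bsub>A\<^esub> d))\<rparr>"

lemma triangular_algebra_simps [simp]:
  "t \<in> carrier (triangular_algebra A) \<longleftrightarrow>
    fst t \<in> carrier A \<and> fst (snd t) \<in> carrier A \<and> snd (snd t) \<in> carrier A"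
  "s \<otimes>\<^bsub>triangular_algebra A\<^esub> t =
    (fst s \<otimes>\<^bsub>A\<^esub> fst t, fst s \<otimes>\<^bsub>A\<^esub> fst (snd t) \<oplus>\<^bsub>A\<^esub> fst (snd s) \<otimes>\<^bsub>A\<^esub> snd (snd t),
      snd (snd s) \<otimes>\<^bsub>A\<^esub> snd (snd t))"
  "s \<oplus>\<^bsub>triangular_algebra A\<^esub> t =
    (fst s \<oplus>\<^bsub>A\<^esub> fst t, fst (snd s) \<oplus>\<^bsub>A\<^esub> fst (snd t), snd (snd s) \<oplus>\<^bsub>A\<^esub> snd (snd t))"
  "c \<odot>\<^bsub>triangular_algebra A\<^esub> t = (c \<odot>\<^bsub>A\<^esub> fst t, c \<odot>\<^bsub>A\<^esub> fst (snd t), c \<odot>\<^bsub>A\<^esub> snd (snd t))"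
  "\<one>\<^bsub>triangular_algebra A\<^esub> = (\<one>\<^bsub>A\<^esub>, \<zero>\<^bsub>A\<^esub>, \<one>\<^bsub>A\<^esub>)"
  "\<zero>\<^bsub>triangular_algebra A\<^esub> = (\<zero>\<^bsub>A\<^esub>, \<zero>\<^bsub>A\<^esub>, \<zero>\<^bsub>A\<^esub>)"
  by (cases s; cases t; simp add: triangular_algebra_def mem_Times_iff)+

lemma complex_alg_triangular:
  assumes "complex_alg A" shows "complex_alg (triangular_algebra A)"
proof -
  interpret complex_alg A by fact
  let ?T = "triangular_algebra A"
  show ?thesis
  proof (intro complex_alg.intro complex_alg_axioms.intro ringI)
    show "abelian_group ?T"
    proof (rule abelian_groupI)
      fix t assume "t \<in> carrier ?T"
      then show "\<exists>s\<in>carrier ?T. s \<oplus>\<^bsub>?T\<^esub> t = \<zero>\<^bsub>?T\<^esub>"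
        by (intro bexI[of _ "(\<ominus>\<^bsub>A\<^esub> fst t, \<ominus>\<^bsub>A\<^esub> fst (snd t), \<ominus>\<^bsub>A\<^esub> snd (snd t))"]) (simp_all add: l_neg)
    qed (simp_all add: add.m_ac)
    show "monoid ?T"
      by (rule monoidI) (simp_all add: m_assoc l_distr r_distr add.m_ac)
  qed (simp_all add: l_distr r_distr add.m_ac smult_l_distr smult_r_distr smult_smult smult_m_l smult_m_r)
qed

text \<open>
  A linear map \<open>D\<close> satisfies \<open>D (x y) = P x D y + D x S y\<close> iff sending \<open>x\<close> to the upper
  triangular matrix with diagonal \<open>P x\<close>, \<open>S x\<close> and corner \<open>D x\<close> is multiplicative, so that
  such a \<open>D\<close> on a presented algebra is determined by values compatible with the relations.
\<close>

lemma skew_derivation_exists: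
  fixes A :: "(complex, 'a, 'x) module_scheme" and R :: "('g list \<Rightarrow>\<^sub>0 complex) set"
  defines "B \<equiv> presented_algebra R"
  assumes A: "complex_alg A"
    and P: "P \<in> algebra_hom B A" and S: "S \<in> algebra_hom B A"
    and \<delta>: "\<And>g. \<delta> g \<in> carrier A"
    and rel: "\<And>r. r \<in> R \<Longrightarrow> eval_free (triangular_algebra A)
      (\<lambda>g. (P (generator R g), \<delta> g, S (generator R g))) r = \<zero>\<^bsub>triangular_algebra A\<^esub>"
  obtains D where "linear_map B A D"
    "\<And>x y. \<lbrakk>x \<in> carrier B; y \<in> carrier B\<rbrakk> \<Longrightarrow>
      D (x \<otimes>\<^bsub>B\<^esub> y) = P x \<otimes>\<^bsub>A\<^esub> D y \<oplus>\<^bsub>A\<^esub> D x \<otimes>\<^bsub>A\<^esub> S y"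
    "\<And>g. D (generator R g) = \<delta> g" "D \<one>\<^bsub>B\<^esub> = \<zero>\<^bsub>A\<^esub>"
proof -
  interpret A: complex_alg A by (rule A)
  let ?T = "triangular_algebra A"
  let ?h = "extend_hom ?T (\<lambda>g. (P (generator R g), \<delta> g, S (generator R g)))"
  note Pl = linear_mapD[OF algebra_hom_linear_map[OF P]] and Sl = linear_mapD[OF algebra_hom_linear_map[OF S]]
  have gen: "generator R g \<in> carrier B" for g unfolding B_def by simp
  interpret h: presented_hom ?T R "\<lambda>g. (P (generator R g), \<delta> g, S (generator R g))"
    by (intro presented_hom.intro presented_hom_axioms.intro complex_alg_triangular A rel)
      (simp_all add: gen \<delta> Pl Sl)
  have h: "?h \<in> algebra_hom B ?T" unfolding B_def by (rule h.extend_hom_algebra_hom)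
  note hl = linear_mapD[OF algebra_hom_linear_map[OF h], simplified] and hm = algebra_homD[OF h, simplified]
  \<comment> \<open>Each diagonal entry is a homomorphism that agrees with \<open>P\<close> or
    \<open>S\<close> on the generators, hence everywhere. The corner of a product of matrices is
    then the skew Leibniz rule.\<close>
  have "(\<lambda>x. fst (?h x)) \<in> algebra_hom B A"
    by (intro algebra_homI linear_mapI) (simp_all add: hl hm)
  then have fstP: "fst (?h x) = P x" if "x \<in> carrier B" for x
    using algebra_hom_presented_eqI[where A = A and f = "\<lambda>x. fst (?h x)" and g = P and R = R] P that
    unfolding B_def by simp
  have "(\<lambda>x. snd (snd (?h x))) \<in> algebra_hom B A"
    by (intro algebra_homI linear_mapI) (simp_all add: hl hm)
  then have sndS: "snd (snd (?h x)) = S x" if "x \<in> carrier B" for x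
    using algebra_hom_presented_eqI[where A = A and f = "\<lambda>x. snd (snd (?h x))" and g = S and R = R] S that
    unfolding B_def by simp
  show ?thesis
  proof
    show "linear_map B A (\<lambda>x. fst (snd (?h x)))"
      by (rule linear_mapI) (simp_all add: hl)
    show "fst (snd (?h (x \<otimes>\<^bsub>B\<^esub> y))) = P x \<otimes>\<^bsub>A\<^esub> fst (snd (?h y)) \<oplus>\<^bsub>A\<^esub> fst (snd (?h x)) \<otimes>\<^bsub>A\<^esub> S y"
      if "x \<in> carrier B" "y \<in> carrier B" for x y
      using that by (simp add: hm fstP sndS)
    show "fst (snd (?h (generator R g))) = \<delta> g" for g by simp
    show "fst (snd (?h \<one>\<^bsub>B\<^esub>)) = \<zero>\<^bsub>A\<^esub>" by (simp add: hm)
  qed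
qed

section \<open>Actions of the quantum group\<close>

lemma (in complex_alg) minus_eq_zero_iff:
  assumes "x \<in> carrier A" "y \<in> carrier A"
  shows "x \<ominus> y = \<zero> \<longleftrightarrow> x = y"
proof
  assume *: "x \<ominus> y = \<zero>"
  have "x = (x \<ominus> y) \<oplus> y" using assms by (simp add: minus_eq a_assoc l_neg)
  then show "x = y" using assms * by simp
qed (use assms in \<open>simp add: minus_eq r_neg\<close>)

text \<open>One translation of the five relations serves four targets: the quantum group itself, its
  tensor square for the comultiplication, the complex numbers for the counit, and the endomorphisms
  of the disc.\<close>

lemma (in complex_alg) uq_relations_iff:
  assumes [simp]: "\<And>g. \<phi> g \<in> carrier A"
  shows "(\<forall>r\<in>uq_relations q. eval_free A \<phi> r = \<zero>) \<longleftrightarrow>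
    \<phi> Gen_kinv \<otimes> \<phi> Gen_k = \<one> \<and> \<phi> Gen_k \<otimes> \<phi> Gen_kinv = \<one> \<and>
    \<phi> Gen_k \<otimes> \<phi> Gen_e = q^2 \<odot> (\<phi> Gen_e \<otimes> \<phi> Gen_k) \<and>
    \<phi> Gen_k \<otimes> \<phi> Gen_f = q powi (-2) \<odot> (\<phi> Gen_f \<otimes> \<phi> Gen_k) \<and>
    \<phi> Gen_e \<otimes> \<phi> Gen_f \<ominus> \<phi> Gen_f \<otimes> \<phi> Gen_e =
      (1 / (q - inverse q)) \<odot> \<phi> Gen_k \<ominus> (1 / (q - inverse q)) \<odot> \<phi> Gen_kinv"
  unfolding uq_relations_def
  by (simp add: eval_free_diff minus_eq_zero_iff del: power_int_minus)

lemma (in complex_alg) disc_relations_iff: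
  assumes [simp]: "\<And>g. \<phi> g \<in> carrier A"
  shows "(\<forall>r\<in>disc_relations q. eval_free A \<phi> r = \<zero>) \<longleftrightarrow>
    \<phi> Gen_z \<otimes> \<phi> Gen_zs = q^2 \<odot> (\<phi> Gen_zs \<otimes> \<phi> Gen_z) \<oplus> (1 - q^2) \<odot> \<one>"
  unfolding disc_relations_def
  by (simp add: eval_free_diff eval_free_add minus_eq_zero_iff)

lemma presented_homI:
  assumes "complex_alg A" "\<And>g. \<phi> g \<in> carrier A" "\<forall>r\<in>R. eval_free A \<phi> r = \<zero>\<^bsub>A\<^esub>"
  shows "presented_hom A R \<phi>"
  using assms by (simp add: presented_hom_def presented_hom_axioms_def)

lemma complex_alg_Uq: "complex_alg (Uq_algebra q)"
  unfolding Uq_algebra_def by (rule complex_alg_presented)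

lemma complex_alg_complex_algebra: "complex_alg complex_algebra"
proof (intro complex_alg.intro complex_alg_axioms.intro ringI)
  show "abelian_group complex_algebra"
  proof (rule abelian_groupI)
    show "\<exists>y\<in>carrier complex_algebra. y \<oplus>\<^bsub>complex_algebra\<^esub> x = \<zero>\<^bsub>complex_algebra\<^esub>" for x
      by (intro bexI[of _ "- x"]) (simp_all add: complex_algebra_def)
  qed (simp_all add: complex_algebra_def)
  show "monoid complex_algebra" by (rule monoidI) (simp_all add: complex_algebra_def)
qed (simp_all add: complex_algebra_def algebra_simps)

section \<open>The quantum group with its comultiplication and counit\<close>

locale uq =
  fixes q :: complex
begin

abbreviation U where "U \<equiv> Uq_algebra q"
abbreviation gen where "gen \<equiv> generator (uq_relations q)"
abbreviation T where "T \<equiv> tensor_algebra U U"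
abbreviation pure where "pure \<equiv> pure_tensor U U"
abbreviation k where "k \<equiv> gen Gen_k"
abbreviation kinv where "kinv \<equiv> gen Gen_kinv"
abbreviation e where "e \<equiv> gen Gen_e"
abbreviation f where "f \<equiv> gen Gen_f"

lemmas Uq_induct [consumes 1, case_names one gen smult add] =
  presented_induct[where R = "uq_relations q", folded Uq_algebra_def]

lemma gen_closed [simp]: "gen g \<in> carrier U"
  unfolding Uq_algebra_def by (rule generator_closed)

lemma Uq_relations:
  "kinv \<otimes>\<^bsub>U\<^esub> k = \<one>\<^bsub>U\<^esub>" "k \<otimes>\<^bsub>U\<^esub> kinv = \<one>\<^bsub>U\<^esub>"
  "k \<otimes>\<^bsub>U\<^esub> e = q^2 \<odot>\<^bsub>U\<^esub> (e \<otimes>\<^bsub>U\<^esub> k)"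
  "k \<otimes>\<^bsub>U\<^esub> f = q powi (-2) \<odot>\<^bsub>U\<^esub> (f \<otimes>\<^bsub>U\<^esub> k)"
  "e \<otimes>\<^bsub>U\<^esub> f \<ominus>\<^bsub>U\<^esub> f \<otimes>\<^bsub>U\<^esub> e =
      (1 / (q - inverse q)) \<odot>\<^bsub>U\<^esub> k \<ominus>\<^bsub>U\<^esub> (1 / (q - inverse q)) \<odot>\<^bsub>U\<^esub> kinv"
proof -
  interpret U: complex_alg U by (rule complex_alg_Uq)
  have "\<forall>r\<in>uq_relations q. eval_free U gen r = \<zero>\<^bsub>U\<^esub>"
    unfolding Uq_algebra_def by (simp add: eval_free_generator_relation)
  then show "kinv \<otimes>\<^bsub>U\<^esub> k = \<one>\<^bsub>U\<^esub>" "k \<otimes>\<^bsub>U\<^esub> kinv = \<one>\<^bsub>U\<^esub>"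
    "k \<otimes>\<^bsub>U\<^esub> e = q^2 \<odot>\<^bsub>U\<^esub> (e \<otimes>\<^bsub>U\<^esub> k)"
    "k \<otimes>\<^bsub>U\<^esub> f = q powi (-2) \<odot>\<^bsub>U\<^esub> (f \<otimes>\<^bsub>U\<^esub> k)"
    "e \<otimes>\<^bsub>U\<^esub> f \<ominus>\<^bsub>U\<^esub> f \<otimes>\<^bsub>U\<^esub> e =
        (1 / (q - inverse q)) \<odot>\<^bsub>U\<^esub> k \<ominus>\<^bsub>U\<^esub> (1 / (q - inverse q)) \<odot>\<^bsub>U\<^esub> kinv"
    by (simp_all only: U.uq_relations_iff[OF gen_closed])
qed

lemma alg_tensor_UU: "alg_tensor U U"
  by (intro alg_tensor.intro complex_alg_Uq)

lemma comult_gen: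
  "uq_comult_gen q Gen_k = pure k k" "uq_comult_gen q Gen_kinv = pure kinv kinv"
  "uq_comult_gen q Gen_e = pure \<one>\<^bsub>U\<^esub> e \<oplus>\<^bsub>T\<^esub> pure e k"
  "uq_comult_gen q Gen_f = pure f \<one>\<^bsub>U\<^esub> \<oplus>\<^bsub>T\<^esub> pure kinv f"
  by (simp_all add: uq_comult_gen_def uq_k_def uq_kinv_def uq_e_def uq_f_def Let_def)

lemma comult_gen_closed: "uq_comult_gen q g \<in> carrier T"
proof -
  interpret UU: alg_tensor U U by (rule alg_tensor_UU)
  interpret T: complex_alg T by (rule UU.complex_alg_T)
  show ?thesis
    by (cases g) (simp_all only: comult_gen T.a_closed UU.pure_closed gen_closed UU.H.one_closed)
qed

lemma kinv_e:
  assumes "q \<noteq> 0"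
  shows "e \<otimes>\<^bsub>U\<^esub> kinv = q^2 \<odot>\<^bsub>U\<^esub> (kinv \<otimes>\<^bsub>U\<^esub> e)"
proof -
  interpret U: complex_alg U by (rule complex_alg_Uq)
  have "e \<otimes>\<^bsub>U\<^esub> kinv = kinv \<otimes>\<^bsub>U\<^esub> (k \<otimes>\<^bsub>U\<^esub> e) \<otimes>\<^bsub>U\<^esub> kinv"
    by (simp add: U.m_assoc[symmetric] Uq_relations(1))
  also have "\<dots> = q^2 \<odot>\<^bsub>U\<^esub> (kinv \<otimes>\<^bsub>U\<^esub> e)"
    by (simp add: Uq_relations U.smult_m_l U.smult_m_r U.m_assoc)
  finally show ?thesis .
qed

text \<open>The relations of k with e and f hold summand by summand. For e and f, the mixed term
  with legs e kinv and k f equals the one with legs kinv e and f k, because the factors q^2 and q^-2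
  cancel. The commutator in the second leg yields a multiple of \<open>pure kinv k\<close>, the
  commutator in the first leg its negative, and only the terms in \<open>pure k k\<close> and
  \<open>pure kinv kinv\<close> survive.\<close>

lemma comult_relations:
  assumes q: "q \<noteq> 0"
  shows "\<forall>r\<in>uq_relations q. eval_free T (uq_comult_gen q) r = \<zero>\<^bsub>T\<^esub>"
proof -
  interpret U: complex_alg U by (rule complex_alg_Uq)
  interpret UU: alg_tensor U U by (rule alg_tensor_UU)
  interpret T: complex_alg T by (rule UU.complex_alg_T)
  let ?c = "1 / (q - inverse q)"
  note R = Uq_relations
  have kk: "pure kinv kinv \<otimes>\<^bsub>T\<^esub> pure k k = \<one>\<^bsub>T\<^esub>" "pure k k \<otimes>\<^bsub>T\<^esub> pure kinv kinv = \<one>\<^bsub>T\<^esub>"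
    by (simp_all add: R UU.pure_one)
  have ke: "pure k k \<otimes>\<^bsub>T\<^esub> (pure \<one>\<^bsub>U\<^esub> e \<oplus>\<^bsub>T\<^esub> pure e k) =
    q^2 \<odot>\<^bsub>T\<^esub> ((pure \<one>\<^bsub>U\<^esub> e \<oplus>\<^bsub>T\<^esub> pure e k) \<otimes>\<^bsub>T\<^esub> pure k k)"
    by (simp add: T.r_distr T.l_distr R UU.pure_smult_l UU.pure_smult_r T.smult_r_distr)
  have kf: "pure k k \<otimes>\<^bsub>T\<^esub> (pure f \<one>\<^bsub>U\<^esub> \<oplus>\<^bsub>T\<^esub> pure kinv f) =
    q powi (-2) \<odot>\<^bsub>T\<^esub> ((pure f \<one>\<^bsub>U\<^esub> \<oplus>\<^bsub>T\<^esub> pure kinv f) \<otimes>\<^bsub>T\<^esub> pure k k)"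
    by (simp add: T.r_distr T.l_distr R UU.pure_smult_l UU.pure_smult_r T.smult_r_distr
        del: power_int_minus)
  have cross: "pure (e \<otimes>\<^bsub>U\<^esub> kinv) (k \<otimes>\<^bsub>U\<^esub> f) = pure (kinv \<otimes>\<^bsub>U\<^esub> e) (f \<otimes>\<^bsub>U\<^esub> k)"
    using q by (simp add: R kinv_e UU.pure_smult_l UU.pure_smult_r T.smult_smult power_int_minus field_simps)
  have ef1: "e \<otimes>\<^bsub>U\<^esub> f = f \<otimes>\<^bsub>U\<^esub> e \<oplus>\<^bsub>U\<^esub> (?c \<odot>\<^bsub>U\<^esub> k \<oplus>\<^bsub>U\<^esub> (- ?c) \<odot>\<^bsub>U\<^esub> kinv)"
  proof -
    have "e \<otimes>\<^bsub>U\<^esub> f = f \<otimes>\<^bsub>U\<^esub> e \<oplus>\<^bsub>U\<^esub> (e \<otimes>\<^bsub>U\<^esub> f \<ominus>\<^bsub>U\<^esub> f \<otimes>\<^bsub>U\<^esub> e)"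
      by (simp add: U.minus_eq U.a_lcomm U.r_neg)
    then show ?thesis unfolding R(5) by (simp only: U.minus_eq U.smult_minus gen_closed)
  qed
  have ef: "(pure \<one>\<^bsub>U\<^esub> e \<oplus>\<^bsub>T\<^esub> pure e k) \<otimes>\<^bsub>T\<^esub> (pure f \<one>\<^bsub>U\<^esub> \<oplus>\<^bsub>T\<^esub> pure kinv f) =
    (pure f \<one>\<^bsub>U\<^esub> \<oplus>\<^bsub>T\<^esub> pure kinv f) \<otimes>\<^bsub>T\<^esub> (pure \<one>\<^bsub>U\<^esub> e \<oplus>\<^bsub>T\<^esub> pure e k)
      \<oplus>\<^bsub>T\<^esub> (?c \<odot>\<^bsub>T\<^esub> pure k k \<oplus>\<^bsub>T\<^esub> (- ?c) \<odot>\<^bsub>T\<^esub> pure kinv kinv)"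
  proof -
    let ?X = "pure f e" and ?Y = "pure kinv (f \<otimes>\<^bsub>U\<^esub> e)" and ?Z = "pure (f \<otimes>\<^bsub>U\<^esub> e) k"
      and ?W = "pure (kinv \<otimes>\<^bsub>U\<^esub> e) (f \<otimes>\<^bsub>U\<^esub> k)"
      and ?C = "pure kinv k"
    have "(pure \<one>\<^bsub>U\<^esub> e \<oplus>\<^bsub>T\<^esub> pure e k) \<otimes>\<^bsub>T\<^esub> (pure f \<one>\<^bsub>U\<^esub> \<oplus>\<^bsub>T\<^esub> pure kinv f)
      = ?X \<oplus>\<^bsub>T\<^esub> (pure kinv (e \<otimes>\<^bsub>U\<^esub> f) \<oplus>\<^bsub>T\<^esub> (pure (e \<otimes>\<^bsub>U\<^esub> f) k \<oplus>\<^bsub>T\<^esub> ?W))"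
      by (simp add: T.r_distr T.l_distr cross T.a_ac)
    also have "pure kinv (e \<otimes>\<^bsub>U\<^esub> f) =
        ?Y \<oplus>\<^bsub>T\<^esub> (?c \<odot>\<^bsub>T\<^esub> ?C \<oplus>\<^bsub>T\<^esub> (- ?c) \<odot>\<^bsub>T\<^esub> pure kinv kinv)"
      unfolding ef1 by (simp add: UU.pure_add_r UU.pure_smult_r)
    also have "pure (e \<otimes>\<^bsub>U\<^esub> f) k =
        ?Z \<oplus>\<^bsub>T\<^esub> (?c \<odot>\<^bsub>T\<^esub> pure k k \<oplus>\<^bsub>T\<^esub> (- ?c) \<odot>\<^bsub>T\<^esub> ?C)"
      unfolding ef1 by (simp add: UU.pure_add_l UU.pure_smult_l)
    also have "?X \<oplus>\<^bsub>T\<^esub> (?Y \<oplus>\<^bsub>T\<^esub> (?c \<odot>\<^bsub>T\<^esub> ?C \<oplus>\<^bsub>T\<^esub> (- ?c) \<odot>\<^bsub>T\<^esub> pure kinv kinv) \<oplus>\<^bsub>T\<^esub>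
        (?Z \<oplus>\<^bsub>T\<^esub> (?c \<odot>\<^bsub>T\<^esub> pure k k \<oplus>\<^bsub>T\<^esub> (- ?c) \<odot>\<^bsub>T\<^esub> ?C) \<oplus>\<^bsub>T\<^esub> ?W)) =
      (?c \<odot>\<^bsub>T\<^esub> ?C \<oplus>\<^bsub>T\<^esub> (- ?c) \<odot>\<^bsub>T\<^esub> ?C) \<oplus>\<^bsub>T\<^esub> (?X \<oplus>\<^bsub>T\<^esub> ?Y \<oplus>\<^bsub>T\<^esub> ?Z \<oplus>\<^bsub>T\<^esub> ?W \<oplus>\<^bsub>T\<^esub>
        (?c \<odot>\<^bsub>T\<^esub> pure k k \<oplus>\<^bsub>T\<^esub> (- ?c) \<odot>\<^bsub>T\<^esub> pure kinv kinv))"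
      by (simp add: T.a_ac)
    also have "?c \<odot>\<^bsub>T\<^esub> ?C \<oplus>\<^bsub>T\<^esub> (- ?c) \<odot>\<^bsub>T\<^esub> ?C = \<zero>\<^bsub>T\<^esub>"
      by (simp add: T.smult_minus T.r_neg)
    also have "\<zero>\<^bsub>T\<^esub> \<oplus>\<^bsub>T\<^esub> (?X \<oplus>\<^bsub>T\<^esub> ?Y \<oplus>\<^bsub>T\<^esub> ?Z \<oplus>\<^bsub>T\<^esub> ?W \<oplus>\<^bsub>T\<^esub>
        (?c \<odot>\<^bsub>T\<^esub> pure k k \<oplus>\<^bsub>T\<^esub> (- ?c) \<odot>\<^bsub>T\<^esub> pure kinv kinv)) =
      (pure f \<one>\<^bsub>U\<^esub> \<oplus>\<^bsub>T\<^esub> pure kinv f) \<otimes>\<^bsub>T\<^esub> (pure \<one>\<^bsub>U\<^esub> e \<oplus>\<^bsub>T\<^esub> pure e k)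
      \<oplus>\<^bsub>T\<^esub> (?c \<odot>\<^bsub>T\<^esub> pure k k \<oplus>\<^bsub>T\<^esub> (- ?c) \<odot>\<^bsub>T\<^esub> pure kinv kinv)"
      by (simp add: T.r_distr T.l_distr T.a_ac)
    finally show ?thesis .
  qed
  have ef': "(pure \<one>\<^bsub>U\<^esub> e \<oplus>\<^bsub>T\<^esub> pure e k) \<otimes>\<^bsub>T\<^esub> (pure f \<one>\<^bsub>U\<^esub> \<oplus>\<^bsub>T\<^esub> pure kinv f) \<ominus>\<^bsub>T\<^esub>
    (pure f \<one>\<^bsub>U\<^esub> \<oplus>\<^bsub>T\<^esub> pure kinv f) \<otimes>\<^bsub>T\<^esub> (pure \<one>\<^bsub>U\<^esub> e \<oplus>\<^bsub>T\<^esub> pure e k)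
      = ?c \<odot>\<^bsub>T\<^esub> pure k k \<ominus>\<^bsub>T\<^esub> ?c \<odot>\<^bsub>T\<^esub> pure kinv kinv"
    unfolding ef by (simp add: T.minus_eq T.smult_minus T.a_ac T.r_neg1 T.r_neg2 T.r_neg del: UU.pure_mult)
  show ?thesis
    unfolding T.uq_relations_iff[OF comult_gen_closed] comult_gen
    using kk ke kf ef' by blast
qed

lemma comult_hom:
  assumes "q \<noteq> 0"
  shows "presented_hom T (uq_relations q) (uq_comult_gen q)"
  using alg_tensor.complex_alg_T[OF alg_tensor_UU] comult_gen_closed comult_relations[OF assms]
  by (rule presented_homI)

lemma counit_hom: "presented_hom complex_algebra (uq_relations q) uq_counit_gen"
proof (rule presented_homI[OF complex_alg_complex_algebra])
  interpret C: complex_alg complex_algebra by (rule complex_alg_complex_algebra)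
  have c: "x \<in> carrier complex_algebra" for x by (simp add: complex_algebra_def)
  then show "uq_counit_gen g \<in> carrier complex_algebra" for g .
  have m: "x \<ominus>\<^bsub>complex_algebra\<^esub> x = 0" for x
    using C.minus_eq_zero_iff[OF c c, of x x] by (simp add: complex_algebra_def)
  show "\<forall>r\<in>uq_relations q. eval_free complex_algebra uq_counit_gen r = \<zero>\<^bsub>complex_algebra\<^esub>"
    unfolding C.uq_relations_iff[OF c]
    by (simp add: uq_counit_gen_def m) (simp add: complex_algebra_def)
qed

lemma Uq_simps [simp]:
  "carrier (Uq q) = carrier U" "mult (Uq q) = mult U" "one (Uq q) = one U" "zero (Uq q) = zero U"
  "add (Uq q) = add U" "smult (Uq q) = smult U"
  "comult (Uq q) = extend_hom T (uq_comult_gen q)"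
  "counit (Uq q) = extend_hom complex_algebra uq_counit_gen"
  by (simp_all add: Uq_def Let_def)

end

text \<open>The assumptions are the conditions on a symmetry written out for the generators only;
  \<open>hopf_symmetry\<close> extends them to the whole quantum group.\<close>

locale uq_action = uq q + A: complex_alg A
  for q :: complex and A :: "(complex, 'a, 'x) module_scheme" +
  fixes \<pi> :: "uq_elem \<Rightarrow> 'a \<Rightarrow> 'a"
  assumes q_nonzero: "q \<noteq> 0"
    and \<pi>: "\<pi> \<in> algebra_hom U (End_algebra A)"
    and act_k: "\<And>a b. \<lbrakk>a \<in> carrier A; b \<in> carrier A\<rbrakk> \<Longrightarrow> \<pi> k (a \<otimes>\<^bsub>A\<^esub> b) = \<pi> k a \<otimes>\<^bsub>A\<^esub> \<pi> k b"
    and act_kinv: "\<And>a b. \<lbrakk>a \<in> carrier A; b \<in> carrier A\<rbrakk> \<Longrightarrow>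
      \<pi> kinv (a \<otimes>\<^bsub>A\<^esub> b) = \<pi> kinv a \<otimes>\<^bsub>A\<^esub> \<pi> kinv b"
    and act_e: "\<And>a b. \<lbrakk>a \<in> carrier A; b \<in> carrier A\<rbrakk> \<Longrightarrow>
      \<pi> e (a \<otimes>\<^bsub>A\<^esub> b) = a \<otimes>\<^bsub>A\<^esub> \<pi> e b \<oplus>\<^bsub>A\<^esub> \<pi> e a \<otimes>\<^bsub>A\<^esub> \<pi> k b"
    and act_f: "\<And>a b. \<lbrakk>a \<in> carrier A; b \<in> carrier A\<rbrakk> \<Longrightarrow>
      \<pi> f (a \<otimes>\<^bsub>A\<^esub> b) = \<pi> f a \<otimes>\<^bsub>A\<^esub> b \<oplus>\<^bsub>A\<^esub> \<pi> kinv a \<otimes>\<^bsub>A\<^esub> \<pi> f b"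
    and act_one: "\<pi> k \<one>\<^bsub>A\<^esub> = \<one>\<^bsub>A\<^esub>" "\<pi> kinv \<one>\<^bsub>A\<^esub> = \<one>\<^bsub>A\<^esub>" "\<pi> e \<one>\<^bsub>A\<^esub> = \<zero>\<^bsub>A\<^esub>" "\<pi> f \<one>\<^bsub>A\<^esub> = \<zero>\<^bsub>A\<^esub>"
begin

lemma act_carrier: "x \<in> carrier U \<Longrightarrow> \<pi> x \<in> carrier (End_algebra A)"
  using linear_mapD(1)[OF algebra_hom_linear_map[OF \<pi>]] .

lemma act_closed [simp]: "\<lbrakk>x \<in> carrier U; a \<in> carrier A\<rbrakk> \<Longrightarrow> \<pi> x a \<in> carrier A"
  using A.EA_closed[OF act_carrier] .

lemma act_linear: "x \<in> carrier U \<Longrightarrow> linear_map A A (\<pi> x)"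
  using A.EA_linear[OF act_carrier] .

lemma act_mult: "\<lbrakk>x \<in> carrier U; y \<in> carrier U; a \<in> carrier A\<rbrakk> \<Longrightarrow> \<pi> (x \<otimes>\<^bsub>U\<^esub> y) a = \<pi> x (\<pi> y a)"
  by (simp add: algebra_homD[OF \<pi>] A.EA_apply)

lemma act_add: "\<lbrakk>x \<in> carrier U; y \<in> carrier U; a \<in> carrier A\<rbrakk> \<Longrightarrow> \<pi> (x \<oplus>\<^bsub>U\<^esub> y) a = \<pi> x a \<oplus>\<^bsub>A\<^esub> \<pi> y a"
  by (simp add: linear_mapD[OF algebra_hom_linear_map[OF \<pi>]] A.EA_apply)

lemma act_smult: "\<lbrakk>x \<in> carrier U; a \<in> carrier A\<rbrakk> \<Longrightarrow> \<pi> (c \<odot>\<^bsub>U\<^esub> x) a = c \<odot>\<^bsub>A\<^esub> \<pi> x a"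
  by (simp add: linear_mapD[OF algebra_hom_linear_map[OF \<pi>]] A.EA_apply)

lemma act_unit: "a \<in> carrier A \<Longrightarrow> \<pi> \<one>\<^bsub>U\<^esub> a = a"
  by (simp add: algebra_homD[OF \<pi>] A.EA_apply)

lemma alg_bilinear_act:
  assumes [simp]: "a \<in> carrier A" "b \<in> carrier A"
  shows "alg_bilinear U U A (\<lambda>x y. \<pi> x a \<otimes>\<^bsub>A\<^esub> \<pi> y b)"
proof (intro alg_bilinear.intro alg_bilinear_axioms.intro alg_tensor_UU A.complex_alg_axioms)
  show "linear_map U A (\<lambda>x. \<pi> x a \<otimes>\<^bsub>A\<^esub> \<pi> y b)" if "y \<in> carrier U" for y
    using that by (intro linear_mapI) (simp_all add: act_add act_smult A.l_distr A.smult_m_l)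
  show "linear_map U A (\<lambda>y. \<pi> x a \<otimes>\<^bsub>A\<^esub> \<pi> y b)" if "x \<in> carrier U" for x
    using that by (intro linear_mapI) (simp_all add: act_add act_smult A.r_distr A.smult_m_r)
qed

text \<open>Taking for \<open>t\<close> the comultiplication of x, this is the induction step from x
  to a generator times x. On a pure tensor with legs x and y it is the rule assumed for the
  generator, applied to \<open>\<pi> x a\<close> and \<open>\<pi> y b\<close>.\<close>

lemma tensor_map_comult_gen:
  assumes t: "t \<in> carrier T" and ab [simp]: "a \<in> carrier A" "b \<in> carrier A"
  shows "tensor_map A (\<lambda>x y. \<pi> x a \<otimes>\<^bsub>A\<^esub> \<pi> y b) (uq_comult_gen q g \<otimes>\<^bsub>T\<^esub> t) =
    \<pi> (gen g) (tensor_map A (\<lambda>x y. \<pi> x a \<otimes>\<^bsub>A\<^esub> \<pi> y b) t)"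
proof -
  interpret U: complex_alg U by (rule complex_alg_Uq)
  interpret UU: alg_tensor U U by (rule alg_tensor_UU)
  interpret T: complex_alg T by (rule UU.complex_alg_T)
  interpret B: alg_bilinear U U A "\<lambda>x y. \<pi> x a \<otimes>\<^bsub>A\<^esub> \<pi> y b" by (rule alg_bilinear_act) simp_all
  note lin = linear_mapD[OF B.linear_map_tensor_map] and glin = linear_mapD[OF act_linear[OF gen_closed]]
  from t show ?thesis
  proof (induction rule: UU.tensor_induct)
    case (pure x y)
    then show ?case
      by (cases g)
        (simp_all add: comult_gen T.l_distr lin act_mult act_unit act_k act_kinv act_e act_f)
  next
    case (smult c t)
    then show ?case by (simp add: T.smult_m_r comult_gen_closed lin glin)
  next
    case (add s t)
    then show ?case by (simp add: T.r_distr comult_gen_closed lin glin)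
  qed
qed

lemma hopf_symmetry: "hopf_symmetry (Uq q) A \<pi>"
  unfolding hopf_symmetry_def Uq_simps
proof (intro conjI ballI)
  show "\<pi> \<in> algebra_hom (Uq q) (End_algebra A)"
    using \<pi> by (simp add: algebra_hom_def ring_hom_def)
next
  interpret U: complex_alg U by (rule complex_alg_Uq)
  interpret UU: alg_tensor U U by (rule alg_tensor_UU)
  interpret T: complex_alg T by (rule UU.complex_alg_T)
  interpret D: presented_hom T "uq_relations q" "uq_comult_gen q" by (rule comult_hom[OF q_nonzero])
  let ?\<Delta> = "extend_hom T (uq_comult_gen q)"
  have D: "?\<Delta> \<in> algebra_hom U T" using D.extend_hom_algebra_hom unfolding Uq_algebra_def .
  note Dl = linear_mapD[OF algebra_hom_linear_map[OF D]] and Dm = algebra_homD[OF D]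
  fix h a b assume h: "h \<in> carrier U" and ab [simp]: "a \<in> carrier A" "b \<in> carrier A"
  interpret B: alg_bilinear U U A "\<lambda>x y. \<pi> x a \<otimes>\<^bsub>A\<^esub> \<pi> y b" by (rule alg_bilinear_act) simp_all
  note lin = linear_mapD[OF B.linear_map_tensor_map]
  from h
  show "\<pi> h (a \<otimes>\<^bsub>A\<^esub> b) = tensor_map A (\<lambda>x y. \<pi> x a \<otimes>\<^bsub>A\<^esub> \<pi> y b) (?\<Delta> h)"
  proof (induction rule: Uq_induct)
    case one
    then show ?case by (simp add: Dm UU.pure_one act_unit)
  next
    case (gen g x)
    then show ?case by (simp add: act_mult Dm Dl tensor_map_comult_gen)
  next
    case (smult c x)
    then show ?case by (simp add: act_smult Dl lin)
  next
    case (add x y)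
    then show ?case by (simp add: act_add Dl lin)
  qed
next
  interpret U: complex_alg U by (rule complex_alg_Uq)
  interpret E: presented_hom complex_algebra "uq_relations q" uq_counit_gen by (rule counit_hom)
  let ?\<epsilon> = "extend_hom complex_algebra uq_counit_gen"
  have E: "?\<epsilon> \<in> algebra_hom U complex_algebra" using E.extend_hom_algebra_hom unfolding Uq_algebra_def .
  note El = linear_mapD[OF algebra_hom_linear_map[OF E]] and Em = algebra_homD[OF E]
  have C: "x \<otimes>\<^bsub>complex_algebra\<^esub> y = x * y" "x \<oplus>\<^bsub>complex_algebra\<^esub> y = x + y"
    "x \<odot>\<^bsub>complex_algebra\<^esub> y = x * y" "\<one>\<^bsub>complex_algebra\<^esub> = 1" for x y
    by (simp_all add: complex_algebra_def)
  fix h assume h: "h \<in> carrier U"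
  from h
  show "\<pi> h \<one>\<^bsub>A\<^esub> = ?\<epsilon> h \<odot>\<^bsub>A\<^esub> \<one>\<^bsub>A\<^esub>"
  proof (induction rule: Uq_induct)
    case one
    then show ?case by (simp add: Em act_unit C)
  next
    case (gen g x)
    have "\<pi> (gen g) \<one>\<^bsub>A\<^esub> = uq_counit_gen g \<odot>\<^bsub>A\<^esub> \<one>\<^bsub>A\<^esub>"
      by (cases g) (simp_all add: uq_counit_gen_def act_one)
    then show ?case using gen linear_mapD(3)[OF act_linear[OF gen_closed]]
      by (simp add: act_mult Em C A.smult_smult mult.commute)
  next
    case (smult c x)
    then show ?case by (simp add: act_smult El C A.smult_smult)
  next
    case (add x y)
    then show ?case by (simp add: act_add El C A.smult_l_distr)
  qed
qed

end

section \<open>The quantum disc\<close>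

context complex_alg
begin

text \<open>Records an element by its two coefficients with respect to fixed \<open>m\<close> and
  \<open>n\<close>, so that identities in the algebra are proved by comparing pairs of complex
  numbers.\<close>

definition comb :: "'a \<Rightarrow> 'a \<Rightarrow> complex \<Rightarrow> complex \<Rightarrow> 'a" where
  "comb m n c d = c \<odot> m \<oplus> d \<odot> n"

lemma comb_closed [simp]: "\<lbrakk>m \<in> carrier A; n \<in> carrier A\<rbrakk> \<Longrightarrow> comb m n c d \<in> carrier A"
  by (simp add: comb_def)

lemma comb_add:
  assumes "m \<in> carrier A" "n \<in> carrier A"
  shows "comb m n c d \<oplus> comb m n c' d' = comb m n (c + c') (d + d')"
  using assms by (simp add: comb_def smult_l_distr a_ac)

lemma comb_smult:
  assumes "m \<in> carrier A" "n \<in> carrier A"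
  shows "c' \<odot> comb m n c d = comb m n (c' * c) (c' * d)"
  using assms by (simp add: comb_def smult_r_distr smult_smult)

lemma comb_a_inv:
  assumes "m \<in> carrier A" "n \<in> carrier A"
  shows "\<ominus> comb m n c d = comb m n (- c) (- d)"
  using assms comb_smult[of m n "-1" c d] by (simp add: a_inv_conv_smult comb_def)

lemma comb_minus:
  assumes "m \<in> carrier A" "n \<in> carrier A"
  shows "comb m n c d \<ominus> comb m n c' d' = comb m n (c - c') (d - d')"
  using assms by (simp add: minus_eq comb_a_inv comb_add)

end

text \<open>The Leibniz rule is asked for only with a generator on the left, which is what the
  induction peels off. \<open>P\<close> and \<open>S\<close> may be arbitrary maps, so that
  composites such as \<open>K (K x)\<close> can serve as twists.\<close>

lemma skew_derivation_eqI:
  assumes "complex_alg A"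
    and G: "linear_map (presented_algebra R) A G" and G': "linear_map (presented_algebra R) A G'"
    and "\<And>g x. x \<in> carrier (presented_algebra R) \<Longrightarrow>
      G (generator R g \<otimes>\<^bsub>presented_algebra R\<^esub> x) = P (generator R g) \<otimes>\<^bsub>A\<^esub> G x \<oplus>\<^bsub>A\<^esub> G (generator R g) \<otimes>\<^bsub>A\<^esub> S x"
    and "\<And>g x. x \<in> carrier (presented_algebra R) \<Longrightarrow>
      G' (generator R g \<otimes>\<^bsub>presented_algebra R\<^esub> x) = P (generator R g) \<otimes>\<^bsub>A\<^esub> G' x \<oplus>\<^bsub>A\<^esub> G' (generator R g) \<otimes>\<^bsub>A\<^esub> S x"
    and "\<And>g. G (generator R g) = G' (generator R g)"
    and "G \<one>\<^bsub>presented_algebra R\<^esub> = G' \<one>\<^bsub>presented_algebra R\<^esub>"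
    and x: "x \<in> carrier (presented_algebra R)"
  shows "G x = G' x"
  using x
  by (induction rule: presented_induct) (simp_all add: assms linear_mapD[OF G] linear_mapD[OF G'])

text \<open>Here \<open>p\<close> is the inverse square of \<open>q\<close>; using it through the
  equation \<open>pq\<close> keeps the scalar computations polynomial.\<close>

locale disc =
  fixes q p :: complex
  assumes pq: "p * q^2 = 1"
begin

abbreviation A where "A \<equiv> Pol_disc q"
abbreviation z where "z \<equiv> disc_z q"
abbreviation zs where "zs \<equiv> disc_zs q"
abbreviation y where "y \<equiv> disc_y q"
abbreviation grade where "grade \<equiv> disc_grade q"

sublocale A: complex_alg "Pol_disc q"
  unfolding Pol_disc_def by (rule complex_alg_presented)

lemma z_closed [simp]: "z \<in> carrier A" and zs_closed [simp]: "zs \<in> carrier A"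
  by (simp_all add: Pol_disc_def disc_z_def disc_zs_def)

lemma y_closed [simp]: "y \<in> carrier A"
  by (simp add: disc_y_def)

lemma disc_relation: "z \<otimes>\<^bsub>A\<^esub> zs = q^2 \<odot>\<^bsub>A\<^esub> (zs \<otimes>\<^bsub>A\<^esub> z) \<oplus>\<^bsub>A\<^esub> (1 - q^2) \<odot>\<^bsub>A\<^esub> \<one>\<^bsub>A\<^esub>"
proof -
  have "\<forall>r\<in>disc_relations q. eval_free A (generator (disc_relations q)) r = \<zero>\<^bsub>A\<^esub>"
    unfolding Pol_disc_def by (simp add: eval_free_generator_relation)
  then show ?thesis
    by (subst (asm) A.disc_relations_iff) (simp_all add: disc_z_def disc_zs_def Pol_disc_def)
qed

text \<open>The disc relation solved for the word in the wrong order. It is the rewrite rule towards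
  the normal form with \<open>z\<close> before \<open>zs\<close>.\<close>

lemma zs_z: "zs \<otimes>\<^bsub>A\<^esub> z = (1 - p) \<odot>\<^bsub>A\<^esub> \<one>\<^bsub>A\<^esub> \<oplus>\<^bsub>A\<^esub> p \<odot>\<^bsub>A\<^esub> (z \<otimes>\<^bsub>A\<^esub> zs)"
proof -
  have "(1 - p) \<odot>\<^bsub>A\<^esub> \<one>\<^bsub>A\<^esub> \<oplus>\<^bsub>A\<^esub> p \<odot>\<^bsub>A\<^esub> (z \<otimes>\<^bsub>A\<^esub> zs) =
    A.comb (zs \<otimes>\<^bsub>A\<^esub> z) \<one>\<^bsub>A\<^esub> 0 (1 - p) \<oplus>\<^bsub>A\<^esub> p \<odot>\<^bsub>A\<^esub> A.comb (zs \<otimes>\<^bsub>A\<^esub> z) \<one>\<^bsub>A\<^esub> (q^2) (1 - q^2)"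
    by (subst disc_relation) (simp add: A.comb_def)
  also have "\<dots> = A.comb (zs \<otimes>\<^bsub>A\<^esub> z) \<one>\<^bsub>A\<^esub> (0 + p * q^2) ((1 - p) + p * (1 - q^2))"
    by (simp add: A.comb_add A.comb_smult)
  also have "(1 - p) + p * (1 - q^2) = 0" using pq by (simp add: algebra_simps)
  finally show ?thesis by (simp add: pq A.comb_def)
qed

text \<open>The two normal words of degree -1 and length at most 3. Every element computed from
  \<open>zs\<close>, and the value of e at \<open>y\<close>, lies in their span;
  \<open>comb_z\<close> is the analogue in degree 1, for \<open>z\<close> and for the value of f at
  \<open>y\<close>.\<close>

abbreviation comb_zs where "comb_zs \<equiv> A.comb zs (z \<otimes>\<^bsub>A\<^esub> (zs \<otimes>\<^bsub>A\<^esub> zs))"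
abbreviation comb_z where "comb_z \<equiv> A.comb z (z \<otimes>\<^bsub>A\<^esub> (z \<otimes>\<^bsub>A\<^esub> zs))"

lemma zs_z_left:
  assumes "x \<in> carrier A"
  shows "zs \<otimes>\<^bsub>A\<^esub> (z \<otimes>\<^bsub>A\<^esub> x) = (1 - p) \<odot>\<^bsub>A\<^esub> x \<oplus>\<^bsub>A\<^esub> p \<odot>\<^bsub>A\<^esub> (z \<otimes>\<^bsub>A\<^esub> (zs \<otimes>\<^bsub>A\<^esub> x))"
  using assms by (simp add: A.m_assoc[symmetric] zs_z A.l_distr A.smult_m_l)

text \<open>Each exchange multiplies the longest normal word by p. The two coefficients add up to 1,
  in accordance with the character that sends \<open>z\<close> and \<open>zs\<close> to 1.\<close>

lemma words_zs:
  "zs \<otimes>\<^bsub>A\<^esub> (z \<otimes>\<^bsub>A\<^esub> zs) = comb_zs (1 - p) p"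
  "zs \<otimes>\<^bsub>A\<^esub> (zs \<otimes>\<^bsub>A\<^esub> z) = comb_zs (1 - p^2) (p^2)"
proof -
  show 1: "zs \<otimes>\<^bsub>A\<^esub> (z \<otimes>\<^bsub>A\<^esub> zs) = comb_zs (1 - p) p"
    by (simp add: zs_z_left A.comb_def)
  have "zs \<otimes>\<^bsub>A\<^esub> (zs \<otimes>\<^bsub>A\<^esub> z) = comb_zs (1 - p) 0 \<oplus>\<^bsub>A\<^esub> p \<odot>\<^bsub>A\<^esub> (zs \<otimes>\<^bsub>A\<^esub> (z \<otimes>\<^bsub>A\<^esub> zs))"
    by (simp add: zs_z A.r_distr A.smult_m_r) (simp add: A.comb_def)
  also have "\<dots> = comb_zs (1 - p + p * (1 - p)) (0 + p * p)"
    unfolding 1 by (simp add: A.comb_smult A.comb_add)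
  also have "\<dots> = comb_zs (1 - p^2) (p^2)"
    by (rule arg_cong2) (simp_all add: algebra_simps power2_eq_square)
  finally show "zs \<otimes>\<^bsub>A\<^esub> (zs \<otimes>\<^bsub>A\<^esub> z) = comb_zs (1 - p^2) (p^2)" .
qed

lemma words_z:
  "z \<otimes>\<^bsub>A\<^esub> (zs \<otimes>\<^bsub>A\<^esub> z) = comb_z (1 - p) p"
  "zs \<otimes>\<^bsub>A\<^esub> (z \<otimes>\<^bsub>A\<^esub> z) = comb_z (1 - p^2) (p^2)"
proof -
  show 1: "z \<otimes>\<^bsub>A\<^esub> (zs \<otimes>\<^bsub>A\<^esub> z) = comb_z (1 - p) p"
    by (simp add: zs_z A.comb_def A.r_distr A.smult_m_r)
  have "zs \<otimes>\<^bsub>A\<^esub> (z \<otimes>\<^bsub>A\<^esub> z) = comb_z (1 - p) 0 \<oplus>\<^bsub>A\<^esub> p \<odot>\<^bsub>A\<^esub> (z \<otimes>\<^bsub>A\<^esub> (zs \<otimes>\<^bsub>A\<^esub> z))"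
    by (simp add: zs_z_left) (simp add: A.comb_def)
  also have "\<dots> = comb_z (1 - p + p * (1 - p)) (0 + p * p)"
    unfolding 1 by (simp add: A.comb_smult A.comb_add)
  also have "\<dots> = comb_z (1 - p^2) (p^2)"
    by (rule arg_cong2) (simp_all add: algebra_simps power2_eq_square)
  finally show "zs \<otimes>\<^bsub>A\<^esub> (z \<otimes>\<^bsub>A\<^esub> z) = comb_z (1 - p^2) (p^2)" .
qed

lemma comb_zs_simps:
  "c \<odot>\<^bsub>A\<^esub> zs = comb_zs c 0"
  "c \<odot>\<^bsub>A\<^esub> (z \<otimes>\<^bsub>A\<^esub> (zs \<otimes>\<^bsub>A\<^esub> zs)) = comb_zs 0 c"
  "comb_zs c d \<oplus>\<^bsub>A\<^esub> comb_zs c' d' = comb_zs (c + c') (d + d')"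
  "comb_zs c d \<ominus>\<^bsub>A\<^esub> comb_zs c' d' = comb_zs (c - c') (d - d')"
  "b \<odot>\<^bsub>A\<^esub> comb_zs c d = comb_zs (b * c) (b * d)"
  "\<ominus>\<^bsub>A\<^esub> comb_zs c d = comb_zs (- c) (- d)"
  by (simp_all add: A.comb_add A.comb_minus A.comb_smult A.comb_a_inv) (simp_all add: A.comb_def)

lemma comb_z_simps:
  "c \<odot>\<^bsub>A\<^esub> z = comb_z c 0"
  "c \<odot>\<^bsub>A\<^esub> (z \<otimes>\<^bsub>A\<^esub> (z \<otimes>\<^bsub>A\<^esub> zs)) = comb_z 0 c"
  "comb_z c d \<oplus>\<^bsub>A\<^esub> comb_z c' d' = comb_z (c + c') (d + d')"
  "comb_z c d \<ominus>\<^bsub>A\<^esub> comb_z c' d' = comb_z (c - c') (d - d')"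
  "b \<odot>\<^bsub>A\<^esub> comb_z c d = comb_z (b * c) (b * d)"
  "\<ominus>\<^bsub>A\<^esub> comb_z c d = comb_z (- c) (- d)"
  by (simp_all add: A.comb_add A.comb_minus A.comb_smult A.comb_a_inv) (simp_all add: A.comb_def)

lemmas expand = A.r_distr A.l_distr A.smult_m_l A.smult_m_r A.smult_smult A.smult_r_distr A.m_assoc

definition gen_val :: "'b \<Rightarrow> 'b \<Rightarrow> disc_gen \<Rightarrow> 'b" where
  "gen_val a b g = (case g of Gen_z \<Rightarrow> a | Gen_zs \<Rightarrow> b)"

lemma gen_val_simps [simp]: "gen_val a b Gen_z = a" "gen_val a b Gen_zs = b"
  by (simp_all add: gen_val_def)

lemma generator_eq: "generator (disc_relations q) = gen_val z zs"
proof
  show "generator (disc_relations q) g = gen_val z zs g" for g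
    by (cases g) (simp_all add: disc_z_def disc_zs_def)
qed

lemma disc_hom_exists:
  assumes B: "complex_alg B" and ab: "a \<in> carrier B" "b \<in> carrier B"
    and rel: "a \<otimes>\<^bsub>B\<^esub> b = q^2 \<odot>\<^bsub>B\<^esub> (b \<otimes>\<^bsub>B\<^esub> a) \<oplus>\<^bsub>B\<^esub> (1 - q^2) \<odot>\<^bsub>B\<^esub> \<one>\<^bsub>B\<^esub>"
  obtains h where "h \<in> algebra_hom A B" "h z = a" "h zs = b"
proof -
  interpret B: complex_alg B by (rule B)
  have cl: "gen_val a b g \<in> carrier B" for g using ab by (cases g) simp_all
  interpret h: presented_hom B "disc_relations q" "gen_val a b"
    by (rule presented_homI[OF B cl]) (simp add: B.disc_relations_iff[OF cl] rel)
  show ?thesis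
    using that[of "extend_hom B (gen_val a b)"] h.extend_hom_algebra_hom
      h.extend_hom_generator[of Gen_z] h.extend_hom_generator[of Gen_zs]
    by (simp add: Pol_disc_def disc_z_def disc_zs_def)
qed

text \<open>The condition \<open>rel\<close> is the corner of the disc relation between triangular
  matrices; the constant 1 - q^2 does not appear in it since the unit matrix has corner 0. The two
  diagonal entries satisfy the relation because \<open>P\<close> and \<open>S\<close> are
  homomorphisms.\<close>

lemma disc_derivation_exists:
  assumes P: "P \<in> algebra_hom A A" and S: "S \<in> algebra_hom A A"
    and ab: "a \<in> carrier A" "b \<in> carrier A"
    and rel: "P z \<otimes>\<^bsub>A\<^esub> b \<oplus>\<^bsub>A\<^esub> a \<otimes>\<^bsub>A\<^esub> S zs = q^2 \<odot>\<^bsub>A\<^esub> (P zs \<otimes>\<^bsub>A\<^esub> a \<oplus>\<^bsub>A\<^esub> b \<otimes>\<^bsub>A\<^esub> S z)"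
  obtains D where "linear_map A A D"
    "\<And>x y. \<lbrakk>x \<in> carrier A; y \<in> carrier A\<rbrakk> \<Longrightarrow> D (x \<otimes>\<^bsub>A\<^esub> y) = P x \<otimes>\<^bsub>A\<^esub> D y \<oplus>\<^bsub>A\<^esub> D x \<otimes>\<^bsub>A\<^esub> S y"
    "D z = a" "D zs = b" "D \<one>\<^bsub>A\<^esub> = \<zero>\<^bsub>A\<^esub>"
proof -
  let ?T = "triangular_algebra A"
  note Pl = linear_mapD[OF algebra_hom_linear_map[OF P]] and Sl = linear_mapD[OF algebra_hom_linear_map[OF S]]
  interpret T: complex_alg ?T by (rule complex_alg_triangular) (rule A.complex_alg_axioms)
  let ?\<phi> = "\<lambda>g. (P (generator (disc_relations q) g), gen_val a b g, S (generator (disc_relations q) g))"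
  have \<delta>: "gen_val a b g \<in> carrier A" for g using ab by (cases g) simp_all
  have cl: "?\<phi> g \<in> carrier ?T" for g
    using ab by (cases g) (simp_all add: generator_eq Pl Sl)
  have "\<forall>r\<in>disc_relations q. eval_free ?T ?\<phi> r = \<zero>\<^bsub>?T\<^esub>"
    unfolding T.disc_relations_iff[OF cl]
    using arg_cong[OF disc_relation, of P] arg_cong[OF disc_relation, of S] rel ab
    by (simp add: generator_eq Pl Sl algebra_homD[OF P] algebra_homD[OF S])
  then have r: "eval_free ?T ?\<phi> r = \<zero>\<^bsub>?T\<^esub>" if "r \<in> disc_relations q" for r using that by blast
  obtain D where D: "linear_map A A D"
    "\<And>x y. \<lbrakk>x \<in> carrier A; y \<in> carrier A\<rbrakk> \<Longrightarrow> D (x \<otimes>\<^bsub>A\<^esub> y) = P x \<otimes>\<^bsub>A\<^esub> D y \<oplus>\<^bsub>A\<^esub> D x \<otimes>\<^bsub>A\<^esub> S y"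
    "\<And>g. D (generator (disc_relations q) g) = gen_val a b g" "D \<one>\<^bsub>A\<^esub> = \<zero>\<^bsub>A\<^esub>"
    using skew_derivation_exists[where R = "disc_relations q" and A = A and P = P and S = S and \<delta> = "gen_val a b"] A.complex_alg_axioms P S \<delta> r
    unfolding Pol_disc_def by blast
  then show ?thesis using that[of D] D(3)[of Gen_z] D(3)[of Gen_zs] by (simp add: generator_eq)
qed

lemmas disc_generator_induct [consumes 1, case_names one gen smult add] =
  presented_induct[where R = "disc_relations q", folded Pol_disc_def]

lemma disc_induct [consumes 1, case_names one z zs smult add]:
  assumes x: "x \<in> carrier A"
    and "P \<one>\<^bsub>A\<^esub>"
    and "\<And>x. \<lbrakk>x \<in> carrier A; P x\<rbrakk> \<Longrightarrow> P (z \<otimes>\<^bsub>A\<^esub> x)"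
    and "\<And>x. \<lbrakk>x \<in> carrier A; P x\<rbrakk> \<Longrightarrow> P (zs \<otimes>\<^bsub>A\<^esub> x)"
    and "\<And>c x. \<lbrakk>x \<in> carrier A; P x\<rbrakk> \<Longrightarrow> P (c \<odot>\<^bsub>A\<^esub> x)"
    and "\<And>x y. \<lbrakk>x \<in> carrier A; y \<in> carrier A; P x; P y\<rbrakk> \<Longrightarrow> P (x \<oplus>\<^bsub>A\<^esub> y)"
  shows "P x"
  using x
proof (induction rule: disc_generator_induct)
  case (gen g x)
  then show ?case using assms(3,4) by (cases g) (simp_all add: generator_eq)
qed (use assms in simp_all)

end

context complex_alg
begin

lemma l_diff_distr:
  assumes "x \<in> carrier A" "y \<in> carrier A" "w \<in> carrier A"
  shows "(x \<ominus> y) \<otimes> w = x \<otimes> w \<ominus> y \<otimes> w"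
  using assms by (simp add: minus_eq l_distr l_minus)

lemma r_diff_distr:
  assumes "x \<in> carrier A" "y \<in> carrier A" "w \<in> carrier A"
  shows "w \<otimes> (x \<ominus> y) = w \<otimes> x \<ominus> w \<otimes> y"
  using assms by (simp add: minus_eq r_distr r_minus)

text \<open>This is why the difference of two homomorphisms is a skew derivation twisted by them:
  \<open>x\<close> plays the mixed product that is subtracted and added. It is applied to
  \<open>K\<close> and \<open>Kinv\<close>.\<close>

lemma diff_telescope:
  assumes "x \<in> carrier A" "y \<in> carrier A" "w \<in> carrier A"
  shows "(x \<ominus> y) \<oplus> (w \<ominus> x) = w \<ominus> y"
proof -
  have "(x \<ominus> y) \<oplus> (w \<ominus> x) = (x \<oplus> \<ominus> x) \<oplus> (w \<ominus> y)"
    using assms by (simp add: minus_eq add.m_ac del: r_neg r_neg1 r_neg2)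
  then show ?thesis using assms by (simp add: r_neg)
qed

end

lemma linear_map_cong:
  assumes "linear_map A B f" "\<And>x. x \<in> carrier A \<Longrightarrow> f x = g x" "complex_alg A"
  shows "linear_map A B g"
proof -
  interpret A: complex_alg A by fact
  show ?thesis by (rule linear_mapI) (simp_all add: assms(2)[symmetric] linear_mapD[OF assms(1)])
qed

section \<open>The parameter family and its scalar identities\<close>

locale disc_params = disc q p for q p :: complex +
  fixes s0 a1 t0 b1 :: complex
  assumes q_sq: "q^2 \<noteq> 1"
    and ab: "a1 * b1 = 0"
    and norm: "q * (b1 * s0 + a1 * t0) = 1"
begin

lemma q_nonzero: "q \<noteq> 0"
  using pq by auto

lemma pq_simps: "q^2 * p = 1" "p * (q^2 * x) = x" "q^2 * (p * x) = x"
  using pq by (simp_all add: mult.commute[of "q^2"] flip: mult.assoc)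

text \<open>Coefficients with respect to 1 and z zs instead of 1 and \<open>y\<close>: since y = 1 -
  z zs, the value s0 - s1 y becomes s + s1 z zs, and likewise for \<open>t\<close>.\<close>

abbreviation s where "s \<equiv> s0 - (1 + p) * a1"
abbreviation s1 where "s1 \<equiv> (1 + p) * a1"
abbreviation s2 where "s2 \<equiv> - (q^2) * a1"
abbreviation t where "t \<equiv> t0 - (1 + p) * b1"
abbreviation t1 where "t1 \<equiv> (1 + p) * b1"
abbreviation t2 where "t2 \<equiv> - (q^2) * b1"

text \<open>The left sides are the coefficients of the commutator of e and f, at \<open>z\<close> in
  the first two equations and at \<open>zs\<close> in the last two. Modulo a1 b1 = 0 two of them
  vanish and the others are multiples of b1 s0 + a1 t0, whose value \<open>norm\<close> fixes. The
  right sides come from (q^2 - q^-2) / (q - 1/q) = q + 1/q = q (1 + p).\<close>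

lemma scalar_identities:
  "t2 * (s + p * s) + t2 * p * (s1 * (1 - p)) - s1 * q^2 * t = (p - q^2) / (q - inverse q)"
  "t2 * s1 + t2 * p * (s1 * p) - s1 * t2 - s1 * q^2 * t1 = 0"
  "t1 * q^2 * s - s2 * (t + p * t + p * t1 * (1 - p)) = (q^2 - p) / (q - inverse q)"
  "t1 * s2 + t1 * q^2 * s1 - s2 * (t1 + p * t1 * p) = 0"
proof -
  have nz: "q - inverse q \<noteq> 0"
    using q_sq q_nonzero by (simp add: field_simps power2_eq_square)
  have e: "q * (1 + p) = (q^2 - p) / (q - inverse q)"
  proof -
    have "q * (1 + p) * (q - inverse q) = q^2 - 1 + (p * q^2) - p"
      using q_nonzero by (simp add: field_simps power2_eq_square)
    then show ?thesis using nz pq by (simp add: eq_divide_eq)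
  qed
  have n: "q^2 * (1 + p) * (b1 * s0 + a1 * t0) = q * (1 + p)"
  proof -
    have "q^2 * (1 + p) * (b1 * s0 + a1 * t0) = q * (1 + p) * (q * (b1 * s0 + a1 * t0))"
      by (simp add: algebra_simps power2_eq_square)
    then show ?thesis by (simp add: norm)
  qed
  have cases: "a1 = 0 \<or> b1 = 0" using ab by simp
  have "t2 * (s + p * s) + t2 * p * (s1 * (1 - p)) - s1 * q^2 * t = - (q^2 * (1 + p) * (b1 * s0 + a1 * t0))"
    using cases by (elim disjE) (simp_all add: algebra_simps)
  also have "\<dots> = (p - q^2) / (q - inverse q)"
    unfolding n e by (simp add: minus_divide_left)
  finally show "t2 * (s + p * s) + t2 * p * (s1 * (1 - p)) - s1 * q^2 * t = (p - q^2) / (q - inverse q)" .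
  have "t1 * q^2 * s - s2 * (t + p * t + p * t1 * (1 - p)) = q^2 * (1 + p) * (b1 * s0 + a1 * t0)"
    using cases by (elim disjE) (simp_all add: algebra_simps)
  also have "\<dots> = (q^2 - p) / (q - inverse q)" unfolding n e ..
  finally show "t1 * q^2 * s - s2 * (t + p * t + p * t1 * (1 - p)) = (q^2 - p) / (q - inverse q)" .
  show "t2 * s1 + t2 * p * (s1 * p) - s1 * t2 - s1 * q^2 * t1 = 0"
    "t1 * s2 + t1 * q^2 * s1 - s2 * (t1 + p * t1 * p) = 0"
    using cases by auto
qed

end

section \<open>The four operators on the disc and the relations between them\<close>

locale disc_ops = disc_params +
  fixes K Kinv E F :: "disc_elem \<Rightarrow> disc_elem"
  assumes K: "K \<in> algebra_hom A A" "K z = p \<odot>\<^bsub>A\<^esub> z" "K zs = q^2 \<odot>\<^bsub>A\<^esub> zs"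
    and Kinv: "Kinv \<in> algebra_hom A A" "Kinv z = q^2 \<odot>\<^bsub>A\<^esub> z" "Kinv zs = p \<odot>\<^bsub>A\<^esub> zs"
    and E: "linear_map A A E"
      "\<And>x y. \<lbrakk>x \<in> carrier A; y \<in> carrier A\<rbrakk> \<Longrightarrow> E (x \<otimes>\<^bsub>A\<^esub> y) = x \<otimes>\<^bsub>A\<^esub> E y \<oplus>\<^bsub>A\<^esub> E x \<otimes>\<^bsub>A\<^esub> K y"
      "E \<one>\<^bsub>A\<^esub> = \<zero>\<^bsub>A\<^esub>" "E z = s \<odot>\<^bsub>A\<^esub> \<one>\<^bsub>A\<^esub> \<oplus>\<^bsub>A\<^esub> s1 \<odot>\<^bsub>A\<^esub> (z \<otimes>\<^bsub>A\<^esub> zs)" "E zs = s2 \<odot>\<^bsub>A\<^esub> (zs \<otimes>\<^bsub>A\<^esub> zs)"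
    and F: "linear_map A A F"
      "\<And>x y. \<lbrakk>x \<in> carrier A; y \<in> carrier A\<rbrakk> \<Longrightarrow> F (x \<otimes>\<^bsub>A\<^esub> y) = Kinv x \<otimes>\<^bsub>A\<^esub> F y \<oplus>\<^bsub>A\<^esub> F x \<otimes>\<^bsub>A\<^esub> y"
      "F \<one>\<^bsub>A\<^esub> = \<zero>\<^bsub>A\<^esub>" "F z = t2 \<odot>\<^bsub>A\<^esub> (z \<otimes>\<^bsub>A\<^esub> z)" "F zs = t \<odot>\<^bsub>A\<^esub> \<one>\<^bsub>A\<^esub> \<oplus>\<^bsub>A\<^esub> t1 \<odot>\<^bsub>A\<^esub> (z \<otimes>\<^bsub>A\<^esub> zs)"
begin

lemmas K_simps [simp] = linear_mapD[OF algebra_hom_linear_map[OF K(1)]] algebra_homD[OF K(1)]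
  and Kinv_simps [simp] = linear_mapD[OF algebra_hom_linear_map[OF Kinv(1)]] algebra_homD[OF Kinv(1)]
  and E_simps [simp] = linear_mapD[OF E(1)] E(2,3)
  and F_simps [simp] = linear_mapD[OF F(1)] F(2,3)

lemma ops_minus:
  assumes "x \<in> carrier A" "v \<in> carrier A"
  shows "K (x \<ominus>\<^bsub>A\<^esub> v) = K x \<ominus>\<^bsub>A\<^esub> K v" "Kinv (x \<ominus>\<^bsub>A\<^esub> v) = Kinv x \<ominus>\<^bsub>A\<^esub> Kinv v"
    "E (x \<ominus>\<^bsub>A\<^esub> v) = E x \<ominus>\<^bsub>A\<^esub> E v" "F (x \<ominus>\<^bsub>A\<^esub> v) = F x \<ominus>\<^bsub>A\<^esub> F v"
  using assms by (simp_all add: A.minus_eq A.a_inv_conv_smult)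

lemma linear_map_comp [simp]:
  "linear_map A A f \<Longrightarrow> linear_map A A g \<Longrightarrow> linear_map A A (\<lambda>x. f (g x))"
  using linear_map_compose[of A A g A f] by (simp add: comp_def)

lemmas lin_ops [simp] = E(1) F(1) algebra_hom_linear_map[OF K(1)] algebra_hom_linear_map[OF Kinv(1)]

lemmas ops_zero [simp] = lin_ops[THEN linear_map_zero[OF A.complex_alg_axioms A.complex_alg_axioms]]

lemmas derivation_eqI = skew_derivation_eqI[where R = "disc_relations q", folded Pol_disc_def,
    OF A.complex_alg_axioms, unfolded generator_eq]

lemma gen_val_closed [simp]: "gen_val z zs g \<in> carrier A"
  by (cases g) simp_all

lemma K_Kinv:
  assumes "x \<in> carrier A" shows "K (Kinv x) = x" "Kinv (K x) = x"
proof -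
  have "K (Kinv x) = x \<and> Kinv (K x) = x"
    using assms by (induction rule: disc_induct)
      (simp_all add: K Kinv A.smult_smult A.smult_m_l A.smult_m_r pq mult.commute[of "q^2"])
  then show "K (Kinv x) = x" "Kinv (K x) = x" by auto
qed

text \<open>Both sides kill 1 and obey the Leibniz rule with left twist \<open>K\<close> and right
  twist \<open>K\<close> applied twice, so it suffices to compare them on \<open>z\<close> and
  \<open>zs\<close>.\<close>

lemma K_E:
  assumes "x \<in> carrier A" shows "K (E x) = q^2 \<odot>\<^bsub>A\<^esub> E (K x)"
proof (rule derivation_eqI[OF _ _ _ _ _ _ assms])
  have "K (E z) = q^2 \<odot>\<^bsub>A\<^esub> E (K z)"
    by (simp add: K E(4) expand pq pq_simps mult.assoc)
  moreover have "K (E zs) = q^2 \<odot>\<^bsub>A\<^esub> E (K zs)"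
    by (simp add: K E(5) expand ac_simps)
  ultimately show "K (E (gen_val z zs g)) = q^2 \<odot>\<^bsub>A\<^esub> E (K (gen_val z zs g))" for g
    by (cases g) simp_all
  show "K (E (gen_val z zs g \<otimes>\<^bsub>A\<^esub> x)) = K (gen_val z zs g) \<otimes>\<^bsub>A\<^esub> K (E x) \<oplus>\<^bsub>A\<^esub>
      K (E (gen_val z zs g)) \<otimes>\<^bsub>A\<^esub> K (K x)" if "x \<in> carrier A" for g x
    using that by simp
  show "q^2 \<odot>\<^bsub>A\<^esub> E (K (gen_val z zs g \<otimes>\<^bsub>A\<^esub> x)) = K (gen_val z zs g) \<otimes>\<^bsub>A\<^esub> (q^2 \<odot>\<^bsub>A\<^esub> E (K x)) \<oplus>\<^bsub>A\<^esub>
      (q^2 \<odot>\<^bsub>A\<^esub> E (K (gen_val z zs g))) \<otimes>\<^bsub>A\<^esub> K (K x)" if "x \<in> carrier A" for g x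
    using that by (simp add: A.smult_r_distr A.smult_m_l A.smult_m_r)
qed (simp_all add: A.linear_smult)

text \<open>As for \<open>K_E\<close>, except that on the left \<open>K\<close> cancels
  \<open>Kinv\<close>: the twists are the identity and \<open>K\<close>.\<close>

lemma K_F:
  assumes "x \<in> carrier A" shows "K (F x) = p \<odot>\<^bsub>A\<^esub> F (K x)"
proof (rule derivation_eqI[OF _ _ _ _ _ _ assms])
  have "K (F zs) = p \<odot>\<^bsub>A\<^esub> F (K zs)"
    by (simp add: K F(5) expand pq pq_simps mult.assoc)
  moreover have "K (F z) = p \<odot>\<^bsub>A\<^esub> F (K z)"
    by (simp add: K F(4) expand ac_simps)
  ultimately show "K (F (gen_val z zs g)) = p \<odot>\<^bsub>A\<^esub> F (K (gen_val z zs g))" for g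
    by (cases g) simp_all
  show "K (F (gen_val z zs g \<otimes>\<^bsub>A\<^esub> x)) = gen_val z zs g \<otimes>\<^bsub>A\<^esub> K (F x) \<oplus>\<^bsub>A\<^esub>
      K (F (gen_val z zs g)) \<otimes>\<^bsub>A\<^esub> K x" if "x \<in> carrier A" for g x
    using that by (simp add: K_Kinv)
  show "p \<odot>\<^bsub>A\<^esub> F (K (gen_val z zs g \<otimes>\<^bsub>A\<^esub> x)) = gen_val z zs g \<otimes>\<^bsub>A\<^esub> (p \<odot>\<^bsub>A\<^esub> F (K x)) \<oplus>\<^bsub>A\<^esub>
      (p \<odot>\<^bsub>A\<^esub> F (K (gen_val z zs g))) \<otimes>\<^bsub>A\<^esub> K x" if "x \<in> carrier A" for g x
    using that by (simp add: A.smult_r_distr A.smult_m_l A.smult_m_r K_Kinv)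
qed (simp_all add: A.linear_smult)

lemma E_Kinv:
  assumes "x \<in> carrier A" shows "E (Kinv x) = q^2 \<odot>\<^bsub>A\<^esub> Kinv (E x)"
  using arg_cong[OF K_E[of "Kinv x"], of Kinv] assms by (simp add: K_Kinv)

lemma F_K:
  assumes "x \<in> carrier A" shows "F (K x) = q^2 \<odot>\<^bsub>A\<^esub> K (F x)"
  using K_F[OF assms] assms pq by (simp add: A.smult_smult mult.commute)

abbreviation c where "c \<equiv> 1 / (q - inverse q)"

lemma EF_commutator_z:
  "E (F z) \<ominus>\<^bsub>A\<^esub> F (E z) = c \<odot>\<^bsub>A\<^esub> K z \<ominus>\<^bsub>A\<^esub> c \<odot>\<^bsub>A\<^esub> Kinv z"
proof -
  \<comment> \<open>The operators are applied and products multiplied out before words are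
    collected, since \<open>comb_z_simps\<close> folds the scalar multiples into coefficient
    pairs.\<close>
  have "E (F z) = comb_z (t2 * (s + p * s) + t2 * p * (s1 * (1 - p))) (t2 * s1 + t2 * p * (s1 * p))"
    by (simp add: F(4,5) E(4,5) K(2,3) expand) (simp add: words_z comb_z_simps, rule arg_cong2[where f = comb_z]; simp add: algebra_simps)
  moreover have "F (E z) = comb_z (s1 * q^2 * t) (s1 * t2 + s1 * q^2 * t1)"
    by (simp add: F(4,5) E(4,5) Kinv(2,3) expand) (simp add: words_z comb_z_simps, rule arg_cong2[where f = comb_z]; simp add: algebra_simps)
  moreover have "c \<odot>\<^bsub>A\<^esub> K z \<ominus>\<^bsub>A\<^esub> c \<odot>\<^bsub>A\<^esub> Kinv z = comb_z ((p - q^2) / (q - inverse q)) 0"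
    by (simp add: K(2,3) Kinv(2,3) expand) (simp add: comb_z_simps diff_divide_distrib)
  ultimately show ?thesis
    using scalar_identities(1,2) by (simp add: comb_z_simps diff_diff_add)
qed

lemma EF_commutator_zs:
  "E (F zs) \<ominus>\<^bsub>A\<^esub> F (E zs) = c \<odot>\<^bsub>A\<^esub> K zs \<ominus>\<^bsub>A\<^esub> c \<odot>\<^bsub>A\<^esub> Kinv zs"
proof -
  have "E (F zs) = comb_zs (t1 * q^2 * s) (t1 * s2 + t1 * q^2 * s1)"
    by (simp add: F(4,5) E(4,5) K(2,3) expand) (simp add: words_zs comb_zs_simps, rule arg_cong2[where f = comb_zs]; simp add: algebra_simps)
  moreover have "F (E zs) = comb_zs (s2 * (t + p * t + p * t1 * (1 - p))) (s2 * (t1 + p * t1 * p))"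
    by (simp add: F(4,5) E(4,5) Kinv(2,3) expand) (simp add: words_zs comb_zs_simps, rule arg_cong2[where f = comb_zs]; simp add: algebra_simps)
  moreover have "c \<odot>\<^bsub>A\<^esub> K zs \<ominus>\<^bsub>A\<^esub> c \<odot>\<^bsub>A\<^esub> Kinv zs = comb_zs ((q^2 - p) / (q - inverse q)) 0"
    by (simp add: K(2,3) Kinv(2,3) expand) (simp add: comb_zs_simps diff_divide_distrib)
  ultimately show ?thesis
    using scalar_identities(3,4) by (simp add: comb_zs_simps)
qed

text \<open>The shape of E (F (w x)) - F (E (w x)) after both Leibniz rules: \<open>a\<close> is F w
  times E x, which occurs in both parts, and \<open>m\<close> is the other mixed product. What
  remains is the rule for the commutator with twists \<open>Kinv\<close> and
  \<open>K\<close>.\<close>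

lemma cancel_middle:
  assumes "a \<in> carrier A" "b \<in> carrier A" "b' \<in> carrier A" "d \<in> carrier A" "d' \<in> carrier A" "m \<in> carrier A"
  shows "(b \<oplus>\<^bsub>A\<^esub> m \<oplus>\<^bsub>A\<^esub> (a \<oplus>\<^bsub>A\<^esub> d)) \<ominus>\<^bsub>A\<^esub> (b' \<oplus>\<^bsub>A\<^esub> a \<oplus>\<^bsub>A\<^esub> (m \<oplus>\<^bsub>A\<^esub> d')) = (b \<ominus>\<^bsub>A\<^esub> b') \<oplus>\<^bsub>A\<^esub> (d \<ominus>\<^bsub>A\<^esub> d')"
proof -
  have "(b \<oplus>\<^bsub>A\<^esub> m \<oplus>\<^bsub>A\<^esub> (a \<oplus>\<^bsub>A\<^esub> d)) \<ominus>\<^bsub>A\<^esub> (b' \<oplus>\<^bsub>A\<^esub> a \<oplus>\<^bsub>A\<^esub> (m \<oplus>\<^bsub>A\<^esub> d')) =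
    (m \<oplus>\<^bsub>A\<^esub> \<ominus>\<^bsub>A\<^esub> m) \<oplus>\<^bsub>A\<^esub> ((a \<oplus>\<^bsub>A\<^esub> \<ominus>\<^bsub>A\<^esub> a) \<oplus>\<^bsub>A\<^esub> ((b \<ominus>\<^bsub>A\<^esub> b') \<oplus>\<^bsub>A\<^esub> (d \<ominus>\<^bsub>A\<^esub> d')))"
    using assms by (simp add: A.minus_eq A.minus_add A.a_ac del: A.r_neg A.r_neg1 A.r_neg2)
  then show ?thesis using assms by (simp add: A.r_neg)
qed

lemma EF_commutator:
  assumes "x \<in> carrier A"
  shows "E (F x) \<ominus>\<^bsub>A\<^esub> F (E x) = c \<odot>\<^bsub>A\<^esub> K x \<ominus>\<^bsub>A\<^esub> c \<odot>\<^bsub>A\<^esub> Kinv x"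
proof (rule derivation_eqI[OF _ _ _ _ _ _ assms])
  have lin: "linear_map A A (\<lambda>x. f x \<ominus>\<^bsub>A\<^esub> g x)" if "linear_map A A f" "linear_map A A g" for f g
  proof -
    note fg = linear_mapD[OF that(1)] linear_mapD[OF that(2)]
    have "linear_map A A (\<lambda>x. f x \<oplus>\<^bsub>A\<^esub> (-1) \<odot>\<^bsub>A\<^esub> g x)"
      using that by (intro A.linear_add A.linear_smult)
    then show ?thesis
      by (rule linear_map_cong) (simp_all add: fg A.minus_eq A.a_inv_conv_smult A.complex_alg_axioms)
  qed
  show "linear_map A A (\<lambda>x. E (F x) \<ominus>\<^bsub>A\<^esub> F (E x))"
    by (rule lin[OF linear_map_comp[OF E(1) F(1)] linear_map_comp[OF F(1) E(1)]])
  show "linear_map A A (\<lambda>x. c \<odot>\<^bsub>A\<^esub> K x \<ominus>\<^bsub>A\<^esub> c \<odot>\<^bsub>A\<^esub> Kinv x)"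
    by (rule lin[OF A.linear_smult[OF algebra_hom_linear_map[OF K(1)]]
          A.linear_smult[OF algebra_hom_linear_map[OF Kinv(1)]]])
  show "E (F (gen_val z zs g)) \<ominus>\<^bsub>A\<^esub> F (E (gen_val z zs g)) =
    c \<odot>\<^bsub>A\<^esub> K (gen_val z zs g) \<ominus>\<^bsub>A\<^esub> c \<odot>\<^bsub>A\<^esub> Kinv (gen_val z zs g)" for g
    by (cases g) (simp_all only: gen_val_simps EF_commutator_z EF_commutator_zs)
  show "E (F \<one>\<^bsub>A\<^esub>) \<ominus>\<^bsub>A\<^esub> F (E \<one>\<^bsub>A\<^esub>) = c \<odot>\<^bsub>A\<^esub> K \<one>\<^bsub>A\<^esub> \<ominus>\<^bsub>A\<^esub> c \<odot>\<^bsub>A\<^esub> Kinv \<one>\<^bsub>A\<^esub>"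
    by (simp add: A.minus_eq A.r_neg)
next
  fix g x assume x: "x \<in> carrier A"
  define w where "w = gen_val z zs g"
  have w: "w \<in> carrier A" by (simp add: w_def)
  \<comment> \<open>The two remaining mixed products agree: moving \<open>Kinv\<close> out of
    \<open>E\<close> on the left leg and \<open>K\<close> out of \<open>F\<close> on the right leg
    produces the same factor q^2.\<close>
  have "E (Kinv w) \<otimes>\<^bsub>A\<^esub> K (F x) = Kinv (E w) \<otimes>\<^bsub>A\<^esub> F (K x)"
    using w x by (simp add: E_Kinv F_K A.smult_m_l A.smult_m_r)
  then show "E (F (gen_val z zs g \<otimes>\<^bsub>A\<^esub> x)) \<ominus>\<^bsub>A\<^esub> F (E (gen_val z zs g \<otimes>\<^bsub>A\<^esub> x)) =
    Kinv (gen_val z zs g) \<otimes>\<^bsub>A\<^esub> (E (F x) \<ominus>\<^bsub>A\<^esub> F (E x)) \<oplus>\<^bsub>A\<^esub>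
    (E (F (gen_val z zs g)) \<ominus>\<^bsub>A\<^esub> F (E (gen_val z zs g))) \<otimes>\<^bsub>A\<^esub> K x"
    unfolding w_def[symmetric] using w x
      cancel_middle[of "F w \<otimes>\<^bsub>A\<^esub> E x" "Kinv w \<otimes>\<^bsub>A\<^esub> E (F x)" "Kinv w \<otimes>\<^bsub>A\<^esub> F (E x)"
        "E (F w) \<otimes>\<^bsub>A\<^esub> K x" "F (E w) \<otimes>\<^bsub>A\<^esub> K x" "Kinv (E w) \<otimes>\<^bsub>A\<^esub> F (K x)"]
    by (simp add: A.r_diff_distr A.l_diff_distr)
  show "c \<odot>\<^bsub>A\<^esub> K (gen_val z zs g \<otimes>\<^bsub>A\<^esub> x) \<ominus>\<^bsub>A\<^esub> c \<odot>\<^bsub>A\<^esub> Kinv (gen_val z zs g \<otimes>\<^bsub>A\<^esub> x) =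
    Kinv (gen_val z zs g) \<otimes>\<^bsub>A\<^esub> (c \<odot>\<^bsub>A\<^esub> K x \<ominus>\<^bsub>A\<^esub> c \<odot>\<^bsub>A\<^esub> Kinv x) \<oplus>\<^bsub>A\<^esub>
    (c \<odot>\<^bsub>A\<^esub> K (gen_val z zs g) \<ominus>\<^bsub>A\<^esub> c \<odot>\<^bsub>A\<^esub> Kinv (gen_val z zs g)) \<otimes>\<^bsub>A\<^esub> K x"
    unfolding w_def[symmetric] using w x
      A.diff_telescope[of "c \<odot>\<^bsub>A\<^esub> (Kinv w \<otimes>\<^bsub>A\<^esub> K x)" "c \<odot>\<^bsub>A\<^esub> (Kinv w \<otimes>\<^bsub>A\<^esub> Kinv x)"
        "c \<odot>\<^bsub>A\<^esub> (K w \<otimes>\<^bsub>A\<^esub> K x)"]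
    by (simp add: A.r_diff_distr A.l_diff_distr A.smult_m_l A.smult_m_r)
qed

section \<open>From the operators to a symmetry\<close>

definition op_gen :: "uq_gen \<Rightarrow> disc_elem \<Rightarrow> disc_elem" where
  "op_gen g = restrict (case g of Gen_k \<Rightarrow> K | Gen_kinv \<Rightarrow> Kinv | Gen_e \<Rightarrow> E | Gen_f \<Rightarrow> F) (carrier A)"

lemma op_gen_apply:
  assumes "x \<in> carrier A"
  shows "op_gen Gen_k x = K x" "op_gen Gen_kinv x = Kinv x" "op_gen Gen_e x = E x" "op_gen Gen_f x = F x"
  using assms by (simp_all add: op_gen_def)

lemma op_gen_closed: "op_gen g \<in> carrier (End_algebra A)"
  unfolding op_gen_def by (rule A.EA_restrict) (cases g; simp)

lemma presented_hom_op_gen: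
  assumes p: "p = q powi (-2)"
  shows "presented_hom (End_algebra A) (uq_relations q) op_gen"
proof (rule presented_homI[OF A.complex_alg_EA op_gen_closed])
  interpret EA: complex_alg "End_algebra A" by (rule A.complex_alg_EA)
  note ap = A.EA_apply op_gen_apply
  have minus: "(f \<ominus>\<^bsub>End_algebra A\<^esub> g) x = f x \<ominus>\<^bsub>A\<^esub> g x"
    if "f \<in> carrier (End_algebra A)" "g \<in> carrier (End_algebra A)" "x \<in> carrier A" for f g x
    using that A.EA_closed[OF that(2,3)]
    by (simp add: EA.minus_eq A.minus_eq EA.a_inv_conv_smult A.a_inv_conv_smult A.EA_apply)
  note cl [simp] = op_gen_closed
  show "\<forall>r\<in>uq_relations q. eval_free (End_algebra A) op_gen r = \<zero>\<^bsub>End_algebra A\<^esub>"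
    unfolding EA.uq_relations_iff[OF op_gen_closed] p[symmetric]
  proof (intro conjI; rule A.EA_eqI)
    fix x assume x: "x \<in> carrier A"
    show "(op_gen Gen_kinv \<otimes>\<^bsub>End_algebra A\<^esub> op_gen Gen_k) x = \<one>\<^bsub>End_algebra A\<^esub> x"
      "(op_gen Gen_k \<otimes>\<^bsub>End_algebra A\<^esub> op_gen Gen_kinv) x = \<one>\<^bsub>End_algebra A\<^esub> x"
      using x by (simp_all add: ap K_Kinv)
    show "(op_gen Gen_k \<otimes>\<^bsub>End_algebra A\<^esub> op_gen Gen_e) x =
        (q^2 \<odot>\<^bsub>End_algebra A\<^esub> (op_gen Gen_e \<otimes>\<^bsub>End_algebra A\<^esub> op_gen Gen_k)) x"
      using x by (simp add: ap K_E)
    show "(op_gen Gen_k \<otimes>\<^bsub>End_algebra A\<^esub> op_gen Gen_f) x =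
        (p \<odot>\<^bsub>End_algebra A\<^esub> (op_gen Gen_f \<otimes>\<^bsub>End_algebra A\<^esub> op_gen Gen_k)) x"
      using x by (simp add: ap K_F)
    show "(op_gen Gen_e \<otimes>\<^bsub>End_algebra A\<^esub> op_gen Gen_f \<ominus>\<^bsub>End_algebra A\<^esub>
          op_gen Gen_f \<otimes>\<^bsub>End_algebra A\<^esub> op_gen Gen_e) x =
        (c \<odot>\<^bsub>End_algebra A\<^esub> op_gen Gen_k \<ominus>\<^bsub>End_algebra A\<^esub> c \<odot>\<^bsub>End_algebra A\<^esub> op_gen Gen_kinv) x"
      using x by (simp add: minus ap EF_commutator)
  qed simp_all
qed

lemma symmetry_exists:
  assumes p: "p = q powi (-2)"
  obtains \<pi> where "uq_disc_symmetry q \<pi>" "\<pi> (uq_k q) = op_gen Gen_k"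
    "\<pi> (uq_e q) = op_gen Gen_e" "\<pi> (uq_f q) = op_gen Gen_f"
proof -
  interpret h: presented_hom "End_algebra A" "uq_relations q" op_gen by (rule presented_hom_op_gen[OF p])
  let ?\<pi> = "extend_hom (End_algebra A) op_gen"
  have \<pi>: "?\<pi> \<in> algebra_hom (Uq_algebra q) (End_algebra A)"
    using h.extend_hom_algebra_hom unfolding Uq_algebra_def .
  \<comment> \<open>The rule for \<open>F\<close> lists its summands in the order opposite to the
    comultiplication of f, hence the appeal to commutativity of addition.\<close>
  interpret uq_action q A ?\<pi>
    by (intro uq_action.intro uq_action_axioms.intro A.complex_alg_axioms q_nonzero \<pi>)
      (simp_all add: op_gen_apply A.a_comm)
  show ?thesis
    using that[of ?\<pi>] hopf_symmetry unfolding uq_disc_symmetry_def uq_k_def uq_e_def uq_f_def by simp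
qed

end

section \<open>Construction of the operators\<close>

context disc_params
begin

text \<open>\<open>K\<close> and \<open>Kinv\<close> rescale \<open>z\<close> and \<open>zs\<close>
  by mutually inverse factors, so they fix both products in the disc relation. \<open>E\<close> and
  \<open>F\<close> come from \<open>disc_derivation_exists\<close> with twists (identity,
  \<open>K\<close>) and (\<open>Kinv\<close>, identity).\<close>

lemma ops_exist:
  obtains K Kinv E F where "disc_ops q p s0 a1 t0 b1 K Kinv E F"
proof -
  obtain K where K: "K \<in> algebra_hom A A" "K z = p \<odot>\<^bsub>A\<^esub> z" "K zs = q^2 \<odot>\<^bsub>A\<^esub> zs"
  proof (rule disc_hom_exists[OF A.complex_alg_axioms])
    show "(p \<odot>\<^bsub>A\<^esub> z) \<otimes>\<^bsub>A\<^esub> (q^2 \<odot>\<^bsub>A\<^esub> zs) =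
      q^2 \<odot>\<^bsub>A\<^esub> ((q^2 \<odot>\<^bsub>A\<^esub> zs) \<otimes>\<^bsub>A\<^esub> (p \<odot>\<^bsub>A\<^esub> z)) \<oplus>\<^bsub>A\<^esub> (1 - q^2) \<odot>\<^bsub>A\<^esub> \<one>\<^bsub>A\<^esub>"
      by (simp add: expand pq_simps pq disc_relation[symmetric])
  qed simp_all
  obtain Kinv where Kinv: "Kinv \<in> algebra_hom A A" "Kinv z = q^2 \<odot>\<^bsub>A\<^esub> z" "Kinv zs = p \<odot>\<^bsub>A\<^esub> zs"
  proof (rule disc_hom_exists[OF A.complex_alg_axioms])
    show "(q^2 \<odot>\<^bsub>A\<^esub> z) \<otimes>\<^bsub>A\<^esub> (p \<odot>\<^bsub>A\<^esub> zs) =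
      q^2 \<odot>\<^bsub>A\<^esub> ((p \<odot>\<^bsub>A\<^esub> zs) \<otimes>\<^bsub>A\<^esub> (q^2 \<odot>\<^bsub>A\<^esub> z)) \<oplus>\<^bsub>A\<^esub> (1 - q^2) \<odot>\<^bsub>A\<^esub> \<one>\<^bsub>A\<^esub>"
      by (simp add: expand pq_simps pq disc_relation[symmetric])
  qed simp_all
  let ?w = "z \<otimes>\<^bsub>A\<^esub> zs"
  obtain E where E: "linear_map A A E"
    "\<And>x y. \<lbrakk>x \<in> carrier A; y \<in> carrier A\<rbrakk> \<Longrightarrow> E (x \<otimes>\<^bsub>A\<^esub> y) = x \<otimes>\<^bsub>A\<^esub> E y \<oplus>\<^bsub>A\<^esub> E x \<otimes>\<^bsub>A\<^esub> K y"
    "E z = s \<odot>\<^bsub>A\<^esub> \<one>\<^bsub>A\<^esub> \<oplus>\<^bsub>A\<^esub> s1 \<odot>\<^bsub>A\<^esub> ?w" "E zs = s2 \<odot>\<^bsub>A\<^esub> (zs \<otimes>\<^bsub>A\<^esub> zs)" "E \<one>\<^bsub>A\<^esub> = \<zero>\<^bsub>A\<^esub>"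
  proof (rule disc_derivation_exists[OF id_algebra_hom K(1)])
    \<comment> \<open>The coefficients of zs and of z zs zs lead to one and the same condition, s1 =
      -p (1 + p) s2, because p differs from 1. The parameter \<open>a1\<close> describes its
      solutions, while \<open>s\<close> is unconstrained; this is where 1 + p and -q^2 come
      from.\<close>
    have "z \<otimes>\<^bsub>A\<^esub> (s2 \<odot>\<^bsub>A\<^esub> (zs \<otimes>\<^bsub>A\<^esub> zs)) \<oplus>\<^bsub>A\<^esub> (s \<odot>\<^bsub>A\<^esub> \<one>\<^bsub>A\<^esub> \<oplus>\<^bsub>A\<^esub> s1 \<odot>\<^bsub>A\<^esub> ?w) \<otimes>\<^bsub>A\<^esub> K zs =
      comb_zs (s * q^2) (s2 + s1 * q^2)"
      by (simp add: K(3) expand) (simp add: comb_zs_simps, rule arg_cong2[where f = comb_zs]; simp)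
    moreover have "q^2 \<odot>\<^bsub>A\<^esub> (zs \<otimes>\<^bsub>A\<^esub> (s \<odot>\<^bsub>A\<^esub> \<one>\<^bsub>A\<^esub> \<oplus>\<^bsub>A\<^esub> s1 \<odot>\<^bsub>A\<^esub> ?w) \<oplus>\<^bsub>A\<^esub>
        (s2 \<odot>\<^bsub>A\<^esub> (zs \<otimes>\<^bsub>A\<^esub> zs)) \<otimes>\<^bsub>A\<^esub> K z) =
      comb_zs (q^2 * (s + s1 * (1 - p) + s2 * p * (1 - p^2))) (q^2 * (s1 * p + s2 * p * p^2))"
      by (simp add: K(2) expand) (simp add: words_zs comb_zs_simps, rule arg_cong2[where f = comb_zs]; simp add: algebra_simps)
    moreover have "s * q^2 = q^2 * (s + s1 * (1 - p) + s2 * p * (1 - p^2))"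
    proof -
      have "q^2 * (s + s1 * (1 - p) + s2 * p * (1 - p^2)) =
        s * q^2 + q^2 * (1 - p^2) * a1 * (1 - p * q^2)"
        by (simp add: algebra_simps power2_eq_square)
      then show ?thesis by (simp add: pq)
    qed
    moreover have "s2 + s1 * q^2 = q^2 * (s1 * p + s2 * p * p^2)"
    proof -
      have "q^2 * (s1 * p + s2 * p * p^2) = a1 * (p * q^2) * (1 + p - p * (p * q^2))"
        by (simp add: algebra_simps power2_eq_square)
      moreover have "s2 + s1 * q^2 = a1 * (p * q^2)"
        by (simp add: algebra_simps)
      ultimately show ?thesis by (simp add: pq)
    qed
    ultimately show "z \<otimes>\<^bsub>A\<^esub> (s2 \<odot>\<^bsub>A\<^esub> (zs \<otimes>\<^bsub>A\<^esub> zs)) \<oplus>\<^bsub>A\<^esub> (s \<odot>\<^bsub>A\<^esub> \<one>\<^bsub>A\<^esub> \<oplus>\<^bsub>A\<^esub> s1 \<odot>\<^bsub>A\<^esub> ?w) \<otimes>\<^bsub>A\<^esub> K zs =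
      q^2 \<odot>\<^bsub>A\<^esub> (zs \<otimes>\<^bsub>A\<^esub> (s \<odot>\<^bsub>A\<^esub> \<one>\<^bsub>A\<^esub> \<oplus>\<^bsub>A\<^esub> s1 \<odot>\<^bsub>A\<^esub> ?w) \<oplus>\<^bsub>A\<^esub>
        (s2 \<odot>\<^bsub>A\<^esub> (zs \<otimes>\<^bsub>A\<^esub> zs)) \<otimes>\<^bsub>A\<^esub> K z)" by simp
  qed simp_all
  obtain F where F: "linear_map A A F"
    "\<And>x y. \<lbrakk>x \<in> carrier A; y \<in> carrier A\<rbrakk> \<Longrightarrow> F (x \<otimes>\<^bsub>A\<^esub> y) = Kinv x \<otimes>\<^bsub>A\<^esub> F y \<oplus>\<^bsub>A\<^esub> F x \<otimes>\<^bsub>A\<^esub> y"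
    "F z = t2 \<odot>\<^bsub>A\<^esub> (z \<otimes>\<^bsub>A\<^esub> z)" "F zs = t \<odot>\<^bsub>A\<^esub> \<one>\<^bsub>A\<^esub> \<oplus>\<^bsub>A\<^esub> t1 \<odot>\<^bsub>A\<^esub> ?w" "F \<one>\<^bsub>A\<^esub> = \<zero>\<^bsub>A\<^esub>"
  proof (rule disc_derivation_exists[OF Kinv(1) id_algebra_hom])
    \<comment> \<open>The condition on \<open>t1\<close> and \<open>t2\<close> is the same as that
      on \<open>s1\<close> and \<open>s2\<close>, with \<open>b1\<close> as its parameter.\<close>
    have "Kinv z \<otimes>\<^bsub>A\<^esub> (t \<odot>\<^bsub>A\<^esub> \<one>\<^bsub>A\<^esub> \<oplus>\<^bsub>A\<^esub> t1 \<odot>\<^bsub>A\<^esub> ?w) \<oplus>\<^bsub>A\<^esub> (t2 \<odot>\<^bsub>A\<^esub> (z \<otimes>\<^bsub>A\<^esub> z)) \<otimes>\<^bsub>A\<^esub> zs =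
      comb_z (q^2 * t) (q^2 * t1 + t2)"
      by (simp add: Kinv(2) expand) (simp add: comb_z_simps, rule arg_cong2[where f = comb_z]; simp)
    moreover have "q^2 \<odot>\<^bsub>A\<^esub> (Kinv zs \<otimes>\<^bsub>A\<^esub> (t2 \<odot>\<^bsub>A\<^esub> (z \<otimes>\<^bsub>A\<^esub> z)) \<oplus>\<^bsub>A\<^esub>
        (t \<odot>\<^bsub>A\<^esub> \<one>\<^bsub>A\<^esub> \<oplus>\<^bsub>A\<^esub> t1 \<odot>\<^bsub>A\<^esub> ?w) \<otimes>\<^bsub>A\<^esub> z) =
      comb_z (q^2 * (t + t1 * (1 - p) + t2 * p * (1 - p^2))) (q^2 * (t1 * p + t2 * p * p^2))"
      by (simp add: Kinv(3) expand) (simp add: words_z comb_z_simps, rule arg_cong2[where f = comb_z]; simp add: algebra_simps)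
    moreover have "q^2 * t = q^2 * (t + t1 * (1 - p) + t2 * p * (1 - p^2))"
    proof -
      have "q^2 * (t + t1 * (1 - p) + t2 * p * (1 - p^2)) =
        q^2 * t + q^2 * (1 - p^2) * b1 * (1 - p * q^2)"
        by (simp add: algebra_simps power2_eq_square)
      then show ?thesis by (simp add: pq)
    qed
    moreover have "q^2 * t1 + t2 = q^2 * (t1 * p + t2 * p * p^2)"
    proof -
      have "q^2 * (t1 * p + t2 * p * p^2) = b1 * (p * q^2) * (1 + p - p * (p * q^2))"
        by (simp add: algebra_simps power2_eq_square)
      moreover have "q^2 * t1 + t2 = b1 * (p * q^2)"
        by (simp add: algebra_simps)
      ultimately show ?thesis by (simp add: pq)
    qed
    ultimately show "Kinv z \<otimes>\<^bsub>A\<^esub> (t \<odot>\<^bsub>A\<^esub> \<one>\<^bsub>A\<^esub> \<oplus>\<^bsub>A\<^esub> t1 \<odot>\<^bsub>A\<^esub> ?w) \<oplus>\<^bsub>A\<^esub> (t2 \<odot>\<^bsub>A\<^esub> (z \<otimes>\<^bsub>A\<^esub> z)) \<otimes>\<^bsub>A\<^esub> zs =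
      q^2 \<odot>\<^bsub>A\<^esub> (Kinv zs \<otimes>\<^bsub>A\<^esub> (t2 \<odot>\<^bsub>A\<^esub> (z \<otimes>\<^bsub>A\<^esub> z)) \<oplus>\<^bsub>A\<^esub>
        (t \<odot>\<^bsub>A\<^esub> \<one>\<^bsub>A\<^esub> \<oplus>\<^bsub>A\<^esub> t1 \<odot>\<^bsub>A\<^esub> ?w) \<otimes>\<^bsub>A\<^esub> z)" by simp
  qed simp_all
  have "disc_ops q p s0 a1 t0 b1 K Kinv E F"
    by (intro disc_ops.intro disc_params_axioms disc_ops_axioms.intro K Kinv E F)
  then show ?thesis by (rule that)
qed

end

section \<open>The grading of the disc\<close>

context disc
begin

abbreviation monomials where
  "monomials k \<equiv> {(z [^]\<^bsub>A\<^esub> i) \<otimes>\<^bsub>A\<^esub> (zs [^]\<^bsub>A\<^esub> j) | (i::nat) (j::nat). int i - int j = k}"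

lemma monomials_carrier: "monomials k \<subseteq> carrier A"
  by (auto intro!: A.m_closed A.nat_pow_closed)

lemma grade_carrier: "x \<in> grade k \<Longrightarrow> x \<in> carrier A"
  unfolding disc_grade_def by (rule subsetD[OF A.lin_span_carrier[OF monomials_carrier]])

lemma grade_add: "\<lbrakk>x \<in> grade k; v \<in> grade k\<rbrakk> \<Longrightarrow> x \<oplus>\<^bsub>A\<^esub> v \<in> grade k"
  unfolding disc_grade_def by (rule A.lin_span_add[OF monomials_carrier])

lemma grade_smult: "x \<in> grade k \<Longrightarrow> c \<odot>\<^bsub>A\<^esub> x \<in> grade k"
  unfolding disc_grade_def by (rule A.lin_span_smult[OF monomials_carrier])

lemma grade_zero: "\<zero>\<^bsub>A\<^esub> \<in> grade k"
  unfolding disc_grade_def by (rule A.lin_span_zero)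

lemma grade_monomial:
  "(z [^]\<^bsub>A\<^esub> (i::nat)) \<otimes>\<^bsub>A\<^esub> (zs [^]\<^bsub>A\<^esub> (j::nat)) \<in> grade (int i - int j)"
  unfolding disc_grade_def by (rule A.lin_span_base[OF _ monomials_carrier]) blast

lemma one_grade: "\<one>\<^bsub>A\<^esub> \<in> grade 0"
  using grade_monomial[of 0 0] by simp

text \<open>A monomial is built by prefixing generators, first the powers of \<open>zs\<close> and
  then those of \<open>z\<close>. The degree is an argument of \<open>P\<close> because it changes
  along the way.\<close>

lemma grade_induct [consumes 1, case_names zero one z zs smult add]:
  assumes x: "x \<in> grade k"
    and zero: "\<And>k. P k \<zero>\<^bsub>A\<^esub>"
    and one: "P 0 \<one>\<^bsub>A\<^esub>"
    and z: "\<And>k x. \<lbrakk>x \<in> grade k; P k x\<rbrakk> \<Longrightarrow> P (k + 1) (z \<otimes>\<^bsub>A\<^esub> x)"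
    and zs: "\<And>k x. \<lbrakk>x \<in> grade k; P k x\<rbrakk> \<Longrightarrow> P (k - 1) (zs \<otimes>\<^bsub>A\<^esub> x)"
    and smult: "\<And>k c x. \<lbrakk>x \<in> carrier A; P k x\<rbrakk> \<Longrightarrow> P k (c \<odot>\<^bsub>A\<^esub> x)"
    and add: "\<And>k x y. \<lbrakk>x \<in> carrier A; y \<in> carrier A; P k x; P k y\<rbrakk> \<Longrightarrow> P k (x \<oplus>\<^bsub>A\<^esub> y)"
  shows "P k x"
proof -
  have zsj: "P (- int j) (zs [^]\<^bsub>A\<^esub> j) \<and> zs [^]\<^bsub>A\<^esub> j \<in> grade (- int j)" for j :: nat
  proof (induction j)
    case 0
    then show ?case using one one_grade by simp
  next
    case (Suc j)
    have "zs [^]\<^bsub>A\<^esub> Suc j = zs \<otimes>\<^bsub>A\<^esub> (zs [^]\<^bsub>A\<^esub> j)"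
      by (rule A.nat_pow_Suc2) simp
    then have "P (- int j - 1) (zs [^]\<^bsub>A\<^esub> Suc j)"
      using zs[of "zs [^]\<^bsub>A\<^esub> j" "- int j"] Suc by simp
    moreover have "- int j - 1 = - int (Suc j)" by simp
    moreover have "zs [^]\<^bsub>A\<^esub> Suc j \<in> grade (- int (Suc j))"
      using grade_monomial[of 0 "Suc j"] by (simp del: A.nat_pow_Suc of_nat_Suc)
    ultimately show ?case by metis
  qed
  have mono: "P (int i - int j) ((z [^]\<^bsub>A\<^esub> i) \<otimes>\<^bsub>A\<^esub> (zs [^]\<^bsub>A\<^esub> j))" for i j :: nat
  proof (induction i)
    case 0
    then show ?case using zsj[of j] by simp
  next
    case (Suc i)
    have "(z [^]\<^bsub>A\<^esub> Suc i) \<otimes>\<^bsub>A\<^esub> (zs [^]\<^bsub>A\<^esub> j) = z \<otimes>\<^bsub>A\<^esub> ((z [^]\<^bsub>A\<^esub> i) \<otimes>\<^bsub>A\<^esub> (zs [^]\<^bsub>A\<^esub> j))"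
      by (subst A.nat_pow_Suc2) (simp_all add: A.m_assoc)
    moreover have "int i - int j + 1 = int (Suc i) - int j" by simp
    ultimately show ?case using z[OF grade_monomial Suc] by metis
  qed
  from x have "x \<in> lin_span A (monomials k)" unfolding disc_grade_def .
  from this monomials_carrier show ?thesis
  proof (induction rule: A.lin_span_induct)
    case zero
    show ?case by (rule assms(2))
  next
    case (smult c s)
    then obtain i j :: nat where s: "s = (z [^]\<^bsub>A\<^esub> i) \<otimes>\<^bsub>A\<^esub> (zs [^]\<^bsub>A\<^esub> j)" "int i - int j = k"
      by blast
    show ?case using assms(6)[of s k c] mono[of i j] by (simp add: s(1) flip: s(2))
  next
    case (add x y)
    show ?case by (rule assms(7)[OF add])
  qed
qed

lemma grade_z:
  assumes "x \<in> grade k" shows "z \<otimes>\<^bsub>A\<^esub> x \<in> grade (k + 1)"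
proof -
  from assms have "x \<in> lin_span A (monomials k)" unfolding disc_grade_def .
  from this monomials_carrier show ?thesis
  proof (induction rule: A.lin_span_induct)
    case zero
    show ?case by (simp add: grade_zero)
  next
    case (smult c s)
    then obtain i j :: nat where s: "s = (z [^]\<^bsub>A\<^esub> i) \<otimes>\<^bsub>A\<^esub> (zs [^]\<^bsub>A\<^esub> j)" "int i - int j = k"
      by blast
    have "z \<otimes>\<^bsub>A\<^esub> s = (z [^]\<^bsub>A\<^esub> Suc i) \<otimes>\<^bsub>A\<^esub> (zs [^]\<^bsub>A\<^esub> j)"
      unfolding s(1) by (subst A.nat_pow_Suc2) (simp_all add: A.m_assoc)
    moreover have "int (Suc i) - int j = k + 1" using s(2) by simp
    ultimately have "z \<otimes>\<^bsub>A\<^esub> s \<in> grade (k + 1)" using grade_monomial[of "Suc i" j] by metis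
    then show ?case using s(1) by (simp add: A.smult_m_r grade_smult)
  next
    case (add x y)
    then show ?case by (simp add: A.r_distr grade_add)
  qed
qed

text \<open>The product of \<open>zs\<close> with a monomial is not in normal order, so
  \<open>zs\<close> is moved through the power of \<open>z\<close> by induction. Both terms of
  \<open>zs_z_left\<close> have the same degree.\<close>

lemma grade_zs:
  assumes "x \<in> grade k" shows "zs \<otimes>\<^bsub>A\<^esub> x \<in> grade (k - 1)"
proof -
  have mono: "zs \<otimes>\<^bsub>A\<^esub> ((z [^]\<^bsub>A\<^esub> i) \<otimes>\<^bsub>A\<^esub> (zs [^]\<^bsub>A\<^esub> j)) \<in> grade (int i - int j - 1)" for i j :: nat
  proof (induction i)
    case 0
    have "zs [^]\<^bsub>A\<^esub> Suc j = zs \<otimes>\<^bsub>A\<^esub> (zs [^]\<^bsub>A\<^esub> j)"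
      by (rule A.nat_pow_Suc2) simp
    then have "zs \<otimes>\<^bsub>A\<^esub> ((z [^]\<^bsub>A\<^esub> (0::nat)) \<otimes>\<^bsub>A\<^esub> (zs [^]\<^bsub>A\<^esub> j)) =
      (z [^]\<^bsub>A\<^esub> (0::nat)) \<otimes>\<^bsub>A\<^esub> (zs [^]\<^bsub>A\<^esub> Suc j)" by simp
    moreover have "int 0 - int (Suc j) = int 0 - int j - 1" by simp
    ultimately show ?case using grade_monomial[of 0 "Suc j"] by metis
  next
    case (Suc i)
    let ?x = "(z [^]\<^bsub>A\<^esub> i) \<otimes>\<^bsub>A\<^esub> (zs [^]\<^bsub>A\<^esub> j)"
    have "zs \<otimes>\<^bsub>A\<^esub> ((z [^]\<^bsub>A\<^esub> Suc i) \<otimes>\<^bsub>A\<^esub> (zs [^]\<^bsub>A\<^esub> j)) = zs \<otimes>\<^bsub>A\<^esub> (z \<otimes>\<^bsub>A\<^esub> ?x)"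
      by (subst A.nat_pow_Suc2) (simp_all add: A.m_assoc)
    also have "\<dots> = (1 - p) \<odot>\<^bsub>A\<^esub> ?x \<oplus>\<^bsub>A\<^esub> p \<odot>\<^bsub>A\<^esub> (z \<otimes>\<^bsub>A\<^esub> (zs \<otimes>\<^bsub>A\<^esub> ?x))"
      by (rule zs_z_left) simp
    also have "\<dots> \<in> grade (int i - int j)"
      using grade_z[OF Suc] grade_monomial[of i j] by (intro grade_add grade_smult) simp_all
    finally show ?case by simp
  qed
  from assms have "x \<in> lin_span A (monomials k)" unfolding disc_grade_def .
  from this monomials_carrier show ?thesis
  proof (induction rule: A.lin_span_induct)
    case zero
    show ?case by (simp add: grade_zero)
  next
    case (smult c s)
    then obtain i j :: nat where s: "s = (z [^]\<^bsub>A\<^esub> i) \<otimes>\<^bsub>A\<^esub> (zs [^]\<^bsub>A\<^esub> j)" "int i - int j = k"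
      by blast
    have "zs \<otimes>\<^bsub>A\<^esub> s \<in> grade (k - 1)" using mono[of i j] by (simp add: s(1) flip: s(2))
    then show ?case using s(1) by (simp add: A.smult_m_r grade_smult)
  next
    case (add x y)
    then show ?case by (simp add: A.r_distr grade_add)
  qed
qed

text \<open>Commuting numbers with product 1 satisfy the disc relation, because q^2 + (1 - q^2) =
  1.\<close>

lemma character_exists:
  assumes "u \<noteq> 0"
  obtains \<chi> where "\<chi> \<in> algebra_hom A complex_algebra" "\<chi> z = u" "\<chi> zs = inverse u"
  by (rule disc_hom_exists[OF complex_alg_complex_algebra, of u "inverse u"])
    (use assms in \<open>simp_all add: complex_algebra_def\<close>)

lemma complex_algebra_simps:
  "a \<otimes>\<^bsub>complex_algebra\<^esub> b = a * b" "a \<oplus>\<^bsub>complex_algebra\<^esub> b = a + b"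
  "a \<odot>\<^bsub>complex_algebra\<^esub> b = a * b" "\<one>\<^bsub>complex_algebra\<^esub> = 1" "\<zero>\<^bsub>complex_algebra\<^esub> = 0"
  by (simp_all add: complex_algebra_def)

text \<open>Replacing the character with u = 1 by the one with u = 2 multiplies the value at an
  element of degree k by 2^k, but leaves scalars unchanged. As 2 has modulus greater than 1, the
  equation 2^m = 1 forces m = 0.\<close>

lemma smult_one_grade:
  assumes x: "c \<odot>\<^bsub>A\<^esub> \<one>\<^bsub>A\<^esub> \<in> grade m" and c: "c \<noteq> 0"
  shows "m = 0"
proof -
  obtain \<chi> where \<chi>: "\<chi> \<in> algebra_hom A complex_algebra" "\<chi> z = 2" "\<chi> zs = inverse 2"
    by (rule character_exists[of 2]) simp_all
  obtain \<epsilon> where \<epsilon>: "\<epsilon> \<in> algebra_hom A complex_algebra" "\<epsilon> z = 1" "\<epsilon> zs = inverse 1"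
    by (rule character_exists[of 1]) simp_all
  note L = linear_mapD[OF algebra_hom_linear_map[OF \<chi>(1)]] linear_mapD[OF algebra_hom_linear_map[OF \<epsilon>(1)]]
    linear_map_zero[OF A.complex_alg_axioms complex_alg_complex_algebra algebra_hom_linear_map[OF \<chi>(1)]]
    linear_map_zero[OF A.complex_alg_axioms complex_alg_complex_algebra algebra_hom_linear_map[OF \<epsilon>(1)]]
    algebra_homD[OF \<chi>(1)] algebra_homD[OF \<epsilon>(1)]
  have "\<chi> x = 2 powi k * \<epsilon> x" if "x \<in> grade k" for x k
    using that
    by (induction rule: grade_induct)
      (simp_all add: L \<chi> \<epsilon> complex_algebra_simps grade_carrier power_int_add power_int_diff algebra_simps)
  from this[OF x] have "2 powi m = (1::complex)"
    using c by (simp add: L complex_algebra_simps)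
  then have "norm (2 powi m :: complex) = 1" by simp
  then have "(2::real) powi m = 1" by (simp add: norm_power_int)
  then have "\<not> m < 0" "\<not> 0 < m"
    using power_int_strict_increasing[of m 0 "2::real"] power_int_strict_increasing[of 0 m "2::real"]
    by auto
  then show "m = 0" by simp
qed

end

section \<open>Degrees of the operators and the grading jump\<close>

context disc_ops
begin

lemma K_grade: "x \<in> grade k \<Longrightarrow> K x \<in> grade k"
  by (induction rule: grade_induct)
    (simp_all add: grade_zero one_grade grade_carrier K A.smult_m_l grade_smult grade_z grade_zs grade_add)

lemma E_grade: "x \<in> grade k \<Longrightarrow> E x \<in> grade (k - 1)"
proof (induction rule: grade_induct)
  case (z k x)
  have "z \<otimes>\<^bsub>A\<^esub> (zs \<otimes>\<^bsub>A\<^esub> K x) \<in> grade k" using grade_z[OF grade_zs[OF K_grade[OF z(1)]]] by simp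
  moreover have "z \<otimes>\<^bsub>A\<^esub> E x \<in> grade k" using grade_z[OF z(2)] by simp
  ultimately show ?case
    using z K_grade[OF z(1)] by (simp add: grade_carrier E(4) expand grade_add grade_smult)
next
  case (zs k x)
  have "zs \<otimes>\<^bsub>A\<^esub> (zs \<otimes>\<^bsub>A\<^esub> K x) \<in> grade (k - 1 - 1)" by (intro grade_zs K_grade zs)
  moreover have "zs \<otimes>\<^bsub>A\<^esub> E x \<in> grade (k - 1 - 1)" by (intro grade_zs zs)
  ultimately show ?case
    using zs by (simp add: grade_carrier E(5) expand grade_add grade_smult)
qed (simp_all add: grade_zero grade_smult grade_add)

lemma F_grade: "x \<in> grade k \<Longrightarrow> F x \<in> grade (k + 1)"
proof (induction rule: grade_induct)
  case (z k x)
  have "z \<otimes>\<^bsub>A\<^esub> (z \<otimes>\<^bsub>A\<^esub> x) \<in> grade (k + 1 + 1)" by (intro grade_z z)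
  moreover have "z \<otimes>\<^bsub>A\<^esub> F x \<in> grade (k + 1 + 1)" by (intro grade_z z)
  ultimately show ?case
    using z by (simp add: grade_carrier F(4) Kinv expand grade_add grade_smult)
next
  case (zs k x)
  have "z \<otimes>\<^bsub>A\<^esub> (zs \<otimes>\<^bsub>A\<^esub> x) \<in> grade k" using grade_z[OF grade_zs[OF zs(1)]] by simp
  moreover have "zs \<otimes>\<^bsub>A\<^esub> F x \<in> grade k" using grade_zs[OF zs(2)] by simp
  ultimately show ?case
    using zs by (simp add: grade_carrier F(5) Kinv expand grade_add grade_smult)
qed (simp_all add: grade_zero grade_smult grade_add)

lemma grading_jump_eq:
  assumes \<pi>: "\<pi> (uq_e q) = op_gen Gen_e" "\<pi> (uq_f q) = op_gen Gen_f"
    and d: "d \<noteq> 0" "E z = d \<odot>\<^bsub>A\<^esub> \<one>\<^bsub>A\<^esub> \<or> F zs = d \<odot>\<^bsub>A\<^esub> \<one>\<^bsub>A\<^esub>"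
  shows "grading_jump q \<pi> = -1"
proof -
  \<comment> \<open>Zero lies in degree 1, where \<open>smult_one_grade\<close> allows no non-zero
    multiple of the unit. In particular the quotient defining the disc is not trivial.\<close>
  have dz: "d \<odot>\<^bsub>A\<^esub> \<one>\<^bsub>A\<^esub> \<noteq> \<zero>\<^bsub>A\<^esub>"
    using smult_one_grade[of d 1] grade_zero[of 1] d(1) by auto
  have nz: "\<not> (\<pi> (uq_e q) = \<zero>\<^bsub>End_algebra A\<^esub> \<and> \<pi> (uq_f q) = \<zero>\<^bsub>End_algebra A\<^esub>)"
    using d(2) dz op_gen_apply[OF z_closed] op_gen_apply[OF zs_closed] A.EA_apply(5)
    unfolding \<pi> by (metis z_closed zs_closed)
  have "is_grading_jump q \<pi> (-1)"
    unfolding is_grading_jump_def \<pi>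
  proof (intro conjI allI image_subsetI)
    show "op_gen Gen_e x \<in> grade (k + -1)" if "x \<in> grade k" for k x
      using E_grade[OF that] grade_carrier[OF that] by (simp add: op_gen_apply)
    show "op_gen Gen_f x \<in> grade (k - -1)" if "x \<in> grade k" for k x
      using F_grade[OF that] grade_carrier[OF that] by (simp add: op_gen_apply)
  qed simp
  moreover have "n = -1" if n: "is_grading_jump q \<pi> n" for n
  proof -
    have z: "z \<in> grade 1" using grade_monomial[of 1 0] by simp
    have zs: "zs \<in> grade (-1)" using grade_monomial[of 0 1] by simp
    have "op_gen Gen_e ` grade 1 \<subseteq> grade (1 + n)" "op_gen Gen_f ` grade (-1) \<subseteq> grade (-1 - n)"
      using n unfolding is_grading_jump_def \<pi> by blast+
    then have "E z \<in> grade (1 + n)" "F zs \<in> grade (-1 - n)"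
      using z zs op_gen_apply[OF z_closed] op_gen_apply[OF zs_closed] by (metis image_subset_iff)+
    then show ?thesis using smult_one_grade[OF _ d(1)] d(2) by fastforce
  qed
  ultimately have "(THE n. is_grading_jump q \<pi> n) = -1" by (rule the_equality)
  then show ?thesis unfolding grading_jump_def using nz by simp
qed

text \<open>The value at \<open>y\<close> follows from those at the generators through y = 1 - z zs
  and the Leibniz rule. The identity p q^2 = 1 reduces the coefficient of z zs zs to
  \<open>a1\<close>, up to sign.\<close>

lemma E_y: "E y = comb_zs (q^2 * ((1 + p) * a1 - s0)) (- a1)"
proof -
  have "E y = E \<one>\<^bsub>A\<^esub> \<ominus>\<^bsub>A\<^esub> E (z \<otimes>\<^bsub>A\<^esub> zs)"
    unfolding disc_y_def by (rule ops_minus(3)) simp_all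
  also have "E (z \<otimes>\<^bsub>A\<^esub> zs) = comb_zs (q^2 * s) (s2 + q^2 * s1)"
    by (simp add: E(4,5) K(3) expand) (simp add: comb_zs_simps)
  also have "s2 + q^2 * s1 = a1"
  proof -
    have "s2 + q^2 * s1 = a1 * (p * q^2)" by (simp add: algebra_simps)
    then show ?thesis by (simp add: pq)
  qed
  finally show ?thesis
    by (simp add: A.minus_eq) (simp add: A.comb_closed comb_zs_simps algebra_simps)
qed

lemma F_y: "F y = comb_z (q^2 * ((1 + p) * b1 - t0)) (- b1)"
proof -
  have "F y = F \<one>\<^bsub>A\<^esub> \<ominus>\<^bsub>A\<^esub> F (z \<otimes>\<^bsub>A\<^esub> zs)"
    unfolding disc_y_def by (rule ops_minus(4)) simp_all
  also have "F (z \<otimes>\<^bsub>A\<^esub> zs) = comb_z (q^2 * t) (t2 + q^2 * t1)"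
    by (simp add: F(4,5) Kinv(2) expand) (simp add: comb_z_simps, rule arg_cong2[where f = comb_z]; simp)
  also have "t2 + q^2 * t1 = b1"
  proof -
    have "t2 + q^2 * t1 = b1 * (p * q^2)" by (simp add: algebra_simps)
    then show ?thesis by (simp add: pq)
  qed
  finally show ?thesis
    by (simp add: A.minus_eq) (simp add: A.comb_closed comb_z_simps algebra_simps)
qed

end

section \<open>Affine expressions in \<open>y\<close> written in normal words\<close>

context disc
begin

lemma affine_y: "a \<odot>\<^bsub>A\<^esub> \<one>\<^bsub>A\<^esub> \<ominus>\<^bsub>A\<^esub> b \<odot>\<^bsub>A\<^esub> y = (a - b) \<odot>\<^bsub>A\<^esub> \<one>\<^bsub>A\<^esub> \<oplus>\<^bsub>A\<^esub> b \<odot>\<^bsub>A\<^esub> (z \<otimes>\<^bsub>A\<^esub> zs)"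
proof -
  have "y = A.comb \<one>\<^bsub>A\<^esub> (z \<otimes>\<^bsub>A\<^esub> zs) 1 (-1)"
    by (simp add: disc_y_def A.comb_def A.minus_eq A.a_inv_conv_smult)
  moreover have "a \<odot>\<^bsub>A\<^esub> \<one>\<^bsub>A\<^esub> = A.comb \<one>\<^bsub>A\<^esub> (z \<otimes>\<^bsub>A\<^esub> zs) a 0" by (simp add: A.comb_def)
  ultimately have "a \<odot>\<^bsub>A\<^esub> \<one>\<^bsub>A\<^esub> \<ominus>\<^bsub>A\<^esub> b \<odot>\<^bsub>A\<^esub> y = A.comb \<one>\<^bsub>A\<^esub> (z \<otimes>\<^bsub>A\<^esub> zs) (a - b) b"
    by (simp only: A.comb_smult A.comb_minus A.one_closed A.m_closed z_closed zs_closed) simp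
  then show ?thesis by (simp add: A.comb_def)
qed

lemma affine_y': "a \<odot>\<^bsub>A\<^esub> \<one>\<^bsub>A\<^esub> \<oplus>\<^bsub>A\<^esub> b \<odot>\<^bsub>A\<^esub> y = (a + b) \<odot>\<^bsub>A\<^esub> \<one>\<^bsub>A\<^esub> \<oplus>\<^bsub>A\<^esub> (- b) \<odot>\<^bsub>A\<^esub> (z \<otimes>\<^bsub>A\<^esub> zs)"
  using affine_y[of a "- b"] by (simp add: A.minus_eq A.smult_minus)

lemma affine_y_zs: "(a \<odot>\<^bsub>A\<^esub> \<one>\<^bsub>A\<^esub> \<oplus>\<^bsub>A\<^esub> b \<odot>\<^bsub>A\<^esub> y) \<otimes>\<^bsub>A\<^esub> zs = comb_zs (a + b) (- b)"
  unfolding affine_y' by (simp add: expand A.comb_def)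

lemma z_affine_y: "z \<otimes>\<^bsub>A\<^esub> (a \<odot>\<^bsub>A\<^esub> \<one>\<^bsub>A\<^esub> \<oplus>\<^bsub>A\<^esub> b \<odot>\<^bsub>A\<^esub> y) = comb_z (a + b) (- b)"
  unfolding affine_y' by (simp add: expand A.comb_def)

end

text \<open>The last assumption says that e sends \<open>z\<close>, or f sends \<open>zs\<close>, to
  the non-zero scalar \<open>d\<close>; this fixes the grading jump. The first alternative occurs in
  series (-1a), the second in (-1b).\<close>

lemma (in disc_params) symmetry:
  assumes p: "p = q powi (-2)" and d: "d \<noteq> 0" "s0 = d \<and> a1 = 0 \<or> t0 = d \<and> b1 = 0"
  obtains \<pi> where "uq_disc_symmetry q \<pi>" "grading_jump q \<pi> = -1"
    "\<pi> (uq_k q) z = p \<odot>\<^bsub>A\<^esub> z" "\<pi> (uq_k q) zs = q^2 \<odot>\<^bsub>A\<^esub> zs"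
    "\<pi> (uq_e q) y = comb_zs (q^2 * ((1 + p) * a1 - s0)) (- a1)"
    "\<pi> (uq_f q) y = comb_z (q^2 * ((1 + p) * b1 - t0)) (- b1)"
    "\<pi> (uq_e q) z = s0 \<odot>\<^bsub>A\<^esub> \<one>\<^bsub>A\<^esub> \<ominus>\<^bsub>A\<^esub> s1 \<odot>\<^bsub>A\<^esub> y"
    "\<pi> (uq_f q) z = t2 \<odot>\<^bsub>A\<^esub> (z \<otimes>\<^bsub>A\<^esub> z)"
    "\<pi> (uq_e q) zs = s2 \<odot>\<^bsub>A\<^esub> (zs \<otimes>\<^bsub>A\<^esub> zs)"
    "\<pi> (uq_f q) zs = t0 \<odot>\<^bsub>A\<^esub> \<one>\<^bsub>A\<^esub> \<ominus>\<^bsub>A\<^esub> t1 \<odot>\<^bsub>A\<^esub> y"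
proof -
  obtain K Kinv E F where "disc_ops q p s0 a1 t0 b1 K Kinv E F" by (rule ops_exist)
  then interpret disc_ops q p s0 a1 t0 b1 K Kinv E F .
  obtain \<pi> where \<pi>: "uq_disc_symmetry q \<pi>" "\<pi> (uq_k q) = op_gen Gen_k"
    "\<pi> (uq_e q) = op_gen Gen_e" "\<pi> (uq_f q) = op_gen Gen_f"
    by (rule symmetry_exists[OF p])
  have "E z = d \<odot>\<^bsub>A\<^esub> \<one>\<^bsub>A\<^esub> \<or> F zs = d \<odot>\<^bsub>A\<^esub> \<one>\<^bsub>A\<^esub>"
    using d(2) by (elim disjE conjE) (simp_all add: E(4) F(5))
  then have "grading_jump q \<pi> = -1" by (rule grading_jump_eq[OF \<pi>(3,4) d(1)])
  then show ?thesis
    using \<pi> by (intro that[of \<pi>])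
      (simp_all only: op_gen_apply y_closed z_closed zs_closed K(2,3) E_y F_y E(4,5) F(4,5) affine_y)
qed

section \<open>The two series as members of the family\<close>

lemma exists_symmetry_a:
  fixes q b0 b1 :: complex
  assumes q: "q \<noteq> 0" "q^2 \<noteq> 1" and b1: "b1 \<noteq> 0"
  defines "A \<equiv> Pol_disc q" and "z \<equiv> disc_z q" and "zs \<equiv> disc_zs q" and "y \<equiv> disc_y q"
  shows "\<exists>\<pi>. uq_disc_symmetry q \<pi> \<and> grading_jump q \<pi> = -1 \<and>
          \<pi> (uq_k q) z = q powi (-2) \<odot>\<^bsub>A\<^esub> z \<and>
          \<pi> (uq_k q) zs = q ^ 2 \<odot>\<^bsub>A\<^esub> zs \<and>
          \<pi> (uq_e q) y = (- q * inverse b1) \<odot>\<^bsub>A\<^esub> zs \<and>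
          \<pi> (uq_f q) y = z \<otimes>\<^bsub>A\<^esub> (b0 \<odot>\<^bsub>A\<^esub> \<one>\<^bsub>A\<^esub> \<oplus>\<^bsub>A\<^esub> b1 \<odot>\<^bsub>A\<^esub> y) \<and>
          \<pi> (uq_e q) z = (inverse q * inverse b1) \<odot>\<^bsub>A\<^esub> \<one>\<^bsub>A\<^esub> \<and>
          \<pi> (uq_f q) z = (- (q ^ 2) * b1) \<odot>\<^bsub>A\<^esub> (z \<otimes>\<^bsub>A\<^esub> z) \<and>
          \<pi> (uq_e q) zs = \<zero>\<^bsub>A\<^esub> \<and>
          \<pi> (uq_f q) zs = (- (q powi (-2)) * b0 + b1) \<odot>\<^bsub>A\<^esub> \<one>\<^bsub>A\<^esub>
                   \<ominus>\<^bsub>A\<^esub> ((1 + q powi (-2)) * b1) \<odot>\<^bsub>A\<^esub> y"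
proof -
  define p where "p = q powi (-2)"
  have pq: "p * q^2 = 1" using q by (simp add: p_def power_int_minus)
  \<comment> \<open>With a1 = 0 the normalization reads q b1 s0 = 1, which gives \<open>s0\<close>.
    The value of \<open>t0\<close> is the constant term prescribed for f at
    \<open>zs\<close>.\<close>
  interpret disc_params q p "inverse q * inverse b1" 0 "- p * b0 + b1" b1
    using pq q b1 by unfold_locales (simp_all add: mult.left_commute[of b1])
  \<comment> \<open>The zero parameter is left unevaluated, so that the facts match the conclusions
    of \<open>symmetry\<close> literally.\<close>
  obtain \<pi> where \<pi>: "uq_disc_symmetry q \<pi>" "grading_jump q \<pi> = -1"
    "\<pi> (uq_k q) z = p \<odot>\<^bsub>A\<^esub> z" "\<pi> (uq_k q) zs = q^2 \<odot>\<^bsub>A\<^esub> zs"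
    "\<pi> (uq_e q) y = comb_zs (q^2 * ((1 + p) * 0 - inverse q * inverse b1)) (- 0)"
    "\<pi> (uq_f q) y = comb_z (q^2 * ((1 + p) * b1 - (- p * b0 + b1))) (- b1)"
    "\<pi> (uq_e q) z = (inverse q * inverse b1) \<odot>\<^bsub>A\<^esub> \<one>\<^bsub>A\<^esub> \<ominus>\<^bsub>A\<^esub> ((1 + p) * 0) \<odot>\<^bsub>A\<^esub> y"
    "\<pi> (uq_f q) z = (- (q^2) * b1) \<odot>\<^bsub>A\<^esub> (z \<otimes>\<^bsub>A\<^esub> z)"
    "\<pi> (uq_e q) zs = (- (q^2) * 0) \<odot>\<^bsub>A\<^esub> (zs \<otimes>\<^bsub>A\<^esub> zs)"
    "\<pi> (uq_f q) zs = (- p * b0 + b1) \<odot>\<^bsub>A\<^esub> \<one>\<^bsub>A\<^esub> \<ominus>\<^bsub>A\<^esub> ((1 + p) * b1) \<odot>\<^bsub>A\<^esub> y"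
    unfolding A_def z_def zs_def y_def
    by (rule symmetry[OF p_def, of "inverse q * inverse b1"]) (use q b1 in simp_all)
  have e: "q^2 * ((1 + p) * 0 - inverse q * inverse b1) = - q * inverse b1"
    using q by (simp add: power2_eq_square field_simps)
  have f: "q^2 * ((1 + p) * b1 - (- p * b0 + b1)) = b0 + b1"
  proof -
    have "q^2 * ((1 + p) * b1 - (- p * b0 + b1)) = (p * q^2) * (b0 + b1)" by (simp add: algebra_simps)
    then show ?thesis by (simp add: pq)
  qed
  show ?thesis
    using \<pi> unfolding e f p_def[symmetric] A_def z_def zs_def y_def
    by (intro exI[of _ \<pi>]) (simp add: z_affine_y A.comb_def A.minus_eq)
qed

lemma exists_symmetry_b:
  fixes q a0 a1 :: complex
  assumes q: "q \<noteq> 0" "q^2 \<noteq> 1" and a1: "a1 \<noteq> 0"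
  defines "A \<equiv> Pol_disc q" and "z \<equiv> disc_z q" and "zs \<equiv> disc_zs q" and "y \<equiv> disc_y q"
  shows "\<exists>\<pi>. uq_disc_symmetry q \<pi> \<and> grading_jump q \<pi> = -1 \<and>
          \<pi> (uq_k q) z = q powi (-2) \<odot>\<^bsub>A\<^esub> z \<and>
          \<pi> (uq_k q) zs = q ^ 2 \<odot>\<^bsub>A\<^esub> zs \<and>
          \<pi> (uq_e q) y = (a0 \<odot>\<^bsub>A\<^esub> \<one>\<^bsub>A\<^esub> \<oplus>\<^bsub>A\<^esub> a1 \<odot>\<^bsub>A\<^esub> y) \<otimes>\<^bsub>A\<^esub> zs \<and>
          \<pi> (uq_f q) y = (- q * inverse a1) \<odot>\<^bsub>A\<^esub> z \<and>
          \<pi> (uq_e q) z = (- (q powi (-2)) * a0 + a1) \<odot>\<^bsub>A\<^esub> \<one>\<^bsub>A\<^esub>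
                  \<ominus>\<^bsub>A\<^esub> ((1 + q powi (-2)) * a1) \<odot>\<^bsub>A\<^esub> y \<and>
          \<pi> (uq_f q) z = \<zero>\<^bsub>A\<^esub> \<and>
          \<pi> (uq_e q) zs = (- (q ^ 2) * a1) \<odot>\<^bsub>A\<^esub> (zs \<otimes>\<^bsub>A\<^esub> zs) \<and>
          \<pi> (uq_f q) zs = (inverse q * inverse a1) \<odot>\<^bsub>A\<^esub> \<one>\<^bsub>A\<^esub>"
proof -
  define p where "p = q powi (-2)"
  have pq: "p * q^2 = 1" using q by (simp add: p_def power_int_minus)
  \<comment> \<open>Now b1 = 0, the normalization gives t0 = 1 / (q a1), and \<open>s0\<close> is
    the constant term prescribed for e at \<open>z\<close>.\<close>
  interpret disc_params q p "- p * a0 + a1" a1 "inverse q * inverse a1" 0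
    using pq q a1 by unfold_locales (simp_all add: mult.left_commute[of a1])
  obtain \<pi> where \<pi>: "uq_disc_symmetry q \<pi>" "grading_jump q \<pi> = -1"
    "\<pi> (uq_k q) z = p \<odot>\<^bsub>A\<^esub> z" "\<pi> (uq_k q) zs = q^2 \<odot>\<^bsub>A\<^esub> zs"
    "\<pi> (uq_e q) y = comb_zs (q^2 * ((1 + p) * a1 - (- p * a0 + a1))) (- a1)"
    "\<pi> (uq_f q) y = comb_z (q^2 * ((1 + p) * 0 - inverse q * inverse a1)) (- 0)"
    "\<pi> (uq_e q) z = (- p * a0 + a1) \<odot>\<^bsub>A\<^esub> \<one>\<^bsub>A\<^esub> \<ominus>\<^bsub>A\<^esub> ((1 + p) * a1) \<odot>\<^bsub>A\<^esub> y"
    "\<pi> (uq_f q) z = (- (q^2) * 0) \<odot>\<^bsub>A\<^esub> (z \<otimes>\<^bsub>A\<^esub> z)"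
    "\<pi> (uq_e q) zs = (- (q^2) * a1) \<odot>\<^bsub>A\<^esub> (zs \<otimes>\<^bsub>A\<^esub> zs)"
    "\<pi> (uq_f q) zs = (inverse q * inverse a1) \<odot>\<^bsub>A\<^esub> \<one>\<^bsub>A\<^esub> \<ominus>\<^bsub>A\<^esub> ((1 + p) * 0) \<odot>\<^bsub>A\<^esub> y"
    unfolding A_def z_def zs_def y_def
    by (rule symmetry[OF p_def, of "inverse q * inverse a1"]) (use q a1 in simp_all)
  have f: "q^2 * ((1 + p) * 0 - inverse q * inverse a1) = - q * inverse a1"
    using q by (simp add: power2_eq_square field_simps)
  have e: "q^2 * ((1 + p) * a1 - (- p * a0 + a1)) = a0 + a1"
  proof -
    have "q^2 * ((1 + p) * a1 - (- p * a0 + a1)) = (p * q^2) * (a0 + a1)" by (simp add: algebra_simps)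
    then show ?thesis by (simp add: pq)
  qed
  show ?thesis
    using \<pi> unfolding e f p_def[symmetric] A_def z_def zs_def y_def
    by (intro exI[of _ \<pi>]) (simp add: affine_y_zs A.comb_def A.minus_eq)
qed

theorem theorem5p2:
  fixes q :: complex
  assumes q_nonzero: "q \<noteq> 0"
    and q_not_root_of_unity: "\<forall>n::nat. n > 0 \<longrightarrow> q ^ n \<noteq> 1"
  shows
    "let A = Pol_disc q; z = disc_z q; zs = disc_zs q; y = disc_y q;
         k = uq_k q; e = uq_e q; f = uq_f q
     in
      (\<forall>b0 b1 :: complex. b1 \<noteq> 0 \<longrightarrow>
        (\<exists>\<pi>. uq_disc_symmetry q \<pi> \<and> grading_jump q \<pi> = -1 \<and>
          \<pi> k z = q powi (-2) \<odot>\<^bsub>A\<^esub> z \<and>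
          \<pi> k zs = q ^ 2 \<odot>\<^bsub>A\<^esub> zs \<and>
          \<pi> e y = (- q * inverse b1) \<odot>\<^bsub>A\<^esub> zs \<and>
          \<pi> f y = z \<otimes>\<^bsub>A\<^esub> (b0 \<odot>\<^bsub>A\<^esub> \<one>\<^bsub>A\<^esub> \<oplus>\<^bsub>A\<^esub> b1 \<odot>\<^bsub>A\<^esub> y) \<and>
          \<pi> e z = (inverse q * inverse b1) \<odot>\<^bsub>A\<^esub> \<one>\<^bsub>A\<^esub> \<and>
          \<pi> f z = (- (q ^ 2) * b1) \<odot>\<^bsub>A\<^esub> (z \<otimes>\<^bsub>A\<^esub> z) \<and>
          \<pi> e zs = \<zero>\<^bsub>A\<^esub> \<and>
          \<pi> f zs = (- (q powi (-2)) * b0 + b1) \<odot>\<^bsub>A\<^esub> \<one>\<^bsub>A\<^esub>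
                   \<ominus>\<^bsub>A\<^esub> ((1 + q powi (-2)) * b1) \<odot>\<^bsub>A\<^esub> y)) \<and>
      (\<forall>a0 a1 :: complex. a1 \<noteq> 0 \<longrightarrow>
        (\<exists>\<pi>. uq_disc_symmetry q \<pi> \<and> grading_jump q \<pi> = -1 \<and>
          \<pi> k z = q powi (-2) \<odot>\<^bsub>A\<^esub> z \<and>
          \<pi> k zs = q ^ 2 \<odot>\<^bsub>A\<^esub> zs \<and>
          \<pi> e y = (a0 \<odot>\<^bsub>A\<^esub> \<one>\<^bsub>A\<^esub> \<oplus>\<^bsub>A\<^esub> a1 \<odot>\<^bsub>A\<^esub> y) \<otimes>\<^bsub>A\<^esub> zs \<and>
          \<pi> f y = (- q * inverse a1) \<odot>\<^bsub>A\<^esub> z \<and>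
          \<pi> e z = (- (q powi (-2)) * a0 + a1) \<odot>\<^bsub>A\<^esub> \<one>\<^bsub>A\<^esub>
                  \<ominus>\<^bsub>A\<^esub> ((1 + q powi (-2)) * a1) \<odot>\<^bsub>A\<^esub> y \<and>
          \<pi> f z = \<zero>\<^bsub>A\<^esub> \<and>
          \<pi> e zs = (- (q ^ 2) * a1) \<odot>\<^bsub>A\<^esub> (zs \<otimes>\<^bsub>A\<^esub> zs) \<and>
          \<pi> f zs = (inverse q * inverse a1) \<odot>\<^bsub>A\<^esub> \<one>\<^bsub>A\<^esub>))"
proof -
  \<comment> \<open>This makes q - 1/q invertible, as the relation between e and f demands.\<close>
  have "q^2 \<noteq> 1" using q_not_root_of_unity by simp
  then show ?thesis
    using exists_symmetry_a[OF q_nonzero] exists_symmetry_b[OF q_nonzero] by (simp add: Let_def)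
qed

end
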